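(* Let $X$ be a Banach function space on the unit circle $\mathbb{T}$ on which the Riesz projection $P$ is bounded. Then the following statements are equivalent: (i) the equality $\|T(\mathbf{e}_{-1})\|_{\mathcal{B}(H[X]),\mathrm{e}} = 1$ holds for the backward shift operator $T(\mathbf{e}_{-1}) : H[X] \to H[X]$; (ii) the equality $\|T(a)\|_{\mathcal{B}(H[X]),\mathrm{e}} = \|a\|_{L^\infty}$ holds for every Toeplitz operator $T(a):H[X]\to H[X]$ with $a \in C + H^\infty$.
   Context: Let $\mathbb{T}=\{z\in\mathbb{C}: |z|=1\}$ be equipped with the Lebesgue measure $m$ normalised so that $m(\mathbb{T})=1$; $L^p=L^p(\mathbb{T},m)$. Banach function spaces: let $\mathcal{M}$ be the set of all measurable complex-valued functions on $\mathbb{T}$ and let $\mathcal{M}^+$ be the set of measurable functions on $\mathbb{T}$ with values in $[0,\infty]$. A mapping $\rho:\mathcal{M}^+\to[0,\infty]$ is called a Banach function norm if for all $f,g,f_n\in\mathcal{M}^+$ ($n\in\mathbb{N}$) and all constants $a\ge 0$: (A1) $\rho(f)=0 \Leftrightarrow f=0$ a.e., $\rho(af)=a\rho(f)$, $\rho(f+g)\le\rho(f)+\rho(g)$; (A2) $0\le g\le f$ a.e. implies $\rho(g)\le\rho(f)$; (A3) $0\le f_n\uparrow f$ a.e. implies $\rho(f_n)\uparrow\rho(f)$; (A4) $\rho(1)<\infty$; (A5) $\int_{\mathbb{T}} f\,dm\le C\rho(f)$ with a constant $C\in(0,\infty)$ that may depend on $\rho$ but not on $f$. Identifying functions equal a.e.,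 the set $X$ of all $f\in\mathcal{M}$ with $\rho(|f|)<\infty$, with norm $\|f\|_X:=\rho(|f|)$, is called a Banach function space; it is a Banach space. By (A5), $X\subset L^1$. For $f\in L^1$, $\widehat{f}(n)=\frac{1}{2\pi}\int_{-\pi}^{\pi} f(e^{i\theta})e^{-in\theta}\,d\theta$, $n\in\mathbb{Z}$, are its Fourier coefficients. The abstract Hardy space built upon $X$ is $H[X]:=\{g\in X: \widehat{g}(n)=0 \text{ for all } n<0\}$ with the norm of $X$; $H^p:=H[L^p]$ for $1\le p\le\infty$. $C$ is the Banach space of complex-valued continuous functions on $\mathbb{T}$ with the supremum norm, and $C+H^\infty:=\{f\in L^\infty: f=g+h,\ g\in C,\ h\in H^\infty\}$. The Cauchy singular integral operator $S$ and the Riesz projection $P$ are defined for $f\in L^1$ and a.e. $t\in\mathbb{T}$ by $$(Sf)(t):=\frac{1}{\pi i}\,\mathrm{p.v.}\int_{\mathbb{T}}\frac{f(\tau)}{\tau-t}\,d\tau,\qquad (Pf)(t):=\frac12\big(f(t)+(Sf)(t)\big),$$ with the integral in the Cauchy principal value sense. When $P$ is bounded on $X$ (that is, $P$ defines a bounded linear operator $X\to X$), for $a\in L^\infty$ the Toeplitz operator with symbol $a$ is the bounded operator $T(a):H[X]\to H[X]$, $T(a)f=P(af)$. Notation: $\mathbf{e}_m(z):=z^m$, $m\in\mathbb{Z}$. For a Banach space $\mathcal{X}$, $\mathcal{B}(\mathcal{X})$ is the Banach algebra of bounded linear operators on $\mathcal{X}$, $\mathcal{K}(\mathcal{X})$ its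 ideal of compact operators, and the essential norm of $A\in\mathcal{B}(\mathcal{X})$ is $\|A\|_{\mathcal{B}(\mathcal{X}),\mathrm{e}}:=\inf\{\|A-K\|_{\mathcal{B}(\mathcal{X})}: K\in\mathcal{K}(\mathcal{X})\}$. *)

theory Defs
  imports "HOL-Probability.Essential_Supremum" "HOL-Probability.Probability_Measure"
begin

text \<open>Lebesgue measure on the unit circle, normalised to total mass 1. It is completed, so
  \<^term>\<open>borel_measurable circle\<close> consists of all Lebesgue measurable functions on the circle.
  Values of functions off the circle are irrelevant, since
  the underlying space of the measure is the unit circle.\<close>

definition circle :: "complex measure" where
  "circle = completion (distr (uniform_measure lborel {-pi..pi})
                              (restrict_space borel (sphere 0 1)) cis)"

definition fourier_coeff :: "(complex \<Rightarrow> complex) \<Rightarrow> int \<Rightarrow> complex" where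
  "fourier_coeff f n =
     1 / (2 * of_real pi) * (LINT \<theta>:{-pi..pi}|lebesgue. f (cis \<theta>) * exp (- \<i> * of_int n * of_real \<theta>))"

definition mon :: "int \<Rightarrow> complex \<Rightarrow> complex" where
  "mon m z = z powi m"

definition banach_function_norm :: "((complex \<Rightarrow> ennreal) \<Rightarrow> ennreal) \<Rightarrow> bool" where
  "banach_function_norm \<rho> \<longleftrightarrow>
     (\<forall>f\<in>borel_measurable circle. \<rho> f = 0 \<longleftrightarrow> (AE t in circle. f t = 0)) \<and>
     (\<forall>f\<in>borel_measurable circle. \<forall>a::real. a \<ge> 0 \<longrightarrow> \<rho> (\<lambda>t. ennreal a * f t) = ennreal a * \<rho> f) \<and>
     (\<forall>f\<in>borel_measurable circle. \<forall>g\<in>borel_measurable circle. \<rho> (\<lambda>t. f t + g t) \<le> \<rho> f + \<rho> g) \<and>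
     (\<forall>f\<in>borel_measurable circle. \<forall>g\<in>borel_measurable circle.
        (AE t in circle. g t \<le> f t) \<longrightarrow> \<rho> g \<le> \<rho> f) \<and>
     (\<forall>f\<in>borel_measurable circle. \<forall>F. (\<forall>n::nat. F n \<in> borel_measurable circle) \<longrightarrow>
        (AE t in circle. incseq (\<lambda>n. F n t) \<and> (\<lambda>n. F n t) \<longlonglongrightarrow> f t) \<longrightarrow>
        incseq (\<lambda>n. \<rho> (F n)) \<and> (\<lambda>n. \<rho> (F n)) \<longlonglongrightarrow> \<rho> f) \<and>
     \<rho> (\<lambda>t. 1) < \<infinity> \<and>
     (\<exists>C::real. C > 0 \<and>
        (\<forall>f\<in>borel_measurable circle. (\<integral>\<^sup>+t. f t \<partial>circle) \<le> ennreal C * \<rho> f))"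

text \<open>The elements of the space are kept as functions; two functions are identified when they
  agree almost everywhere. All notions below respect this identification.\<close>

definition bfs :: "((complex \<Rightarrow> ennreal) \<Rightarrow> ennreal) \<Rightarrow> (complex \<Rightarrow> complex) set" where
  "bfs \<rho> = {f \<in> borel_measurable circle. \<rho> (\<lambda>t. ennreal (cmod (f t))) < \<infinity>}"

definition bfs_norm :: "((complex \<Rightarrow> ennreal) \<Rightarrow> ennreal) \<Rightarrow> (complex \<Rightarrow> complex) \<Rightarrow> real" where
  "bfs_norm \<rho> f = enn2real (\<rho> (\<lambda>t. ennreal (cmod (f t))))"

definition hardy :: "((complex \<Rightarrow> ennreal) \<Rightarrow> ennreal) \<Rightarrow> (complex \<Rightarrow> complex) set" where
  "hardy \<rho> = {g \<in> bfs \<rho>. \<forall>n<0. fourier_coeff g n = 0}"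

text \<open>\<open>L\<^sup>\<infinity>\<close> is the Banach function space whose norm is the essential supremum.\<close>

abbreviation Linf :: "(complex \<Rightarrow> complex) set" where
  "Linf \<equiv> bfs (esssup circle)"

abbreviation Linf_norm :: "(complex \<Rightarrow> complex) \<Rightarrow> real" where
  "Linf_norm \<equiv> bfs_norm (esssup circle)"

abbreviation Hinf :: "(complex \<Rightarrow> complex) set" where
  "Hinf \<equiv> hardy (esssup circle)"

definition C_plus_Hinf :: "(complex \<Rightarrow> complex) set" where
  "C_plus_Hinf = {f \<in> Linf. \<exists>g h. continuous_on (sphere 0 1) g \<and> h \<in> Hinf \<and>
                                   (AE t in circle. f t = g t + h t)}"

text \<open>Here \<open>V\<close> is a linear space of functions on the circle and \<open>N\<close> a seminorm on it whose null
  functions are those vanishing almost everywhere. A map that is linear up to null sets and bounded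
  in the following sense sends almost everywhere equal functions to almost everywhere equal
  functions, so such maps represent exactly the bounded linear operators on the normed space of
  equivalence classes.\<close>

definition bounded_op ::
  "(complex \<Rightarrow> complex) set \<Rightarrow> ((complex \<Rightarrow> complex) \<Rightarrow> real) \<Rightarrow>
   ((complex \<Rightarrow> complex) \<Rightarrow> complex \<Rightarrow> complex) \<Rightarrow> bool" where
  "bounded_op V N A \<longleftrightarrow>
     (\<forall>f\<in>V. A f \<in> V) \<and>
     (\<forall>f\<in>V. \<forall>g\<in>V. AE t in circle. A (\<lambda>s. f s + g s) t = A f t + A g t) \<and>
     (\<forall>f\<in>V. \<forall>c. AE t in circle. A (\<lambda>s. c * f s) t = c * A f t) \<and>
     (\<exists>C. \<forall>f\<in>V. N (A f) \<le> C * N f)"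

definition compact_op ::
  "(complex \<Rightarrow> complex) set \<Rightarrow> ((complex \<Rightarrow> complex) \<Rightarrow> real) \<Rightarrow>
   ((complex \<Rightarrow> complex) \<Rightarrow> complex \<Rightarrow> complex) \<Rightarrow> bool" where
  "compact_op V N K \<longleftrightarrow> bounded_op V N K \<and>
     (\<forall>f. (\<forall>n::nat. f n \<in> V \<and> N (f n) \<le> 1) \<longrightarrow>
        (\<exists>r g. strict_mono r \<and> g \<in> V \<and> (\<lambda>n. N (\<lambda>t. K (f (r n)) t - g t)) \<longlonglongrightarrow> 0))"

definition op_norm ::
  "(complex \<Rightarrow> complex) set \<Rightarrow> ((complex \<Rightarrow> complex) \<Rightarrow> real) \<Rightarrow>
   ((complex \<Rightarrow> complex) \<Rightarrow> complex \<Rightarrow> complex) \<Rightarrow> real" where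
  "op_norm V N A = (SUP f\<in>{f \<in> V. N f \<le> 1}. N (A f))"

definition ess_norm ::
  "(complex \<Rightarrow> complex) set \<Rightarrow> ((complex \<Rightarrow> complex) \<Rightarrow> real) \<Rightarrow>
   ((complex \<Rightarrow> complex) \<Rightarrow> complex \<Rightarrow> complex) \<Rightarrow> real" where
  "ess_norm V N A = (INF K\<in>{K. compact_op V N K}. op_norm V N (\<lambda>f t. A f t - K f t))"

text \<open>With \<open>\<tau> = e\<^sup>i\<^sup>\<theta>\<close>, \<open>d\<tau> = \<i> e\<^sup>i\<^sup>\<theta> d\<theta>\<close>. The limit exists for almost every \<open>t\<close> when \<open>f\<close> is integrable;
  elsewhere the value is an arbitrary constant.\<close>

definition cauchy_sing :: "(complex \<Rightarrow> complex) \<Rightarrow> complex \<Rightarrow> complex" where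
  "cauchy_sing f t = 1 / (of_real pi * \<i>) *
     Lim (at_right 0) (\<lambda>\<epsilon>::real. LINT \<theta>:{\<theta> \<in> {-pi..pi}. cmod (cis \<theta> - t) > \<epsilon>}|lebesgue.
                                    f (cis \<theta>) / (cis \<theta> - t) * (\<i> * cis \<theta>))"

definition riesz :: "(complex \<Rightarrow> complex) \<Rightarrow> complex \<Rightarrow> complex" where
  "riesz f t = (f t + cauchy_sing f t) / 2"

definition toeplitz :: "(complex \<Rightarrow> complex) \<Rightarrow> (complex \<Rightarrow> complex) \<Rightarrow> complex \<Rightarrow> complex" where
  "toeplitz a f = riesz (\<lambda>t. a t * f t)"

end

theory Submission
  imports Defs "HOL-Computational_Algebra.Polynomial"
begin

text \<open>Write \<open>T\<close> for the backward shift \<open>T(e\<^sub>-\<^sub>1)\<close> and \<open>P\<close> for the Riesz projection. That (ii) implies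
  (i) is the case \<open>a = e\<^sub>-\<^sub>1\<close>. For the converse, \<open>T(a)\<close> depends continuously on \<open>a\<close> in the
  essential supremum norm, because \<open>P\<close> is bounded, and the symbols \<open>e\<^sub>-\<^sub>n h\<close> with \<open>h\<close> in \<open>H\<^sup>\<infinity>\<close>
  are dense in \<open>C + H\<^sup>\<infinity>\<close> (\<open>C_plus_Hinf_approx\<close>). So both estimates are made for such symbols.

  Upper estimate (\<open>ess_norm_upper\<close>). The operator \<open>T(e\<^sub>-\<^sub>n h)\<close> is multiplication by \<open>h\<close> followed by
  the \<open>n\<close>-th power of \<open>T\<close>. If \<open>K\<close> is compact and \<open>T - K\<close> has norm at most \<open>1 + \<eta>\<close>, then the
  \<open>n\<close>-th powers of \<open>T\<close> and \<open>T - K\<close> differ by a compact operator, so the essential norm of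
  \<open>T(e\<^sub>-\<^sub>n h)\<close> is at most \<open>(1 + \<eta>)\<^sup>n\<close> times the norm of \<open>h\<close>. Let \<open>\<eta>\<close> tend to 0 while \<open>n\<close> is kept.

  Lower estimate (\<open>ess_norm_lower\<close>). Let \<open>K\<close> be compact and let \<open>M\<close> be the norm of
  \<open>T(e\<^sub>-\<^sub>m h) - K\<close>. For \<open>n \<ge> m\<close> the function \<open>e\<^sub>n\<^sub>-\<^sub>m h f\<close> is analytic, so it is exactly the image of
  \<open>e\<^sub>n f\<close> under \<open>T(e\<^sub>-\<^sub>m h)\<close>. Along a subsequence \<open>K(e\<^sub>n f)\<close> converges to some \<open>g\<close>, and then
  \<open>h f - e\<^sub>m\<^sub>-\<^sub>n g\<close> has norm at most \<open>M\<close> times the norm of \<open>f\<close>, up to a small error. The functions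
  \<open>e\<^sub>n f\<close> may fail to converge weakly to 0 in the space, so that \<open>g\<close> can be nonzero; but averages of
  the functions \<open>e\<^sub>m\<^sub>-\<^sub>n\<close> tend to 0 in \<open>L\<^sup>2\<close>, hence almost everywhere along a subsequence, and the
  Fatou property removes \<open>g\<close>: the norm of \<open>h f\<close> is at most \<open>M\<close> times that of \<open>f\<close>. Taking for \<open>f\<close>
  the powers of \<open>h\<close>, one sees that the integral of \<open>\<bar>h\<bar>\<^sup>k\<close> is at most a constant times \<open>M\<^sup>k\<close>, and this
  forces \<open>\<bar>h\<bar> \<le> M\<close>.

  What remains is classical analysis on the circle: \<open>P f = f\<close> for \<open>f\<close> in the abstract Hardy space,
  \<open>P e\<^sub>-\<^sub>n = 0\<close> for \<open>n > 0\<close>, and \<open>h f\<close> is analytic if \<open>h\<close> and \<open>f\<close> are and \<open>h\<close> is bounded.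
  Polynomials need not be dense in the Hardy space, so the principal value has to be evaluated for
  every function separately. This is done at its Lebesgue points. An analytic function has
  integral 0 against the polynomials without constant term, so that such a polynomial may be added to the truncated
  Cauchy kernel, and a suitable one turns that kernel into an approximate identity of mass 1/2.
  The same convergence theorem for approximate identities (\<open>lebesgue_point_kernel_limit\<close>), applied
  to Fejer kernels, gives the statement about products. Almost every point is a Lebesgue point by a
  weak type maximal inequality, which comes from the Vitali covering lemma for balls in the plane.\<close>

section \<open>Lebesgue measure on the circle\<close>

text \<open>Facts about Borel sets transfer to the circle through this measure, of which \<^const>\<open>circle\<close> is
  the completion.\<close>
definition circle0 :: "complex measure" where
  "circle0 = distr (uniform_measure lborel {-pi..pi}) (restrict_space borel (sphere 0 1)) cis"

lemma circle_completion: "circle = completion circle0" by (simp add: circle_def circle0_def)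

lemma cis_meas [measurable]: "cis \<in> borel \<rightarrow>\<^sub>M restrict_space borel (sphere 0 1)"
  by (intro measurable_restrict_space2) (auto intro!: borel_measurable_continuous_onI continuous_intros)

lemma sets_circle0 [simp, measurable_cong]: "sets circle0 = sets (restrict_space borel (sphere 0 1))"
  by (simp add: circle0_def)
lemma space_circle0 [simp]: "space circle0 = sphere 0 1"
  by (simp add: circle0_def space_restrict_space)
lemma space_circle [simp]: "space circle = sphere 0 1"
  by (simp add: circle_completion)

lemma emeasure_interval_pi: "emeasure lborel {-pi..pi} = ennreal (2*pi)"
  by simp

lemma prob_space_circle0: "prob_space circle0"
proof -
  interpret U: prob_space "uniform_measure lborel {-pi..pi}"
    by (rule prob_space_uniform_measure) (use pi_gt_zero in \<open>auto simp: emeasure_interval_pi\<close>)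
  show ?thesis unfolding circle0_def
    by (rule U.prob_space_distr) simp
qed

lemma prob_space_circle: "prob_space circle"
  using prob_space.prob_space_completion[OF prob_space_circle0] by (simp add: circle_completion)

interpretation prob_space circle by (rule prob_space_circle)

lemma borel_imp_circle: 
  assumes "f \<in> borel_measurable borel" shows "f \<in> borel_measurable circle"
proof -
  have "f \<in> borel_measurable circle0"
    using assms by (subst measurable_cong_sets[OF sets_circle0 refl]) (rule measurable_restrict_space1)
  then show ?thesis by (simp add: circle_completion measurable_completion)
qed

lemma continuous_imp_circle: 
  fixes f :: "complex \<Rightarrow> 'a::topological_space"
  assumes "continuous_on (sphere 0 1) f" shows "f \<in> borel_measurable circle"
proof -
  have "f \<in> borel_measurable circle0"
    using assms by (subst measurable_cong_sets[OF sets_circle0 refl]) (rule borel_measurable_continuous_on_restrict)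
  then show ?thesis by (simp add: circle_completion measurable_completion)
qed

lemma circle_borel_rep_real:
  fixes g :: "complex \<Rightarrow> real"
  assumes "g \<in> borel_measurable circle"
  obtains g' where "g' \<in> borel_measurable borel" "AE t in circle. g t = g' t"
proof -
  obtain r where r: "r \<in> borel_measurable circle0" "AE x in circle0. g x = r x"
    using completion_ex_borel_measurable_real[of g circle0] assms unfolding circle_completion by metis
  have "(\<lambda>x. indicator (sphere 0 1) x *\<^sub>R r x) \<in> borel_measurable borel"
  proof (rule borel_measurable_restrict_space_iff[THEN iffD1])
    show "r \<in> borel_measurable (restrict_space borel (sphere 0 1))"
      using r(1) measurable_cong_sets[OF sets_circle0 refl] by blast
  qed simp
  moreover have "AE x in circle. g x = indicator (sphere 0 1) x *\<^sub>R r x"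
    unfolding circle_completion AE_completion_iff using r(2) AE_space
    by eventually_elim auto
  ultimately show ?thesis using that by blast
qed

text \<open>A function that is measurable for the completed measure may lose measurability when it is
  composed with a Borel map such as \<^const>\<open>cis\<close>; its Borel representative does not.\<close>
lemma circle_borel_rep:
  fixes g :: "complex \<Rightarrow> complex"
  assumes "g \<in> borel_measurable circle"
  obtains g' where "g' \<in> borel_measurable borel" "AE t in circle. g t = g' t"
proof -
  have "(\<lambda>t. Re (g t)) \<in> borel_measurable circle" "(\<lambda>t. Im (g t)) \<in> borel_measurable circle"
    using assms by measurable
  note m = this
  obtain u where u: "u \<in> borel_measurable borel" "AE t in circle. Re (g t) = u t"
    using circle_borel_rep_real[OF m(1)] by blast
  obtain v where v: "v \<in> borel_measurable borel" "AE t in circle. Im (g t) = v t"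
    using circle_borel_rep_real[OF m(2)] by blast
  have "(\<lambda>t. Complex (u t) (v t)) \<in> borel_measurable borel"
    using u(1) v(1) by (simp add: borel_measurable_complex_iff)
  moreover have "AE t in circle. g t = Complex (u t) (v t)"
    using u(2) v(2) by eventually_elim (simp add: complex_eq_iff)
  ultimately show ?thesis using that by blast
qed

lemma AE_circle_lebesgue:
  assumes "AE t in circle. P t"
  shows "AE \<theta> in lebesgue. \<theta> \<in> {-pi..pi} \<longrightarrow> P (cis \<theta>)"
proof -
  have "AE t in circle0. P t" using assms unfolding circle_completion AE_completion_iff .
  then have "AE \<theta> in uniform_measure lborel {-pi..pi}. P (cis \<theta>)"
    unfolding circle0_def by (rule AE_distrD[rotated]) simp
  then have "AE \<theta> in lborel. \<theta> \<in> {-pi..pi} \<longrightarrow> P (cis \<theta>)"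
    using pi_gt_zero by (subst (asm) AE_uniform_measure) (auto simp: emeasure_interval_pi)
  then show ?thesis by (simp add: AE_completion_iff)
qed

lemma uniform_pi: "uniform_measure lborel {-pi..pi} = density lborel (\<lambda>\<theta>. ennreal (indicator {-pi..pi} \<theta> / (2*pi)))"
proof -
  have "1 / ennreal (2*pi) = ennreal (1 / (2*pi))"
    using pi_gt_zero divide_ennreal[of 1 "2*pi"] by simp
  then show ?thesis
    unfolding uniform_measure_def emeasure_interval_pi
    by (intro arg_cong[where f="density lborel"] ext) (simp add: indicator_def)
qed

lemma nn_integral_circle:
  assumes [measurable]: "g \<in> borel_measurable borel"
  shows "(\<integral>\<^sup>+t. g t \<partial>circle) = (\<integral>\<^sup>+\<theta>. g (cis \<theta>) * indicator {-pi..pi} \<theta> \<partial>lborel) / ennreal (2*pi)"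
proof -
  have m: "g \<in> borel_measurable (restrict_space borel (sphere 0 1))"
    by (rule measurable_restrict_space1) simp
  have cb: "cis \<in> borel \<rightarrow>\<^sub>M borel" by (auto intro!: borel_measurable_continuous_onI continuous_intros)
  have [measurable]: "(\<lambda>\<theta>. g (cis \<theta>)) \<in> borel_measurable borel"
    by (rule measurable_compose[OF cb]) simp
  have "(\<integral>\<^sup>+t. g t \<partial>circle) = (\<integral>\<^sup>+t. g t \<partial>circle0)"
    by (simp add: circle_completion nn_integral_completion)
  also have "\<dots> = (\<integral>\<^sup>+\<theta>. g (cis \<theta>) \<partial>uniform_measure lborel {-pi..pi})"
    unfolding circle0_def using m by (subst nn_integral_distr) auto
  also have "\<dots> = (\<integral>\<^sup>+\<theta>. g (cis \<theta>) * indicator {-pi..pi} \<theta> \<partial>lborel) / ennreal (2*pi)"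
    by (subst nn_integral_uniform_measure) (auto simp: emeasure_interval_pi)
  finally show ?thesis .
qed

text \<open>The integrals over angles in the definitions of the Fourier coefficients and of the
  Cauchy integral become integrals over the circle, so that the parametrisation can be forgotten.\<close>
lemma integral_over_angles:
  fixes g :: "complex \<Rightarrow> complex"
  assumes g: "g \<in> borel_measurable circle"
  shows "(LINT \<theta>:{-pi..pi}|lebesgue. g (cis \<theta>)) = 2 * pi * (LINT t|circle. g t)"
proof -
  obtain g' where g'[measurable]: "g' \<in> borel_measurable borel" and eq: "AE t in circle. g t = g' t"
    using circle_borel_rep[OF g] by blast
  have m: "g' \<in> borel_measurable (restrict_space borel (sphere 0 1))"
    by (rule measurable_restrict_space1) simp
  have cb: "cis \<in> borel \<rightarrow>\<^sub>M borel" by (auto intro!: borel_measurable_continuous_onI continuous_intros)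
  have [measurable]: "(\<lambda>\<theta>. g' (cis \<theta>)) \<in> borel_measurable borel"
    by (rule measurable_compose[OF cb]) simp
  have ae: "AE \<theta> in lebesgue. indicator {-pi..pi} \<theta> *\<^sub>R g' (cis \<theta>) = indicator {-pi..pi} \<theta> *\<^sub>R g (cis \<theta>)"
    using AE_circle_lebesgue[OF eq] by eventually_elim (auto simp: indicator_def)
  have m1: "(\<lambda>\<theta>. indicator {-pi..pi} \<theta> *\<^sub>R g' (cis \<theta>)) \<in> borel_measurable borel"
    by measurable
  have m1': "(\<lambda>\<theta>. indicator {-pi..pi} \<theta> *\<^sub>R g' (cis \<theta>)) \<in> borel_measurable lebesgue"
    using m1 by (intro measurable_completion) simp
  have m2: "(\<lambda>\<theta>. indicator {-pi..pi} \<theta> *\<^sub>R g (cis \<theta>)) \<in> borel_measurable lebesgue"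
    by (rule borel_measurable_AE[OF m1' ae])
  have "(LINT \<theta>:{-pi..pi}|lebesgue. g (cis \<theta>)) = (LINT \<theta>|lebesgue. indicator {-pi..pi} \<theta> *\<^sub>R g' (cis \<theta>))"
    unfolding set_lebesgue_integral_def
    using m1' m2 ae by (intro integral_cong_AE) (auto elim: eventually_mono)
  also have "\<dots> = (LINT \<theta>|lborel. indicator {-pi..pi} \<theta> *\<^sub>R g' (cis \<theta>))"
    using m1 by (intro integral_completion) simp
  also have "\<dots> = (LINT \<theta>|lborel. of_real (2 * pi) * ((indicator {-pi..pi} \<theta> / (2*pi)) *\<^sub>R g' (cis \<theta>)))"
    using pi_gt_zero by (intro Bochner_Integration.integral_cong) (auto simp: indicator_def scaleR_conv_of_real)
  also have "\<dots> = 2 * pi * (LINT \<theta>|lborel. (indicator {-pi..pi} \<theta> / (2*pi)) *\<^sub>R g' (cis \<theta>))"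
    by (subst integral_mult_right_zero) simp
  also have "(LINT \<theta>|lborel. (indicator {-pi..pi} \<theta> / (2*pi)) *\<^sub>R g' (cis \<theta>)) = (LINT \<theta>|uniform_measure lborel {-pi..pi}. g' (cis \<theta>))"
    unfolding uniform_pi by (subst integral_density) (auto simp: indicator_def)
  also have "\<dots> = (LINT t|circle0. g' t)"
    unfolding circle0_def using m by (subst integral_distr) auto
  also have "\<dots> = (LINT t|circle. g' t)"
    unfolding circle_completion using m measurable_cong_sets[OF sets_circle0 refl] by (subst integral_completion) auto
  also have "\<dots> = (LINT t|circle. g t)"
    using g eq by (intro integral_cong_AE) (auto intro: borel_imp_circle elim: eventually_mono)
  finally show ?thesis by simp
qed

text \<open>Rotation shifts the interval of angles by some \<open>x\<close> between 0 and \<open>2 pi\<close>; the part that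
  leaves the interval on the right re-enters on the left by periodicity.\<close>
lemma nn_integral_circle_rotate:
  assumes [measurable]: "g \<in> borel_measurable borel" and c: "cmod c = 1"
  shows "(\<integral>\<^sup>+t. g (c * t) \<partial>circle) = (\<integral>\<^sup>+t. g t \<partial>circle)"
proof -
  have "(Re c)\<^sup>2 + (Im c)\<^sup>2 = 1" using c by (metis cmod_power2 one_power2)
  then obtain x where x: "0 \<le> x" "x < 2*pi" "Re c = cos x" "Im c = sin x"
    by (metis sincos_total_2pi)
  have cx: "c = cis x" using x by (simp add: complex_eq_iff)
  have cb: "cis \<in> borel \<rightarrow>\<^sub>M borel" by (auto intro!: borel_measurable_continuous_onI continuous_intros)
  have [measurable]: "(\<lambda>\<theta>. g (cis \<theta>)) \<in> borel_measurable borel"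
    by (rule measurable_compose[OF cb]) simp
  define J where "J a b = (\<integral>\<^sup>+\<theta>. g (cis \<theta>) * indicator {a..<b} \<theta> \<partial>lborel)" for a b :: real
  have add: "J a d = J a b + J b d" if "a \<le> b" "b \<le> d" for a b d
    unfolding J_def using that
    by (subst nn_integral_add[symmetric]) (auto intro!: nn_integral_cong simp: indicator_def)
  have shift: "(\<integral>\<^sup>+\<theta>. g (cis (\<theta> + s)) * indicator {a..<b} \<theta> \<partial>lborel) = J (a+s) (b+s)" for a b s
    unfolding J_def
    by (subst nn_integral_real_affine[where c=1 and t=s and f="\<lambda>\<theta>. g (cis \<theta>) * indicator {a + s..<b + s} \<theta>"])
       (auto intro!: nn_integral_cong simp: indicator_def add_ac)
  have per: "J a b = J (a + 2*pi) (b + 2*pi)" for a b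
    using shift[of "2*pi" a b] by (simp add: J_def cis_mult[symmetric])
  have half: "(\<integral>\<^sup>+\<theta>. h \<theta> * indicator {-pi..pi} \<theta> \<partial>lborel) = (\<integral>\<^sup>+\<theta>. h \<theta> * indicator {-pi..<pi} \<theta> \<partial>lborel)" for h :: "real \<Rightarrow> ennreal"
    using AE_lborel_singleton[of pi]
    by (intro nn_integral_cong_AE) (auto simp: indicator_def elim!: eventually_mono)
  have "J (-pi+x) (pi+x) = J (-pi+x) pi + J pi (pi+x)"
    using x by (intro add) auto
  also have "J pi (pi+x) = J (-pi) (-pi+x)"
    using per[of "-pi" "-pi+x"] by (simp add: algebra_simps)
  also have "J (-pi+x) pi + J (-pi) (-pi+x) = J (-pi) pi"
    using x by (subst add.commute, intro add[symmetric]) auto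
  finally have J: "J (-pi+x) (pi+x) = J (-pi) pi" .
  have "(\<integral>\<^sup>+t. g (c * t) \<partial>circle) = J (-pi+x) (pi+x) / ennreal (2*pi)"
    unfolding shift[of x "-pi" pi, symmetric]
    by (subst nn_integral_circle) (simp_all add: half cx cis_mult add.commute)
  also have "\<dots> = (\<integral>\<^sup>+t. g t \<partial>circle)"
    unfolding J by (subst nn_integral_circle) (auto simp: half J_def)
  finally show ?thesis .
qed

lemma nn_integral_circle_cnj:
  assumes [measurable]: "g \<in> borel_measurable borel"
  shows "(\<integral>\<^sup>+t. g (cnj t) \<partial>circle) = (\<integral>\<^sup>+t. g t \<partial>circle)"
proof -
  have cb: "cis \<in> borel \<rightarrow>\<^sub>M borel" by (auto intro!: borel_measurable_continuous_onI continuous_intros)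
  have [measurable]: "(\<lambda>\<theta>. g (cis \<theta>)) \<in> borel_measurable borel"
    by (rule measurable_compose[OF cb]) simp
  have "cnj \<in> borel \<rightarrow>\<^sub>M borel" by (auto intro!: borel_measurable_continuous_onI continuous_intros)
  then have "(\<lambda>t. g (cnj t)) \<in> borel_measurable borel"
    by (rule measurable_compose) simp
  then show ?thesis
    apply (subst nn_integral_circle)
     apply simp
    apply (subst nn_integral_circle)
     apply simp
    apply (subst (2) nn_integral_real_affine[where c="-1" and t=0])
      apply (auto intro!: arg_cong2[where f="(/)"] nn_integral_cong simp: indicator_def cis_cnj)
    done
qed

text \<open>Reflections are what the principal value needs: the reflection fixing \<open>t\<close>, which is
  \<open>w \<mapsto> t\<^sup>2 / w\<close>, shows that the singular part of the Cauchy kernel has mean 0.\<close>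
lemma integral_circle_reflect:
  fixes g :: "complex \<Rightarrow> complex"
  assumes g: "g \<in> borel_measurable borel" and c: "cmod c = 1"
  shows "(LINT t|circle. g (c * cnj t)) = (LINT t|circle. g t)"
proof -
  have cb: "(\<lambda>t. c * cnj t) \<in> borel \<rightarrow>\<^sub>M borel" "(\<lambda>t. c * t) \<in> borel \<rightarrow>\<^sub>M borel"
    by (auto intro!: borel_measurable_continuous_onI continuous_intros)
  have "distr circle borel (\<lambda>t. c * cnj t) = distr circle borel (\<lambda>t. t)"
  proof (rule measure_eqI)
    fix A assume "A \<in> sets (distr circle borel (\<lambda>t. c * cnj t))"
    then have A[measurable]: "A \<in> sets borel" by simp
    have m: "(\<lambda>t. c * cnj t) \<in> circle \<rightarrow>\<^sub>M borel" "(\<lambda>t. t) \<in> circle \<rightarrow>\<^sub>M borel"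
      using cb by (auto intro: borel_imp_circle)
    have i: "(indicator A::complex \<Rightarrow> ennreal) \<in> borel_measurable borel" by simp
    have i': "(\<lambda>t. indicator A (c * t)::ennreal) \<in> borel_measurable borel"
      by (rule measurable_compose[OF cb(2)]) simp
    have "emeasure (distr circle borel (\<lambda>t. c * cnj t)) A = (\<integral>\<^sup>+t. indicator A t \<partial>distr circle borel (\<lambda>t. c * cnj t))"
      by simp
    also have "\<dots> = (\<integral>\<^sup>+t. indicator A (c * cnj t) \<partial>circle)"
      by (subst nn_integral_distr) (use m in auto)
    also have "\<dots> = (\<integral>\<^sup>+t. indicator A t \<partial>circle)"
      using nn_integral_circle_cnj[OF i'] nn_integral_circle_rotate[OF i c] by simp
    also have "\<dots> = (\<integral>\<^sup>+t. indicator A t \<partial>distr circle borel (\<lambda>t. t))"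
      by (subst nn_integral_distr) (use m in auto)
    finally show "emeasure (distr circle borel (\<lambda>t. c * cnj t)) A = emeasure (distr circle borel (\<lambda>t. t)) A"
      by simp
  qed simp
  then have "integral\<^sup>L (distr circle borel (\<lambda>t. c * cnj t)) g = integral\<^sup>L (distr circle borel (\<lambda>t. t)) g"
    by simp
  then show ?thesis
    using g cb by (simp add: integral_distr borel_imp_circle)
qed

section \<open>The maximal inequality\<close>

text \<open>This is \<open>sin x \<ge> x / pi\<close> for \<open>0 \<le> x \<le> pi / 2\<close>, with \<open>x = \<bar>\<theta>\<bar> / 2\<close>. The constant is half
  of the optimal one, which makes the measure of a ball of radius \<open>r\<close> at most \<open>r\<close>.\<close>
lemma abs_angle_le_chord:
  assumes "\<bar>\<theta>\<bar> \<le> pi" shows "\<bar>\<theta>\<bar> \<le> pi * cmod (cis \<theta> - 1)"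
proof -
  have sin_lower: "x / pi \<le> sin x" if "0 \<le> x" "x \<le> pi/2" for x
  proof (cases "x \<le> pi/3")
    case True
    show ?thesis
    proof (cases "x = 0")
      case False
      then have "0 < x" using that by simp
      then obtain z where z: "0 < z" "z < x" "sin x - sin 0 = (x - 0) * cos z"
        using MVT2[of 0 x sin cos] DERIV_sin by blast
      have "cos (pi/3) \<le> cos z" using z True pi_gt_zero by (intro cos_monotone_0_pi_le) auto
      then have "x * (1/2) \<le> x * cos z" using \<open>0 < x\<close> by (intro mult_left_mono) (auto simp: cos_60)
      then have "x * (1/2) \<le> sin x" using z by simp
      moreover have "x / pi \<le> x * (1/2)" using \<open>0 < x\<close> pi_ge_two by (auto simp: field_simps)
      ultimately show ?thesis by linarith
    qed simp
  next
    case False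
    have "sin (pi/6) \<le> sin x" using False that by (intro sin_monotone_2pi_le) auto
    then have "1/2 \<le> sin x" by (simp add: sin_30)
    moreover have "x / pi \<le> 1/2" using that by (simp add: field_simps)
    ultimately show ?thesis by linarith
  qed
  have "cmod (cis \<theta> - 1) ^ 2 = (2 * sin (\<theta>/2)) ^ 2"
  proof -
    have "cmod (cis \<theta> - 1) ^ 2 = (cos \<theta> - 1)^2 + (sin \<theta>)^2" by (simp add: cmod_power2)
    also have "\<dots> = 2 - 2 * cos \<theta>" using sin_cos_squared_add[of \<theta>] by (simp add: power2_eq_square algebra_simps)
    also have "cos \<theta> = 1 - 2 * (sin (\<theta>/2))^2" using cos_double_sin[of "\<theta>/2"] by simp
    finally show ?thesis by (simp add: power_mult_distrib)
  qed
  then have eq: "cmod (cis \<theta> - 1) = 2 * \<bar>sin (\<theta>/2)\<bar>"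
    by (metis abs_mult abs_numeral norm_ge_zero power2_abs power2_eq_imp_eq abs_ge_zero)
  have "\<bar>\<theta>\<bar>/2 / pi \<le> sin (\<bar>\<theta>\<bar>/2)" using assms by (intro sin_lower) auto
  also have "\<dots> \<le> \<bar>sin (\<theta>/2)\<bar>" by (cases "\<theta> \<ge> 0") auto
  finally show ?thesis unfolding eq using pi_gt_zero by (simp add: field_simps)
qed

lemma borel_Int_circle [simp, intro]: "A \<in> sets borel \<Longrightarrow> A \<inter> sphere 0 1 \<in> sets circle"
  unfolding circle_completion by (intro sets_completionI_sets) (auto simp: sets_restrict_space)

lemma sphere_in_circle [simp]: "sphere 0 1 \<in> sets circle"
  using sets.top[of circle] by simp

lemma emeasure_cball_circle:
  assumes t: "t \<in> sphere 0 1" and r: "r \<ge> 0"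
  shows "emeasure circle (cball t r \<inter> sphere 0 1) \<le> ennreal r"
proof -
  have t1: "cmod t = 1" using t by simp
  have [measurable]: "(\<lambda>w. indicator (cball t r) (t * w) :: ennreal) \<in> borel_measurable borel"
    by (rule measurable_compose[where N=borel and f="\<lambda>w. t * w"])
      (simp, intro borel_measurable_indicator borel_closed closed_cball)
  have "emeasure circle (cball t r \<inter> sphere 0 1) = (\<integral>\<^sup>+w. indicator (cball t r \<inter> sphere 0 1) w \<partial>circle)"
    by simp
  also have "\<dots> = (\<integral>\<^sup>+w. indicator (cball t r) w \<partial>circle)"
    by (intro nn_integral_cong) (auto simp: indicator_def)
  also have "\<dots> = (\<integral>\<^sup>+w. indicator (cball t r) (t * w) \<partial>circle)"
    using t1 by (subst nn_integral_circle_rotate[where g="indicator (cball t r)"])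
      (auto intro!: borel_measurable_indicator borel_closed)
  also have "\<dots> = (\<integral>\<^sup>+\<theta>. indicator (cball t r) (t * cis \<theta>) * indicator {-pi..pi} \<theta> \<partial>lborel) / ennreal (2*pi)"
    by (subst nn_integral_circle) auto
  also have "\<dots> \<le> (\<integral>\<^sup>+\<theta>. indicator {-(pi*r)..pi*r} \<theta> \<partial>lborel) / ennreal (2*pi)"
  proof (intro divide_right_mono_ennreal nn_integral_mono)
    fix \<theta> :: real
    have "\<bar>\<theta>\<bar> \<le> pi * r" if "\<bar>\<theta>\<bar> \<le> pi" "t * cis \<theta> \<in> cball t r"
    proof -
      have "cmod (cis \<theta> - 1) = cmod (t * cis \<theta> - t)"
        using t1 by (metis mult.right_neutral norm_mult right_diff_distrib mult_1)
      then have "cmod (cis \<theta> - 1) \<le> r" using that(2) by (simp add: dist_norm norm_minus_commute)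
      then show ?thesis using abs_angle_le_chord[OF that(1)] pi_gt_zero 
        by (meson mult_left_mono order_trans less_imp_le)
    qed
    then show "indicator (cball t r) (t * cis \<theta>) * indicator {-pi..pi} \<theta> \<le> (indicator {-(pi*r)..pi*r} \<theta>::ennreal)"
      by (auto simp: indicator_def abs_le_iff)
  qed
  also have "\<dots> = ennreal (2*pi*r) / ennreal (2*pi)"
    using r by (simp add: mult_nonneg_nonneg mult.assoc)
  also have "\<dots> = ennreal r" using r pi_gt_zero by (simp add: divide_ennreal)
  finally show ?thesis .
qed

text \<open>The maximal inequality for the circle, stated without the maximal function: a set each
  of whose points is the centre of a ball with large mean has a measurable cover of small measure.
  A disjoint subfamily of these balls, enlarged five times, still covers the set, and disjoint balls
  together carry at most the whole integral of \<open>F\<close>. Balls in the plane may be used because the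
  measure of a ball centred on the circle is at most its radius.\<close>
lemma weak_type_maximal:
  fixes F :: "complex \<Rightarrow> ennreal"
  assumes F[measurable]: "F \<in> borel_measurable circle" and fin: "(\<integral>\<^sup>+w. F w \<partial>circle) < \<infinity>"
    and lam: "lam > 0" and K: "K \<subseteq> sphere 0 1"
    and large: "\<And>t. t \<in> K \<Longrightarrow> \<exists>r>0. ennreal (lam * r) < (\<integral>\<^sup>+w. F w * indicator (cball t r) w \<partial>circle)"
  obtains A where "A \<in> sets circle" "K \<subseteq> A" "emeasure circle A \<le> ennreal (5 / lam) * (\<integral>\<^sup>+w. F w \<partial>circle)"
proof -
  define I where "I = enn2real (\<integral>\<^sup>+w. F w \<partial>circle)"
  have I: "(\<integral>\<^sup>+w. F w \<partial>circle) = ennreal I" using fin by (simp add: I_def)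
  obtain r where r: "\<And>t. t \<in> K \<Longrightarrow> 0 < r t"
    "\<And>t. t \<in> K \<Longrightarrow> ennreal (lam * r t) < (\<integral>\<^sup>+w. F w * indicator (cball t (r t)) w \<partial>circle)"
    using large by metis
  have rB: "0 < r t \<and> r t \<le> I / lam" if "t \<in> K" for t
  proof -
    have "ennreal (lam * r t) < (\<integral>\<^sup>+w. F w * indicator (cball t (r t)) w \<partial>circle)" using r that by simp
    also have "\<dots> \<le> (\<integral>\<^sup>+w. F w \<partial>circle)" by (intro nn_integral_mono) (auto simp: indicator_def)
    finally have "lam * r t < I" unfolding I using r(1)[OF that] lam 
      by (simp add: ennreal_less_iff)
    then show ?thesis using r(1)[OF that] lam by (simp add: field_simps)
  qed
  obtain C where C: "countable C" "C \<subseteq> K" "pairwise (\<lambda>i j. disjnt (cball i (r i)) (cball j (r j))) C"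
     "\<And>i. i \<in> K \<Longrightarrow> \<exists>j. j \<in> C \<and> \<not> disjnt (cball i (r i)) (cball j (r j)) \<and> cball i (r i) \<subseteq> ball j (5 * r j)"
    proof (rule Vitali_covering_lemma_cballs_balls[OF rB, where a="\<lambda>t. t"])
    fix C
    assume h: "countable C" "C \<subseteq> K" "pairwise (\<lambda>i j. disjnt (cball i (r i)) (cball j (r j))) C"
     "\<And>i. i \<in> K \<Longrightarrow> \<exists>j. j \<in> C \<and> \<not> disjnt (cball i (r i)) (cball j (r j)) \<and> cball i (r i) \<subseteq> ball j (5 * r j)"
    show thesis by (rule that[OF h])
  qed
  \<comment> \<open>An enumeration of the countable subfamily by a set of natural numbers.\<close>
  define N where "N = to_nat_on C ` C"
  define e where "e = from_nat_into C"
  have eC: "e n \<in> C" if "n \<in> N" for n using that C(1) by (auto simp: N_def e_def)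
  have inj: "e m \<noteq> e n" if "n \<in> N" "m \<in> N" "m \<noteq> n" for m n
    using that C(1) by (auto simp: N_def e_def)
  define X where "X n = (if n \<in> N then cball (e n) (r (e n)) \<inter> sphere 0 1 else {})" for n
  define Y where "Y n = (if n \<in> N then ball (e n) (5 * r (e n)) \<inter> sphere 0 1 else {})" for n
  have X[measurable]: "X n \<in> sets circle" and Y[measurable]: "Y n \<in> sets circle" for n
    by (auto simp: X_def Y_def)
  let ?\<nu> = "density circle F"
  have dis: "disjoint_family X"
  proof (unfold disjoint_family_on_def, intro ballI impI)
    fix m n :: nat assume "m \<noteq> n"
    then show "X m \<inter> X n = {}"
      using C(3) inj[of m n] eC by (auto simp: X_def pairwise_def disjnt_def)
  qed
  have YX: "emeasure circle (Y n) \<le> ennreal (5/lam) * emeasure ?\<nu> (X n)" for n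
  proof (cases "n \<in> N")
    case True
    then have nK: "e n \<in> K" using eC C(2) by auto
    have "emeasure circle (Y n) \<le> emeasure circle (cball (e n) (5 * r (e n)) \<inter> sphere 0 1)"
      using True by (intro emeasure_mono) (auto simp: Y_def)
    also have "\<dots> \<le> ennreal (5 * r (e n))"
      using nK K rB by (intro emeasure_cball_circle) (auto intro: less_imp_le)
    also have "\<dots> = ennreal (5/lam) * ennreal (lam * r (e n))"
      using lam rB[OF nK] by (subst ennreal_mult[symmetric]) auto
    also have "\<dots> \<le> ennreal (5/lam) * (\<integral>\<^sup>+w. F w * indicator (cball (e n) (r (e n))) w \<partial>circle)"
      using r(2)[OF nK] by (intro mult_left_mono) (auto intro: less_imp_le)
    also have "(\<integral>\<^sup>+w. F w * indicator (cball (e n) (r (e n))) w \<partial>circle) = emeasure ?\<nu> (X n)"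
      using True by (subst emeasure_density) (auto simp: X_def indicator_def intro!: nn_integral_cong)
    finally show ?thesis .
  qed (simp add: Y_def)
  have "emeasure circle (\<Union>n. Y n) \<le> (\<Sum>n. emeasure circle (Y n))"
    by (rule emeasure_subadditive_countably) auto
  also have "\<dots> \<le> (\<Sum>n. ennreal (5/lam) * emeasure ?\<nu> (X n))"
    by (intro suminf_le YX) auto
  also have "\<dots> = ennreal (5/lam) * (\<Sum>n. emeasure ?\<nu> (X n))" by simp
  also have "(\<Sum>n. emeasure ?\<nu> (X n)) = emeasure ?\<nu> (\<Union>n. X n)"
    using dis by (intro suminf_emeasure) auto
  also have "\<dots> \<le> emeasure ?\<nu> (space circle)"
    by (intro emeasure_mono) (auto simp: X_def)
  also have "\<dots> = (\<integral>\<^sup>+w. F w \<partial>circle)"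
    by (subst emeasure_density) (auto simp del: space_circle intro!: nn_integral_cong)
  finally have 1: "emeasure circle (\<Union>n. Y n) \<le> ennreal (5/lam) * (\<integral>\<^sup>+w. F w \<partial>circle)"
    by (simp add: mult_left_mono)
  have 2: "K \<subseteq> (\<Union>n. Y n)"
  proof
    fix t assume t: "t \<in> K"
    then obtain j where j: "j \<in> C" "cball t (r t) \<subseteq> ball j (5 * r j)" using C(4) by blast
    have "t \<in> ball j (5 * r j) \<inter> sphere 0 1" proof -
      have "t \<in> cball t (r t)" using rB[OF t] by simp
      then show ?thesis using j(2) t K by blast
    qed
    moreover have "e (to_nat_on C j) = j" "to_nat_on C j \<in> N" using j(1) C(1) by (auto simp: e_def N_def)
    ultimately show "t \<in> (\<Union>n. Y n)" by (auto simp: Y_def intro!: bexI[of _ "to_nat_on C j"])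
  qed
  show ?thesis using that[OF _ 2 1] by auto
qed

section \<open>Lebesgue points\<close>

text \<open>For the indicator of a set, inner and outer regularity give a compact subset and an open
  superset of almost the same measure; a Urysohn function between them is the approximation.\<close>
lemma continuous_dense_L1:
  fixes f :: "complex \<Rightarrow> complex"
  assumes "integrable circle f"
  shows "\<forall>e>0. \<exists>g. continuous_on UNIV g \<and> (\<integral>\<^sup>+w. ennreal (cmod (f w - g w)) \<partial>circle) \<le> ennreal e"
  using assms
proof (induction rule: integrable_induct)
  case (base A c)
  let ?\<nu> = "distr circle borel (\<lambda>t. t)"
  have idm: "(\<lambda>t. t) \<in> circle \<rightarrow>\<^sub>M (borel::complex measure)" by (rule borel_imp_circle) simp
  interpret \<nu>: prob_space ?\<nu> using idm by (rule prob_space_distr)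
  have "(indicator A :: complex \<Rightarrow> real) \<in> borel_measurable circle" using base by simp
  then obtain u where u[measurable]: "u \<in> borel_measurable borel" and Au: "AE t in circle. indicator A t = (u t::real)"
    using circle_borel_rep_real by blast
  define A' where "A' = {t. u t = 1}"
  have A'[measurable]: "A' \<in> sets borel" unfolding A'_def by measurable
  have AA': "AE t in circle. t \<in> A \<longleftrightarrow> t \<in> A'" using Au by eventually_elim (auto simp: A'_def indicator_def split: if_splits)
  show ?case
  proof (intro allI impI)
    fix e :: real assume e: "0 < e"
    define e' where "e' = e / (2 * (cmod c + 1))"
    have e': "e' > 0" using e by (simp add: e'_def add_nonneg_pos)
    have fin: "emeasure ?\<nu> (space ?\<nu>) \<noteq> \<infinity>" by (simp add: \<nu>.emeasure_space_1 del: space_distr)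
    have finA: "emeasure ?\<nu> S \<noteq> \<infinity>" for S by simp
    obtain K where K: "K \<subseteq> A'" "compact K" "emeasure ?\<nu> A' < emeasure ?\<nu> K + ennreal e'"
      using SUP_approx_ennreal[OF _ _ inner_regular[OF _ fin A'] finA, of "e'"] e' compact_empty by (auto simp del: compact_empty)
    obtain U where U: "A' \<subseteq> U" "open U" "emeasure ?\<nu> U < emeasure ?\<nu> A' + ennreal e'"
      using INF_approx_ennreal[OF _ outer_regular[OF _ fin A'] finA, of "e'"] e' by auto
    have bm: "K \<in> sets borel" "U \<in> sets borel" using K U by (auto intro: borel_closed compact_imp_closed)
    have "measure ?\<nu> (U - K) = measure ?\<nu> U - measure ?\<nu> K"
      using bm K U by (intro \<nu>.finite_measure_Diff) auto
    also have "\<dots> \<le> 2 * e'"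
      using K(3) U(3) e' by (simp add: \<nu>.emeasure_eq_measure ennreal_less_iff flip: ennreal_plus)
    finally have m: "emeasure ?\<nu> (U - K) \<le> ennreal (2 * e')" by (simp add: \<nu>.emeasure_eq_measure ennreal_leI)
    obtain g :: "complex \<Rightarrow> real" where g: "continuous_on UNIV g" "\<And>x. g x \<in> closed_segment 1 0"
        "\<And>x. x \<in> K \<Longrightarrow> g x = 1" "\<And>x. x \<in> -U \<Longrightarrow> g x = 0"
      using Urysohn_local[of UNIV K "-U" "1::real" 0] K U by (auto intro: compact_imp_closed)
    have "(\<integral>\<^sup>+w. ennreal (cmod (indicat_real A w *\<^sub>R c - g w *\<^sub>R c)) \<partial>circle) \<le> (\<integral>\<^sup>+w. ennreal (cmod c) * indicator (U - K) w \<partial>circle)"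
    proof (rule nn_integral_mono_AE)
      show "AE w in circle. ennreal (cmod (indicat_real A w *\<^sub>R c - g w *\<^sub>R c)) \<le> ennreal (cmod c) * indicator (U - K) w"
        using AA'
      proof eventually_elim
        case (elim w)
        have "\<bar>indicat_real A w - g w\<bar> \<le> indicator (U - K) w"
          using elim g(2)[of w] g(3,4)[of w] K(1) U(1) by (auto simp: indicator_def closed_segment_eq_real_ivl)
        then have "\<bar>indicat_real A w - g w\<bar> * cmod c \<le> indicator (U - K) w * cmod c"
          by (rule mult_right_mono) simp
        then have "cmod (indicat_real A w *\<^sub>R c - g w *\<^sub>R c) \<le> cmod c * indicator (U - K) w"
          by (simp add: scaleR_diff_left[symmetric] mult.commute)
        then have "ennreal (cmod (indicat_real A w *\<^sub>R c - g w *\<^sub>R c)) \<le> ennreal (cmod c * indicator (U - K) w)"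
            by (rule ennreal_leI)
          moreover have "ennreal (cmod c * indicator (U - K) w) = ennreal (cmod c) * indicator (U - K) w"
            by (simp add: indicator_def)
          ultimately show ?case by (simp only:)
      qed
    qed
    also have "\<dots> = ennreal (cmod c) * (\<integral>\<^sup>+w. indicator (U - K) w \<partial>circle)"
      using bm by (intro nn_integral_cmult) (auto intro!: borel_imp_circle)
    also have "(\<integral>\<^sup>+w. indicator (U - K) w \<partial>circle) = emeasure ?\<nu> (U - K)"
      using bm idm by (subst nn_integral_indicator[symmetric], simp) (subst nn_integral_distr, auto)
    also have "ennreal (cmod c) * \<dots> \<le> ennreal (cmod c) * ennreal (2 * e')"
      using m by (rule mult_left_mono) simp
    also have "\<dots> = ennreal (cmod c * (2 * e'))" using e' by (subst ennreal_mult) auto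
    also have "\<dots> \<le> ennreal e"
    proof (rule ennreal_leI)
      have "cmod c * e \<le> e * (cmod c + 1)" using e by (simp add: algebra_simps)
      then show "cmod c * (2 * e') \<le> e" using e by (simp add: e'_def divide_simps add_nonneg_pos)
    qed
    finally show "\<exists>g. continuous_on UNIV g \<and> (\<integral>\<^sup>+w. ennreal (cmod (indicat_real A w *\<^sub>R c - g w)) \<partial>circle) \<le> ennreal e"
      using g(1) by (intro exI[of _ "\<lambda>w. g w *\<^sub>R c"]) (auto intro!: continuous_intros)
  qed
next
  case (add f1 f2)
  show ?case
  proof (intro allI impI)
    fix e :: real assume e: "0 < e"
    obtain g1 where g1: "continuous_on UNIV g1" "(\<integral>\<^sup>+w. ennreal (cmod (f1 w - g1 w)) \<partial>circle) \<le> ennreal (e/2)"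
      using add e by (meson half_gt_zero)
    obtain g2 where g2: "continuous_on UNIV g2" "(\<integral>\<^sup>+w. ennreal (cmod (f2 w - g2 w)) \<partial>circle) \<le> ennreal (e/2)"
      using add e by (meson half_gt_zero)
    have [measurable]: "f1 \<in> borel_measurable circle" "f2 \<in> borel_measurable circle" using add by auto
    have [measurable]: "g1 \<in> borel_measurable circle" "g2 \<in> borel_measurable circle"
      using g1 g2 by (auto intro!: borel_imp_circle borel_measurable_continuous_onI)
    have "(\<integral>\<^sup>+w. ennreal (cmod ((f1 w + f2 w) - (g1 w + g2 w))) \<partial>circle) \<le>
       (\<integral>\<^sup>+w. ennreal (cmod (f1 w - g1 w)) + ennreal (cmod (f2 w - g2 w)) \<partial>circle)"
      by (intro nn_integral_mono) (auto simp: norm_diff_triangle_ineq simp flip: ennreal_plus intro!: ennreal_leI)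
    also have "\<dots> = (\<integral>\<^sup>+w. ennreal (cmod (f1 w - g1 w)) \<partial>circle) + (\<integral>\<^sup>+w. ennreal (cmod (f2 w - g2 w)) \<partial>circle)"
      by (intro nn_integral_add) auto
    also have "\<dots> \<le> ennreal (e/2) + ennreal (e/2)" using g1 g2 by (intro add_mono)
    also have "\<dots> = ennreal e" using e by (simp flip: ennreal_plus)
    finally show "\<exists>g. continuous_on UNIV g \<and> (\<integral>\<^sup>+w. ennreal (cmod (f1 w + f2 w - g w)) \<partial>circle) \<le> ennreal e"
      using g1(1) g2(1) by (intro exI[of _ "\<lambda>w. g1 w + g2 w"]) (auto intro!: continuous_intros)
  qed
next
  case (lim f s)
  show ?case
  proof (intro allI impI)
    fix e :: real assume e: "0 < e"
    have [measurable]: "f \<in> borel_measurable circle" "\<And>i. s i \<in> borel_measurable circle" using lim by auto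
    have "(\<lambda>i. \<integral>\<^sup>+w. ennreal (cmod (f w - s i w)) \<partial>circle) \<longlonglongrightarrow> (\<integral>\<^sup>+w. 0 \<partial>circle)"
    proof (rule nn_integral_dominated_convergence[where w="\<lambda>w. ennreal (3 * cmod (f w))"])
      show "AE w in circle. ennreal (cmod (f w - s j w)) \<le> ennreal (3 * cmod (f w))" for j
      proof (intro AE_I2 ennreal_leI)
        fix w assume "w \<in> space circle"
        then have "cmod (s j w) \<le> 2 * cmod (f w)" using lim by blast
        then show "cmod (f w - s j w) \<le> 3 * cmod (f w)" using norm_triangle_ineq4[of "f w" "s j w"] by linarith
      qed
      have "integrable circle (\<lambda>w. 3 * cmod (f w))" using lim by auto
      then show "(\<integral>\<^sup>+w. ennreal (3 * cmod (f w)) \<partial>circle) < \<infinity>"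
        unfolding integrable_iff_bounded by (simp only: real_norm_def abs_of_nonneg mult_nonneg_nonneg norm_ge_zero zero_le_numeral)
      show "AE w in circle. (\<lambda>i. ennreal (cmod (f w - s i w))) \<longlonglongrightarrow> 0"
      proof (rule AE_I2)
        fix w assume "w \<in> space circle"
        then have "(\<lambda>i. cmod (f w - s i w)) \<longlonglongrightarrow> cmod (f w - f w)" using lim by (intro tendsto_intros) auto
        then have "(\<lambda>i. ennreal (cmod (f w - s i w))) \<longlonglongrightarrow> ennreal (cmod (f w - f w))" by (rule tendsto_ennrealI)
        then show "(\<lambda>i. ennreal (cmod (f w - s i w))) \<longlonglongrightarrow> 0" by simp
      qed
    qed auto
    then have "eventually (\<lambda>i. (\<integral>\<^sup>+w. ennreal (cmod (f w - s i w)) \<partial>circle) < ennreal (e/2)) sequentially"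
      using e by (intro order_tendstoD(2)[where y=0]) auto
    then obtain i where i: "(\<integral>\<^sup>+w. ennreal (cmod (f w - s i w)) \<partial>circle) < ennreal (e/2)"
      by (auto simp: eventually_sequentially)
    obtain g where g: "continuous_on UNIV g" "(\<integral>\<^sup>+w. ennreal (cmod (s i w - g w)) \<partial>circle) \<le> ennreal (e/2)"
      using lim e by (meson half_gt_zero)
    have [measurable]: "g \<in> borel_measurable circle"
      using g by (auto intro!: borel_imp_circle borel_measurable_continuous_onI)
    have "(\<integral>\<^sup>+w. ennreal (cmod (f w - g w)) \<partial>circle) \<le> (\<integral>\<^sup>+w. ennreal (cmod (f w - s i w)) + ennreal (cmod (s i w - g w)) \<partial>circle)"
      by (intro nn_integral_mono) (auto simp flip: ennreal_plus intro!: ennreal_leI norm_triangle_le_diff norm_diff_triangle_le[OF order_refl order_refl])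
    also have "\<dots> = (\<integral>\<^sup>+w. ennreal (cmod (f w - s i w)) \<partial>circle) + (\<integral>\<^sup>+w. ennreal (cmod (s i w - g w)) \<partial>circle)"
      by (intro nn_integral_add) auto
    also have "\<dots> \<le> ennreal (e/2) + ennreal (e/2)" using g i by (intro add_mono) auto
    also have "\<dots> = ennreal e" using e by (simp flip: ennreal_plus)
    finally show "\<exists>g. continuous_on UNIV g \<and> (\<integral>\<^sup>+w. ennreal (cmod (f w - g w)) \<partial>circle) \<le> ennreal e"
      using g(1) by blast
  qed
qed

text \<open>The integral is not divided by the measure of the ball, which is comparable to \<open>r\<close>.\<close>
abbreviation oscillation :: "(complex \<Rightarrow> complex) \<Rightarrow> complex \<Rightarrow> real \<Rightarrow> ennreal" where
  "oscillation f t r \<equiv> (\<integral>\<^sup>+w. ennreal (cmod (f w - f t)) * indicator (cball t r) w \<partial>circle)"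

abbreviation poisson_weight :: "real \<Rightarrow> real \<Rightarrow> real" where
  "poisson_weight e d \<equiv> e / (e\<^sup>2 + d\<^sup>2)"

text \<open>The first step towards Lebesgue's differentiation theorem: \<open>f\<close> oscillates little near \<open>t\<close> if it
  is close to a continuous function \<open>g\<close>, both at \<open>t\<close> and in the mean over the ball.\<close>
lemma nn_integral_cball_oscillation:
  fixes f g :: "complex \<Rightarrow> complex"
  assumes [measurable]: "f \<in> borel_measurable circle" "g \<in> borel_measurable circle"
    and t: "t \<in> sphere 0 1" and r: "r > 0" and \<eta>: "\<eta> > 0"
    and 1: "(\<integral>\<^sup>+w. ennreal (cmod (f w - g w)) * indicator (cball t r) w \<partial>circle) \<le> ennreal (\<eta> * r)"
    and 2: "\<And>w. w \<in> cball t r \<Longrightarrow> cmod (g w - g t) \<le> \<eta>"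
    and 3: "cmod (f t - g t) \<le> \<eta>"
  shows "oscillation f t r \<le> ennreal (3 * \<eta> * r)"
proof -
  have [measurable]: "(\<lambda>w. indicator (cball t r) w :: ennreal) \<in> borel_measurable circle"
    by (intro borel_imp_circle borel_measurable_indicator borel_closed closed_cball)
  have "oscillation f t r \<le>
    (\<integral>\<^sup>+w. ennreal (cmod (f w - g w)) * indicator (cball t r) w + ennreal (2*\<eta>) * indicator (cball t r) w \<partial>circle)"
  proof (intro nn_integral_mono)
    fix w
    show "ennreal (cmod (f w - f t)) * indicator (cball t r) w \<le> ennreal (cmod (f w - g w)) * indicator (cball t r) w + ennreal (2*\<eta>) * indicator (cball t r) w"
    proof (cases "w \<in> cball t r")
      case True
      have eq: "f w - f t = ((f w - g w) + (g w - g t)) - (f t - g t)" by simp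
      have "cmod (f w - f t) \<le> cmod ((f w - g w) + (g w - g t)) + cmod (f t - g t)"
        unfolding eq by (rule norm_triangle_ineq4)
      moreover have "cmod ((f w - g w) + (g w - g t)) \<le> cmod (f w - g w) + cmod (g w - g t)"
        by (rule norm_triangle_ineq)
      ultimately have "cmod (f w - f t) \<le> cmod (f w - g w) + cmod (g w - g t) + cmod (f t - g t)"
        by linarith
      then have "cmod (f w - f t) \<le> cmod (f w - g w) + 2 * \<eta>" using 2[OF True] 3 by simp
      then show ?thesis using True \<eta> by (simp add: ennreal_leI flip: ennreal_plus)
    qed simp
  qed
  also have "\<dots> = (\<integral>\<^sup>+w. ennreal (cmod (f w - g w)) * indicator (cball t r) w \<partial>circle) + (\<integral>\<^sup>+w. ennreal (2*\<eta>) * indicator (cball t r) w \<partial>circle)"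
    by (intro nn_integral_add) auto
  also have "(\<integral>\<^sup>+w. ennreal (2*\<eta>) * indicator (cball t r) w \<partial>circle) = ennreal (2*\<eta>) * (\<integral>\<^sup>+w. indicator (cball t r) w \<partial>circle)"
    by (intro nn_integral_cmult) auto
  also have "(\<integral>\<^sup>+w. indicator (cball t r) w \<partial>circle) = (\<integral>\<^sup>+w. indicator (cball t r \<inter> sphere 0 1) w \<partial>circle)"
    by (intro nn_integral_cong) (auto simp: indicator_def)
  also have "\<dots> = emeasure circle (cball t r \<inter> sphere 0 1)" by (simp add: borel_closed)
  also have "\<dots> \<le> ennreal r" using emeasure_cball_circle[OF t] r by simp
  finally have "oscillation f t r \<le> ennreal (\<eta> * r) + ennreal (2*\<eta>) * ennreal r"
    using 1 by (meson add_mono mult_left_mono order_refl order_trans zero_le)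
  also have "\<dots> = ennreal (3 * \<eta> * r)"
    using r \<eta> by (simp flip: ennreal_mult ennreal_plus)
  finally show ?thesis .
qed

lemma null_set_by_covers:
  assumes "\<And>e::real. e > 0 \<Longrightarrow> \<exists>A\<in>sets M. B \<subseteq> A \<and> emeasure M A \<le> ennreal e"
  shows "AE x in M. x \<notin> B"
proof -
  have "\<forall>n::nat. \<exists>A\<in>sets M. B \<subseteq> A \<and> emeasure M A \<le> ennreal (1 / (real n + 1))"
    by (intro allI assms) auto
  then have "\<forall>n::nat. \<exists>A. A \<in> sets M \<and> B \<subseteq> A \<and> emeasure M A \<le> ennreal (1 / (real n + 1))"
    unfolding Bex_def .
  from choice[OF this] obtain A where "\<forall>n::nat. A n \<in> sets M \<and> B \<subseteq> A n \<and> emeasure M (A n) \<le> ennreal (1 / (real n + 1))"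
    by (elim exE)
  then have A: "\<And>n. A n \<in> sets M" "\<And>n. B \<subseteq> A n" "\<And>n::nat. emeasure M (A n) \<le> ennreal (1 / (real n + 1))"
    by simp_all
  have le: "emeasure M (\<Inter>n. A n) \<le> ennreal e" if e: "e > 0" for e :: real
  proof -
    obtain n :: nat where "1 / of_nat (Suc n) < e" by (rule nat_approx_posE[OF e])
    then have n: "1 / (real n + 1) < e" by (simp add: add.commute)
    have "emeasure M (\<Inter>n. A n) \<le> emeasure M (A n)" using A by (intro emeasure_mono) auto
    also have "\<dots> \<le> ennreal e" using A(3)[of n] n by (meson ennreal_leI less_imp_le order_trans)
    finally show ?thesis .
  qed
  have "emeasure M (\<Inter>n. A n) \<le> 0" by (rule ennreal_le_epsilon) (simp add: le)
  then have "emeasure M (\<Inter>n. A n) = 0" by simp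
  then show ?thesis using A by (intro AE_I'[of "\<Inter>n. A n"]) auto
qed

definition lebesgue_point :: "(complex \<Rightarrow> complex) \<Rightarrow> complex \<Rightarrow> bool" where
  "lebesgue_point f t \<longleftrightarrow> (\<forall>\<eta>>0. \<exists>\<delta>>0. \<forall>r. 0 < r \<and> r \<le> \<delta> \<longrightarrow>
    oscillation f t r \<le> ennreal (\<eta> * r))"

text \<open>Lebesgue's differentiation theorem. Where the oscillation is not small, either the mean
  of \<open>\<bar>f - g\<bar>\<close> over some ball or \<open>\<bar>f - g\<bar>\<close> itself is large, for a continuous \<open>g\<close> close to \<open>f\<close> in
  \<open>L\<^sup>1\<close>; both happen only on small sets, by the maximal and by Markov's inequality.\<close>
lemma AE_lebesgue_point:
  fixes f :: "complex \<Rightarrow> complex"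
  assumes f: "integrable circle f"
  shows "AE t in circle. lebesgue_point f t"
proof -
  have fm[measurable]: "f \<in> borel_measurable circle" using f by auto
  define ok where "ok \<eta> t \<longleftrightarrow> (\<exists>\<delta>>0. \<forall>r. 0 < r \<and> r \<le> \<delta> \<longrightarrow>
    oscillation f t r \<le> ennreal (3 * \<eta> * r))" for \<eta> t
  have bad: "AE t in circle. t \<notin> {t \<in> sphere 0 1. \<not> ok \<eta> t}" if \<eta>: "\<eta> > 0" for \<eta> :: real
  proof (rule null_set_by_covers)
    fix e :: real assume e: "e > 0"
    \<comment> \<open>The two exceptional sets have measure at most \<open>5 e' / \<eta>\<close> and \<open>e' / \<eta>\<close>.\<close>
    define e' where "e' = e * \<eta> / 6"
    have e': "e' > 0" using e \<eta> by (simp add: e'_def)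
    obtain g where g: "continuous_on UNIV g" and fg: "(\<integral>\<^sup>+w. ennreal (cmod (f w - g w)) \<partial>circle) \<le> ennreal e'"
      using continuous_dense_L1[OF f] e' by blast
    have gm[measurable]: "g \<in> borel_measurable circle"
      using g by (auto intro!: borel_imp_circle borel_measurable_continuous_onI)
    define F where "F w = ennreal (cmod (f w - g w))" for w
    have Fm[measurable]: "F \<in> borel_measurable circle" unfolding F_def by measurable
    have Ffin: "(\<integral>\<^sup>+w. F w \<partial>circle) < \<infinity>" using le_less_trans[OF fg, of \<infinity>] by (simp add: F_def)
    define K where "K = {t \<in> sphere 0 1. \<exists>r>0. ennreal (\<eta> * r) < (\<integral>\<^sup>+w. F w * indicator (cball t r) w \<partial>circle)}"
    have Ks: "K \<subseteq> sphere 0 1" by (auto simp: K_def)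
    have Kl: "\<exists>r>0. ennreal (\<eta> * r) < (\<integral>\<^sup>+w. F w * indicator (cball t r) w \<partial>circle)" if "t \<in> K" for t
      using that by (simp add: K_def)
    obtain A where A: "A \<in> sets circle" "K \<subseteq> A" "emeasure circle A \<le> ennreal (5 / \<eta>) * (\<integral>\<^sup>+w. F w \<partial>circle)"
      by (rule weak_type_maximal[OF Fm Ffin \<eta> Ks Kl]) (assumption | rule that)+
    define B where "B = {t \<in> space circle. 1 \<le> ennreal (1/\<eta>) * F t}"
    have Bm: "B \<in> sets circle" unfolding B_def by measurable
    have "emeasure circle B \<le> ennreal (1/\<eta>) * (\<integral>\<^sup>+w. F w * indicator (space circle) w \<partial>circle)"
      using nn_integral_Markov_inequality[of F "space circle" circle "ennreal (1/\<eta>)"] Fm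
      by (simp add: B_def del: space_circle)
    also have "(\<integral>\<^sup>+w. F w * indicator (space circle) w \<partial>circle) = (\<integral>\<^sup>+w. F w \<partial>circle)"
      by (intro nn_integral_cong) (auto simp: indicator_def)
    finally have B: "emeasure circle B \<le> ennreal (1/\<eta>) * (\<integral>\<^sup>+w. F w \<partial>circle)" .
    have "emeasure circle (A \<union> B) \<le> emeasure circle A + emeasure circle B"
      using A Bm by (intro emeasure_subadditive) auto
    also have "\<dots> \<le> ennreal (5/\<eta>) * ennreal e' + ennreal (1/\<eta>) * ennreal e'"
      using A(3) B fg unfolding F_def[symmetric] by (meson add_mono mult_left_mono order_trans zero_le)
    also have "\<dots> = ennreal (5/\<eta> * e' + 1/\<eta> * e')"
      using \<eta> e' by (simp flip: ennreal_mult ennreal_plus)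
    also have "5/\<eta> * e' + 1/\<eta> * e' = e" using \<eta> by (simp add: e'_def field_simps)
    finally have small: "emeasure circle (A \<union> B) \<le> ennreal e" .
    have "{t \<in> sphere 0 1. \<not> ok \<eta> t} \<subseteq> A \<union> B"
    proof (rule subsetI, rule ccontr)
      fix t assume t: "t \<in> {t \<in> sphere 0 1. \<not> ok \<eta> t}" and nin: "t \<notin> A \<union> B"
      have ts: "t \<in> sphere 0 1" using t by simp
      have "t \<notin> K" using nin A(2) by auto
      then have K': "\<And>r. r > 0 \<Longrightarrow> (\<integral>\<^sup>+w. F w * indicator (cball t r) w \<partial>circle) \<le> ennreal (\<eta> * r)"
        using ts unfolding K_def by (blast intro: leI)
      have "\<not> 1 \<le> ennreal (1/\<eta>) * F t" using nin ts by (auto simp: B_def)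
      then have "ennreal (1/\<eta> * cmod (f t - g t)) < 1"
        using \<eta> by (simp add: F_def not_le flip: ennreal_mult)
      then have 3: "cmod (f t - g t) \<le> \<eta>" using \<eta> by (simp add: ennreal_less_one_iff field_simps)
      have "isCont g t" using g by (simp add: continuous_on_eq_continuous_at)
      then obtain \<delta> where \<delta>: "\<delta> > 0" "\<And>w. dist w t < \<delta> \<Longrightarrow> dist (g w) (g t) < \<eta>"
        using \<eta> unfolding continuous_at_eps_delta by blast
      have "ok \<eta> t" unfolding ok_def
      proof (intro exI[of _ "\<delta>/2"] conjI allI impI)
        fix r assume r: "0 < r \<and> r \<le> \<delta>/2"
        show "oscillation f t r \<le> ennreal (3 * \<eta> * r)"
        proof (rule nn_integral_cball_oscillation[OF fm gm ts _ \<eta> _ _ 3])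
          show "0 < r" using r by simp
          show "(\<integral>\<^sup>+w. ennreal (cmod (f w - g w)) * indicator (cball t r) w \<partial>circle) \<le> ennreal (\<eta> * r)"
            using K'[of r] r by (simp add: F_def)
          show "cmod (g w - g t) \<le> \<eta>" if "w \<in> cball t r" for w
            using \<delta>(2)[of w] \<delta>(1) that r by (auto simp: dist_norm norm_minus_commute)
        qed
      qed (use \<delta> in auto)
      then show False using t by simp
    qed
    then show "\<exists>A\<in>sets circle. {t \<in> sphere 0 1. \<not> ok \<eta> t} \<subseteq> A \<and> emeasure circle A \<le> ennreal e"
      using A(1) Bm small by (intro bexI[of _ "A \<union> B"]) auto
  qed
  have "AE t in circle. \<forall>n::nat. t \<notin> {t \<in> sphere 0 1. \<not> ok (1 / (3 * (real n + 1))) t}"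
    unfolding AE_all_countable by (intro allI bad) (auto intro!: divide_pos_pos)
  then show ?thesis using AE_space
  proof eventually_elim
    case (elim t)
    show ?case unfolding lebesgue_point_def
    proof (intro allI impI)
      fix \<eta> :: real assume \<eta>: "\<eta> > 0"
      obtain n :: nat where "1 / of_nat (Suc n) < \<eta>" by (rule nat_approx_posE[OF \<eta>])
      then have n: "1 / (real n + 1) < \<eta>" by (simp add: add.commute)
      have "ok (1 / (3 * (real n + 1))) t" using elim by auto
      then obtain \<delta> where \<delta>: "\<delta> > 0" "\<And>r. 0 < r \<and> r \<le> \<delta> \<Longrightarrow>
        oscillation f t r \<le> ennreal (3 * (1 / (3 * (real n + 1))) * r)"
        unfolding ok_def by blast
      show "\<exists>\<delta>>0. \<forall>r. 0 < r \<and> r \<le> \<delta> \<longrightarrow>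
          oscillation f t r \<le> ennreal (\<eta> * r)"
      proof (intro exI[of _ \<delta>] conjI allI impI \<delta>(1))
        fix r assume r: "0 < r \<and> r \<le> \<delta>"
        have "3 * (1 / (3 * (real n + 1))) = 1 / (real n + 1)" by (simp add: divide_simps)
        then have "ennreal (3 * (1 / (3 * (real n + 1))) * r) \<le> ennreal (\<eta> * r)"
          using r n by (intro ennreal_leI mult_right_mono) (simp_all only:, linarith+)
        then show "oscillation f t r \<le> ennreal (\<eta> * r)"
          using \<delta>(2)[OF r] by (rule order_trans[rotated])
      qed
    qed
  qed
qed

text \<open>Up to a constant, the weight is a superposition of normalised indicators of the balls of
  radius \<open>2\<^sup>j e\<close> with weights \<open>2\<^sup>-\<^sup>j\<close>; far away from the centre it is small. So an integral against
  the weight is controlled by means over balls.\<close>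
lemma poisson_dyadic_bound:
  assumes e: "0 < e" and dl: "0 < \<delta>" and d: "0 \<le> (d::real)"
  shows "ennreal (poisson_weight e d) \<le> 
    (\<Sum>j. ennreal (4 * (1/4)^j / e) * (if d \<le> min (2^j * e) \<delta> then 1 else 0)) + ennreal (e / \<delta>\<^sup>2)"
proof (cases "d \<le> \<delta>")
  case False
  have "e / (e\<^sup>2 + d\<^sup>2) \<le> e / \<delta>\<^sup>2"
  proof (rule divide_left_mono)
    have "\<delta>\<^sup>2 \<le> d\<^sup>2" using False dl by (intro power_mono) auto
    then show "\<delta>\<^sup>2 \<le> e\<^sup>2 + d\<^sup>2" by (simp add: add_increasing)
  qed (use e dl in \<open>auto intro!: mult_pos_pos add_pos_nonneg\<close>)
  then show ?thesis by (simp add: ennreal_leI add_increasing)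
next
  case True
  obtain n :: nat where "d / e < 2 ^ n" using real_arch_pow[of 2 "d/e"] by auto
  then have ex: "d \<le> 2 ^ n * e" using e by (simp add: field_simps)
  define j where "j = (LEAST n. d \<le> 2 ^ n * e)"
  have j: "d \<le> 2 ^ j * e" unfolding j_def using ex by (rule LeastI)
  have le: "e / (e\<^sup>2 + d\<^sup>2) \<le> 4 * (1/4)^j / e"
  proof (cases j)
    case 0
    have "e / (e\<^sup>2 + d\<^sup>2) \<le> e / e\<^sup>2"
      using e by (intro divide_left_mono) (auto intro!: mult_pos_pos add_pos_nonneg)
    also have "\<dots> \<le> 4 / e" using e by (simp add: power2_eq_square divide_right_mono)
    finally show ?thesis using 0 by simp
  next
    case (Suc i)
    have "\<not> d \<le> 2 ^ i * e" using not_less_Least[of i "\<lambda>n. d \<le> 2 ^ n * e"] Suc by (simp add: j_def)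
    then have "(2 ^ i * e)\<^sup>2 \<le> d\<^sup>2" using e by (intro power_mono) auto
    then have "(2 ^ i * e)\<^sup>2 \<le> e\<^sup>2 + d\<^sup>2" by (simp add: add_increasing)
    then have "e / (e\<^sup>2 + d\<^sup>2) \<le> e / (2 ^ i * e)\<^sup>2"
      using e by (intro divide_left_mono) (auto intro!: mult_pos_pos add_pos_nonneg)
    also have "\<dots> = (1/4)^i / e"
    proof -
      have "((2::real) ^ i)\<^sup>2 = 4 ^ i" unfolding power2_eq_square power_mult_distrib[symmetric] by simp
      then show ?thesis using e by (simp add: power_mult_distrib power2_eq_square power_one_over field_simps)
    qed
    also have "\<dots> = 4 * (1/4)^j / e" by (simp add: Suc)
    finally show ?thesis .
  qed
  have "ennreal (poisson_weight e d) \<le> (\<Sum>i\<in>{j}. ennreal (4 * (1/4)^i / e) * (if d \<le> min (2^i * e) \<delta> then 1 else 0))"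
    using le j True by (simp add: ennreal_leI)
  also have "\<dots> \<le> (\<Sum>i. ennreal (4 * (1/4)^i / e) * (if d \<le> min (2^i * e) \<delta> then 1 else 0))"
    by (intro sum_le_suminf) auto
  finally show ?thesis by (simp add: add_increasing2)
qed

text \<open>The balls are cut off at the radius \<open>\<delta>\<close> below which the oscillation is at most \<open>\<eta>/16\<close>
  times the radius; summing the dyadic bounds then costs a factor 8, and the part of the integral far
  from \<open>t\<close> is at most \<open>e / \<delta>\<^sup>2\<close> times the integral of \<open>\<bar>f - f t\<bar>\<close>.\<close>
lemma lebesgue_point_poisson:
  fixes f :: "complex \<Rightarrow> complex"
  assumes f: "integrable circle f" and L: "lebesgue_point f t" and \<eta>: "\<eta> > 0"
  shows "\<forall>\<^sub>F e in at_right 0. (\<integral>\<^sup>+w. ennreal (cmod (f w - f t)) * ennreal (poisson_weight e (dist w t)) \<partial>circle) \<le> ennreal \<eta>"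
proof -
  have [measurable]: "f \<in> borel_measurable circle" using f by auto
  have [measurable]: "(\<lambda>w. indicator (cball t r) w :: ennreal) \<in> borel_measurable circle" for r
    by (intro borel_imp_circle borel_measurable_indicator borel_closed closed_cball)
  define \<phi> where "\<phi> w = cmod (f w - f t)" for w
  have [measurable]: "\<phi> \<in> borel_measurable circle" unfolding \<phi>_def by measurable
  have \<phi>i: "integrable circle \<phi>" unfolding \<phi>_def using f by auto
  define I where "I = (LINT w|circle. \<phi> w)"
  have I: "(\<integral>\<^sup>+w. ennreal (\<phi> w) \<partial>circle) = ennreal I" "I \<ge> 0"
  proof -
    show "(\<integral>\<^sup>+w. ennreal (\<phi> w) \<partial>circle) = ennreal I"
      unfolding I_def by (rule nn_integral_eq_integral[OF \<phi>i]) (simp add: \<phi>_def)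
    show "I \<ge> 0" unfolding I_def by (simp add: \<phi>_def)
  qed
  have "\<eta>/16 > 0" using \<eta> by simp
  then obtain \<delta> where \<delta>0: "\<delta> > 0" "\<forall>r. 0 < r \<and> r \<le> \<delta> \<longrightarrow>
    (\<integral>\<^sup>+w. ennreal (\<phi> w) * indicator (cball t r) w \<partial>circle) \<le> ennreal (\<eta>/16 * r)"
    using L unfolding lebesgue_point_def \<phi>_def by meson
  have \<delta>: "\<delta> > 0" "\<And>r. 0 < r \<Longrightarrow> r \<le> \<delta> \<Longrightarrow>
    (\<integral>\<^sup>+w. ennreal (\<phi> w) * indicator (cball t r) w \<partial>circle) \<le> ennreal (\<eta>/16 * r)"
    using \<delta>0 by simp_all
  have main: "(\<integral>\<^sup>+w. ennreal (\<phi> w) * ennreal (poisson_weight e (dist w t)) \<partial>circle) \<le> ennreal (\<eta>/2) + ennreal (I * e / \<delta>\<^sup>2)"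
    if e: "e > 0" for e :: real
  proof -
    define a where "a j = ennreal (4 * (1/4)^j / e)" for j
    define r where "r j = min (2^j * e) \<delta>" for j :: nat
    have r: "0 < r j" "r j \<le> \<delta>" "r j \<le> 2^j * e" for j using e \<delta> by (auto simp: r_def)
    have "(\<integral>\<^sup>+w. ennreal (\<phi> w) * ennreal (poisson_weight e (dist w t)) \<partial>circle) \<le>
      (\<integral>\<^sup>+w. (\<Sum>j. a j * (ennreal (\<phi> w) * indicator (cball t (r j)) w)) + ennreal (e / \<delta>\<^sup>2) * ennreal (\<phi> w) \<partial>circle)"
    proof (rule nn_integral_mono)
      fix w
      have "ennreal (\<phi> w) * ennreal (poisson_weight e (dist w t)) \<le> ennreal (\<phi> w) *
        ((\<Sum>j. a j * (if dist w t \<le> r j then 1 else 0)) + ennreal (e / \<delta>\<^sup>2))"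
        unfolding a_def r_def by (intro mult_left_mono poisson_dyadic_bound) (use e \<delta> in auto)
      also have "\<dots> = (\<Sum>j. ennreal (\<phi> w) * (a j * (if dist w t \<le> r j then 1 else 0))) + ennreal (e / \<delta>\<^sup>2) * ennreal (\<phi> w)"
        by (simp add: distrib_left mult.commute)
      also have "(\<lambda>j. ennreal (\<phi> w) * (a j * (if dist w t \<le> r j then 1 else 0))) = (\<lambda>j. a j * (ennreal (\<phi> w) * indicator (cball t (r j)) w))"
        by (auto simp: fun_eq_iff indicator_def dist_commute mult.commute)
      finally show "ennreal (\<phi> w) * ennreal (poisson_weight e (dist w t)) \<le> (\<Sum>j. a j * (ennreal (\<phi> w) * indicator (cball t (r j)) w)) + ennreal (e / \<delta>\<^sup>2) * ennreal (\<phi> w)" .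
    qed
    also have "\<dots> = (\<integral>\<^sup>+w. (\<Sum>j. a j * (ennreal (\<phi> w) * indicator (cball t (r j)) w)) \<partial>circle) + (\<integral>\<^sup>+w. ennreal (e / \<delta>\<^sup>2) * ennreal (\<phi> w) \<partial>circle)"
      by (intro nn_integral_add) auto
    also have "(\<integral>\<^sup>+w. ennreal (e / \<delta>\<^sup>2) * ennreal (\<phi> w) \<partial>circle) = ennreal (e / \<delta>\<^sup>2) * ennreal I"
      by (subst nn_integral_cmult) (auto simp: I)
    also have "ennreal (e / \<delta>\<^sup>2) * ennreal I = ennreal (I * e / \<delta>\<^sup>2)"
      using e I(2) by (simp add: mult.commute flip: ennreal_mult)
    also have "(\<integral>\<^sup>+w. (\<Sum>j. a j * (ennreal (\<phi> w) * indicator (cball t (r j)) w)) \<partial>circle) = (\<Sum>j. \<integral>\<^sup>+w. a j * (ennreal (\<phi> w) * indicator (cball t (r j)) w) \<partial>circle)"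
      by (intro nn_integral_suminf) auto
    also have "\<dots> \<le> (\<Sum>j. ennreal (\<eta>/4 * (1/2)^j))"
    proof (intro suminf_le)
      fix j
      have "(\<integral>\<^sup>+w. a j * (ennreal (\<phi> w) * indicator (cball t (r j)) w) \<partial>circle) = a j * (\<integral>\<^sup>+w. ennreal (\<phi> w) * indicator (cball t (r j)) w \<partial>circle)"
        by (intro nn_integral_cmult) auto
      also have "\<dots> \<le> a j * ennreal (\<eta>/16 * r j)" using \<delta>(2) r by (intro mult_left_mono) auto
      also have "\<dots> = ennreal (4 * (1/4)^j / e * (\<eta>/16 * r j))" unfolding a_def using e r \<eta> 
        by (intro ennreal_mult[symmetric]) (auto intro!: mult_nonneg_nonneg less_imp_le[OF r(1)])
      also have "\<dots> \<le> ennreal (4 * (1/4)^j / e * (\<eta>/16 * (2^j*e)))"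
        using r e \<eta> by (intro ennreal_leI mult_left_mono) auto
      also have "4 * (1/4)^j / e * (\<eta>/16 * (2^j*e)) = \<eta>/4 * (1/2)^j"
      proof -
        have "(1/4::real)^j * 2^j = (1/2)^j" by (simp flip: power_mult_distrib)
        then show ?thesis using e by (simp add: field_simps)
      qed
      finally show "(\<integral>\<^sup>+w. a j * (ennreal (\<phi> w) * indicator (cball t (r j)) w) \<partial>circle) \<le> ennreal (\<eta>/4 * (1/2)^j)" .
    qed auto
    also have "(\<Sum>j. ennreal (\<eta>/4 * (1/2)^j)) = ennreal (\<eta>/2)"
    proof -
      have "(\<lambda>j. \<eta>/4 * (1/2)^j) sums (\<eta>/4 * (1 / (1 - 1/2)))"
        by (intro sums_mult geometric_sums) auto
      then show ?thesis using \<eta> by (intro suminf_ennreal_eq) auto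
    qed
    finally show ?thesis by (simp add: add_mono)
  qed
  have "((\<lambda>e. I * e / \<delta>\<^sup>2) \<longlongrightarrow> I * 0 / \<delta>\<^sup>2) (at_right 0)"
    by (intro tendsto_intros) (use \<delta> in auto)
  then have "\<forall>\<^sub>F e in at_right 0. I * e / \<delta>\<^sup>2 < \<eta>/2"
    using \<eta> by (intro order_tendstoD(2)) auto
  then show ?thesis using eventually_at_right_less
  proof eventually_elim
    case (elim e)
    have "ennreal (\<eta>/2) + ennreal (I * e / \<delta>\<^sup>2) = ennreal (\<eta>/2 + I * e / \<delta>\<^sup>2)"
      using elim I \<eta> by (intro ennreal_plus[symmetric]) auto
    also have "\<dots> \<le> ennreal \<eta>" using elim(1) by (intro ennreal_leI) linarith
    finally show ?case using main[OF elim(2)] unfolding \<phi>_def by (rule order_trans[rotated])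
  qed
qed

text \<open>Approximate identities converge at Lebesgue points. The kernels may be complex and may
  change sign; all that matters is the majorant and the limit of their integrals.\<close>
lemma lebesgue_point_kernel_limit:
  fixes f :: "complex \<Rightarrow> complex" and K :: "'i \<Rightarrow> complex \<Rightarrow> complex" and e :: "'i \<Rightarrow> real"
  assumes f: "integrable circle f" and L: "lebesgue_point f t"
    and e: "filterlim e (at_right 0) F"
    and Km: "\<forall>\<^sub>F i in F. K i \<in> borel_measurable circle"
    and Kb: "\<forall>\<^sub>F i in F. \<forall>w\<in>sphere 0 1. cmod (K i w) \<le> C * poisson_weight (e i) (dist w t)" and C: "C > 0"
    and Kc: "((\<lambda>i. LINT w|circle. K i w) \<longlongrightarrow> c) F"
  shows "((\<lambda>i. LINT w|circle. f w * K i w) \<longlongrightarrow> f t * c) F"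
proof -
  have fm[measurable]: "f \<in> borel_measurable circle" using f by auto
  have epos: "\<forall>\<^sub>F i in F. e i > 0" using eventually_compose_filterlim[OF eventually_at_right_less e] .
  have split: "\<forall>\<^sub>F i in F. (LINT w|circle. f w * K i w) = (LINT w|circle. (f w - f t) * K i w) + f t * (LINT w|circle. K i w)"
    using epos Km Kb
  proof eventually_elim
    case (elim i)
    note [measurable] = elim(2)
    have b: "cmod (K i w) \<le> C / e i" if "w \<in> sphere 0 1" for w
    proof -
      have "e i / ((e i)\<^sup>2 + (dist w t)\<^sup>2) \<le> e i / (e i)\<^sup>2"
        using elim(1) by (intro divide_left_mono) (auto intro!: mult_pos_pos add_pos_nonneg)
      then have "C * poisson_weight (e i) (dist w t) \<le> C * (e i / (e i)\<^sup>2)"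
        using C by (intro mult_left_mono) auto
      then show ?thesis using elim(3) that elim(1) by (force simp: power2_eq_square)
    qed
    have Ki: "integrable circle (K i)"
      by (rule integrable_const_bound[where B="C / e i"]) (use b in auto)
    have "integrable circle (\<lambda>w. (f w - f t) * K i w)"
    proof (rule Bochner_Integration.integrable_bound)
      show "integrable circle (\<lambda>w. C / e i * (f w - f t))" using f by auto
      show "AE w in circle. norm ((f w - f t) * K i w) \<le> norm (C / e i * (f w - f t))"
      proof (rule AE_I2)
        fix w assume "w \<in> space circle"
        then have "cmod (f w - f t) * cmod (K i w) \<le> cmod (f w - f t) * (C / e i)" using b by (intro mult_left_mono) auto
        then show "norm ((f w - f t) * K i w) \<le> norm (C / e i * (f w - f t))" using C elim(1)
          by (simp add: norm_mult norm_divide mult_ac)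
      qed
    qed measurable
    then have "(LINT w|circle. (f w - f t) * K i w) + (LINT w|circle. f t * K i w) = (LINT w|circle. (f w - f t) * K i w + f t * K i w)"
      using Ki by (intro Bochner_Integration.integral_add[symmetric]) auto
    also have "\<dots> = (LINT w|circle. f w * K i w)" by (simp add: algebra_simps)
    finally show ?case by simp
  qed
  have "((\<lambda>i. LINT w|circle. (f w - f t) * K i w) \<longlongrightarrow> 0) F"
  proof (rule tendstoI)
    fix \<eta> :: real assume \<eta>: "\<eta> > 0"
    have "\<eta> / (2*C) > 0" using \<eta> C by simp
    from eventually_compose_filterlim[OF lebesgue_point_poisson[OF f L this] e]
    have "\<forall>\<^sub>F i in F. (\<integral>\<^sup>+w. ennreal (cmod (f w - f t)) * ennreal (poisson_weight (e i) (dist w t)) \<partial>circle) \<le> ennreal (\<eta> / (2*C))" .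
    then show "\<forall>\<^sub>F i in F. dist (LINT w|circle. (f w - f t) * K i w) 0 < \<eta>"
      using epos Km Kb
    proof eventually_elim
      case (elim i)
      note [measurable] = elim(3)
      have "ennreal (norm (LINT w|circle. (f w - f t) * K i w)) \<le> (\<integral>\<^sup>+w. ennreal (norm ((f w - f t) * K i w)) \<partial>circle)"
        by (cases "integrable circle (\<lambda>w. (f w - f t) * K i w)")
          (simp_all add: integral_norm_bound_ennreal not_integrable_integral_eq)
      also have "\<dots> \<le> (\<integral>\<^sup>+w. ennreal C * (ennreal (cmod (f w - f t)) * ennreal (poisson_weight (e i) (dist w t))) \<partial>circle)"
      proof (rule nn_integral_mono)
        fix w assume "w \<in> space circle"
        then have "norm ((f w - f t) * K i w) \<le> cmod (f w - f t) * (C * poisson_weight (e i) (dist w t))"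
          using elim(4) unfolding norm_mult by (intro mult_left_mono) auto
        also have "\<dots> = C * (cmod (f w - f t) * poisson_weight (e i) (dist w t))" by simp
        finally have "ennreal (norm ((f w - f t) * K i w)) \<le> ennreal (C * (cmod (f w - f t) * poisson_weight (e i) (dist w t)))"
          by (rule ennreal_leI)
        also have "\<dots> = ennreal C * (ennreal (cmod (f w - f t)) * ennreal (poisson_weight (e i) (dist w t)))"
          using C elim(2) by (subst ennreal_mult, simp, simp) (subst ennreal_mult, simp_all)
        finally show "ennreal (norm ((f w - f t) * K i w)) \<le> ennreal C * (ennreal (cmod (f w - f t)) * ennreal (poisson_weight (e i) (dist w t)))" .
      qed
      also have "\<dots> = ennreal C * (\<integral>\<^sup>+w. ennreal (cmod (f w - f t)) * ennreal (poisson_weight (e i) (dist w t)) \<partial>circle)"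
      proof (rule nn_integral_cmult)
        have "(\<lambda>w. dist w t) \<in> borel_measurable circle" by (rule borel_imp_circle) measurable
        then show "(\<lambda>w. ennreal (cmod (f w - f t)) * ennreal (poisson_weight (e i) (dist w t))) \<in> borel_measurable circle" by measurable
      qed
      also have "\<dots> \<le> ennreal C * ennreal (\<eta> / (2*C))" using elim(1) by (rule mult_left_mono) simp
      also have "\<dots> = ennreal (\<eta>/2)" using C \<eta> by (simp flip: ennreal_mult)
      finally have "norm (LINT w|circle. (f w - f t) * K i w) \<le> \<eta>/2" using \<eta> by simp
      then show ?case using \<eta> by simp
    qed
  qed
  then have "((\<lambda>i. (LINT w|circle. (f w - f t) * K i w) + f t * (LINT w|circle. K i w)) \<longlongrightarrow> 0 + f t * c) F"
    by (intro tendsto_intros Kc)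
  then show ?thesis using split by (simp add: tendsto_cong)
qed

section \<open>Analytic integrable functions\<close>

lemma fourier_coeff_circle:
  assumes [measurable]: "f \<in> borel_measurable circle"
  shows "fourier_coeff f n = (LINT w|circle. f w * w powi (-n))"
proof -
  have pm: "(\<lambda>w::complex. w powi (-n)) \<in> borel_measurable circle"
    by (intro continuous_imp_circle continuous_intros) auto
  have "(LINT \<theta>:{-pi..pi}|lebesgue. f (cis \<theta>) * exp (- \<i> * of_int n * of_real \<theta>)) =
    (LINT \<theta>:{-pi..pi}|lebesgue. f (cis \<theta>) * cis \<theta> powi (-n))"
  proof -
    have "exp (- \<i> * of_int n * of_real \<theta>) = cis (- (of_int n * \<theta>))" for \<theta>
      by (simp add: cis_conv_exp mult_ac)
    then have "exp (- \<i> * of_int n * of_real \<theta>) = cis \<theta> powi (-n)" for \<theta>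
      by (simp add: cis_power_int)
    then show ?thesis by simp
  qed
  also have "\<dots> = 2 * pi * (LINT w|circle. f w * w powi (-n))"
    using pm by (intro integral_over_angles) measurable
  finally show ?thesis by (simp add: fourier_coeff_def)
qed

lemma cnj_circle: "cmod z = 1 \<Longrightarrow> cnj z = inverse z"
  by (metis complex_div_cnj div_by_1 divide_inverse_commute mult.right_neutral of_real_1 one_power2 inverse_eq_divide mult_1)

lemma circle_nz: "cmod z = 1 \<Longrightarrow> z \<noteq> 0" by auto

lemma powi_borel_measurable [measurable]: "(\<lambda>w::complex. w powi n) \<in> borel_measurable borel"
  unfolding power_int_def by (cases "n \<ge> 0") simp_all

lemma powi_circle_measurable [measurable]: "(\<lambda>w::complex. w powi n) \<in> borel_measurable circle"
  by (intro continuous_imp_circle continuous_intros) auto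

lemma id_circle_measurable [measurable]: "(\<lambda>w::complex. w) \<in> borel_measurable circle"
  by (intro continuous_imp_circle continuous_intros)

lemma cmod_powi_circle [simp]: "cmod z = 1 \<Longrightarrow> cmod (z powi n) = 1"
  by (simp add: norm_power_int)

lemma bounded_integrable_circle:
  fixes f :: "complex \<Rightarrow> complex"
  assumes "f \<in> borel_measurable circle" "\<And>w. w \<in> sphere 0 1 \<Longrightarrow> cmod (f w) \<le> B"
  shows "integrable circle f"
proof -
  show ?thesis by (rule integrable_const_bound[where B=B]) (use assms in auto)
qed

lemma integrable_mult_bounded:
  fixes f g :: "complex \<Rightarrow> complex"
  assumes f: "integrable circle f" and g: "g \<in> borel_measurable circle" and b: "AE w in circle. cmod (g w) \<le> B"
  shows "integrable circle (\<lambda>w. f w * g w)"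
proof (rule Bochner_Integration.integrable_bound)
  show "integrable circle (\<lambda>w. B * f w)" using f by auto
  show "(\<lambda>w. f w * g w) \<in> borel_measurable circle" using f g by measurable
  show "AE w in circle. norm (f w * g w) \<le> norm (B * f w)" using b
  proof eventually_elim
    case (elim w)
    then have "cmod (g w) * cmod (f w) \<le> \<bar>B\<bar> * cmod (f w)" by (intro mult_right_mono) auto
    then show ?case by (simp add: norm_mult mult.commute)
  qed
qed

lemma integrable_mult_powi:
  fixes f :: "complex \<Rightarrow> complex"
  assumes f: "integrable circle f"
  shows "integrable circle (\<lambda>w. f w * w powi n)"
  by (rule integrable_mult_bounded[where B=1]) (use f in auto)

lemma integrable_powi: "integrable circle (\<lambda>w::complex. w powi n)"
  by (rule bounded_integrable_circle[where B=1]) auto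

text \<open>The rotation by \<open>c = cis (pi / n)\<close>, which is composed of two reflections, changes the sign of
  \<open>w\<^sup>n\<close>.\<close>
lemma integral_powi:
  "(LINT w|circle. w powi n) = (if n = 0 then 1 else 0)"
proof (cases "n = 0")
  case True
  show ?thesis using True by (simp add: prob_space del: space_circle)
next
  case False
  define c where "c = cis (pi / n)"
  have c1: "cmod c = 1" by (simp add: c_def)
  have cn: "c powi n = -1" using False by (simp add: c_def cis_power_int)
  have "(LINT w|circle. w powi n) = (LINT w|circle. (c * cnj w) powi n)"
    using integral_circle_reflect[OF powi_borel_measurable c1] by simp
  also have "\<dots> = (LINT w|circle. (c * cnj (1 * cnj w)) powi n)"
  proof (rule integral_circle_reflect[symmetric])
    have "(\<lambda>w. c * cnj w) \<in> borel_measurable borel" by (intro borel_measurable_continuous_onI continuous_intros)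
    then show "(\<lambda>w::complex. (c * cnj w) powi n) \<in> borel_measurable borel"
      by (rule measurable_compose) simp
  qed simp
  also have "\<dots> = - (LINT w|circle. w powi n)" by (simp add: power_int_mult_distrib cn)
  finally show ?thesis using False by simp
qed

text \<open>The Hardy space \<open>H\<^sup>1\<close>, with the negative Fourier coefficients written as integrals over the
  circle.\<close>
definition analytic_L1 :: "(complex \<Rightarrow> complex) \<Rightarrow> bool" where
  "analytic_L1 f \<longleftrightarrow> integrable circle f \<and> (\<forall>n>0. (LINT w|circle. f w * w powi n) = 0)"

lemma analytic_L1_iff: 
  "analytic_L1 f \<longleftrightarrow> integrable circle f \<and> (\<forall>n<0. fourier_coeff f n = 0)"
proof -
  have "(\<forall>n<0. fourier_coeff f n = 0) \<longleftrightarrow> (\<forall>n>0. (LINT w|circle. f w * w powi n) = 0)" if "integrable circle f"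
  proof -
    have m: "f \<in> borel_measurable circle" using that by auto
    show ?thesis
    proof (intro iffI allI impI)
      fix n :: int assume "\<forall>n<0. fourier_coeff f n = 0" "0 < n"
      then have "fourier_coeff f (-n) = 0" by simp
      then show "(LINT w|circle. f w * w powi n) = 0" unfolding fourier_coeff_circle[OF m] by simp
    next
      fix n :: int assume "\<forall>n>0. (LINT w|circle. f w * w powi n) = 0" "n < 0"
      then show "fourier_coeff f n = 0" unfolding fourier_coeff_circle[OF m] by simp
    qed
  qed
  then show ?thesis by (auto simp: analytic_L1_def)
qed

section \<open>The Riesz projection on analytic functions\<close>

text \<open>The truncated Cauchy kernel. The numerator comes from \<open>dw = \<i> w d\<theta>\<close>.\<close>
definition cauchy_kernel :: "complex \<Rightarrow> real \<Rightarrow> complex \<Rightarrow> complex" where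
  "cauchy_kernel t \<epsilon> w = (if cmod (w - t) > \<epsilon> then w / (w - t) else 0)"

lemma cauchy_kernel_measurable [measurable]: "cauchy_kernel t \<epsilon> \<in> borel_measurable borel"
  unfolding cauchy_kernel_def[abs_def] by measurable

lemma cauchy_kernel_measurable' [measurable]: "cauchy_kernel t \<epsilon> \<in> borel_measurable circle"
  by (rule borel_imp_circle) simp

lemma cauchy_kernel_bound:
  assumes "\<epsilon> > 0" "w \<in> sphere 0 1" shows "cmod (cauchy_kernel t \<epsilon> w) \<le> 1 / \<epsilon>"
  using assms by (auto simp: cauchy_kernel_def norm_divide intro!: divide_left_mono mult_pos_pos)

lemma cauchy_sing_limit:
  assumes f[measurable]: "f \<in> borel_measurable circle"
    and L: "((\<lambda>\<epsilon>. LINT w|circle. f w * cauchy_kernel t \<epsilon> w) \<longlongrightarrow> L) (at_right 0)"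
  shows "cauchy_sing f t = 2 * L"
proof -
  have eq: "(LINT \<theta>:{\<theta> \<in> {-pi..pi}. cmod (cis \<theta> - t) > \<epsilon>}|lebesgue. f (cis \<theta>) / (cis \<theta> - t) * (\<i> * cis \<theta>))
    = 2 * pi * \<i> * (LINT w|circle. f w * cauchy_kernel t \<epsilon> w)" for \<epsilon>
  proof -
    have "(LINT \<theta>:{\<theta> \<in> {-pi..pi}. cmod (cis \<theta> - t) > \<epsilon>}|lebesgue. f (cis \<theta>) / (cis \<theta> - t) * (\<i> * cis \<theta>))
      = (LINT \<theta>:{-pi..pi}|lebesgue. \<i> * (f (cis \<theta>) * cauchy_kernel t \<epsilon> (cis \<theta>)))"
      unfolding set_lebesgue_integral_def
      by (intro Bochner_Integration.integral_cong) (auto simp: indicator_def cauchy_kernel_def)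
    also have "\<dots> = 2 * pi * (LINT w|circle. \<i> * (f w * cauchy_kernel t \<epsilon> w))"
      by (intro integral_over_angles) measurable
    finally show ?thesis by simp
  qed
  have "((\<lambda>\<epsilon>. 2 * pi * \<i> * (LINT w|circle. f w * cauchy_kernel t \<epsilon> w)) \<longlongrightarrow> 2 * pi * \<i> * L) (at_right 0)"
    by (intro tendsto_intros L)
  then have "Lim (at_right 0) (\<lambda>\<epsilon>. 2 * pi * \<i> * (LINT w|circle. f w * cauchy_kernel t \<epsilon> w)) = 2 * pi * \<i> * L"
    by (intro tendsto_Lim) (auto simp: trivial_limit_at_right_real)
  then show ?thesis unfolding cauchy_sing_def eq by simp
qed

definition off_ball :: "complex \<Rightarrow> real \<Rightarrow> complex \<Rightarrow> complex" where
  "off_ball t \<epsilon> w = (if cmod (w - t) > \<epsilon> then 1 else 0)"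

lemma off_ball_measurable [measurable]: "off_ball t \<epsilon> \<in> borel_measurable circle"
  unfolding off_ball_def[abs_def] by (rule borel_imp_circle) measurable

lemma integral_off_ball:
  assumes t: "t \<in> sphere 0 1" and f[measurable]: "f \<in> borel_measurable circle" and b: "\<And>w. w \<in> sphere 0 1 \<Longrightarrow> cmod (f w) \<le> 1"
  shows "((\<lambda>\<epsilon>. LINT w|circle. f w * off_ball t \<epsilon> w) \<longlongrightarrow> (LINT w|circle. f w)) (at_right 0)"
proof -
  have fi: "integrable circle f" by (rule bounded_integrable_circle[OF f b])
  have "\<forall>\<^sub>F \<epsilon> in at_right 0. cmod ((LINT w|circle. f w * off_ball t \<epsilon> w) - (LINT w|circle. f w)) \<le> \<epsilon>"
    using eventually_at_right_less
  proof eventually_elim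
    case (elim \<epsilon>)
    have i2: "integrable circle (\<lambda>w. f w * off_ball t \<epsilon> w)"
      by (rule bounded_integrable_circle[where B=1]) (use b in \<open>auto simp: off_ball_def\<close>)
    have "(LINT w|circle. f w * off_ball t \<epsilon> w) - (LINT w|circle. f w) = (LINT w|circle. f w * off_ball t \<epsilon> w - f w)"
      using i2 fi by simp
    also have "cmod \<dots> \<le> (LINT w|circle. indicat_real (cball t \<epsilon> \<inter> sphere 0 1) w)"
    proof (rule Bochner_Integration.integral_norm_bound_integral)
      show "cmod (f w * off_ball t \<epsilon> w - f w) \<le> indicat_real (cball t \<epsilon> \<inter> sphere 0 1) w" if "w \<in> space circle" for w
        using b[of w] that by (auto simp: off_ball_def indicator_def dist_norm norm_minus_commute)
    qed (use i2 fi in \<open>auto simp: borel_closed less_top[symmetric] intro!: integrable_real_indicator\<close>)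
    also have "\<dots> = measure circle (cball t \<epsilon> \<inter> sphere 0 1)" by (simp add: borel_closed)
    also have "\<dots> \<le> \<epsilon>"
      using emeasure_cball_circle[OF t, of \<epsilon>] elim by (simp add: emeasure_eq_measure)
    finally show ?case .
  qed
  then have "((\<lambda>\<epsilon>. (LINT w|circle. f w * off_ball t \<epsilon> w) - (LINT w|circle. f w)) \<longlongrightarrow> 0) (at_right 0)"
    by (rule Lim_null_comparison) (rule tendsto_ident_at)
  then show ?thesis by (rule LIM_zero_cancel)
qed

text \<open>The kernel and its image under the reflection \<open>w \<mapsto> t\<^sup>2 / w\<close> add up to 1 off the ball of
  radius \<open>\<epsilon>\<close>.\<close>
lemma integral_cauchy_kernel:
  assumes t: "t \<in> sphere 0 1"
  shows "((\<lambda>\<epsilon>. LINT w|circle. cauchy_kernel t \<epsilon> w) \<longlongrightarrow> 1/2) (at_right 0)"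
proof -
  have t1: "cmod t = 1" "t \<noteq> 0" using t by auto
  have eq: "(LINT w|circle. off_ball t \<epsilon> w) / 2 = (LINT w|circle. cauchy_kernel t \<epsilon> w)" if e: "\<epsilon> > 0" for \<epsilon>
  proof -
    have i: "integrable circle (cauchy_kernel t \<epsilon>)"
      by (rule bounded_integrable_circle[where B="1/\<epsilon>"]) (use cauchy_kernel_bound[OF e] in auto)
    have o: "integrable circle (off_ball t \<epsilon>)"
      by (rule bounded_integrable_circle[where B=1]) (auto simp: off_ball_def)
    have "(LINT w|circle. cauchy_kernel t \<epsilon> w) = (LINT w|circle. cauchy_kernel t \<epsilon> (t\<^sup>2 * cnj w))"
      by (rule integral_circle_reflect[symmetric]) (auto simp: norm_power t1)
    also have "\<dots> = (LINT w|circle. off_ball t \<epsilon> w - cauchy_kernel t \<epsilon> w)"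
    proof (intro Bochner_Integration.integral_cong refl)
      fix w assume "w \<in> space circle"
      then have w: "cmod w = 1" "w \<noteq> 0" by auto
      have d: "t\<^sup>2 * cnj w - t = t * (t - w) / w" using w t1 by (simp add: cnj_circle field_simps power2_eq_square)
      have "cmod (t\<^sup>2 * cnj w - t) = cmod (w - t)" unfolding d using w t1 by (simp add: norm_mult norm_divide norm_minus_commute)
      moreover have "t\<^sup>2 * cnj w / (t\<^sup>2 * cnj w - t) = 1 - w / (w - t)" if "w \<noteq> t"
        unfolding d using w t1 that by (simp add: cnj_circle field_simps power2_eq_square)
      ultimately show "cauchy_kernel t \<epsilon> (t\<^sup>2 * cnj w) = off_ball t \<epsilon> w - cauchy_kernel t \<epsilon> w"
        using e by (cases "w = t") (simp_all add: cauchy_kernel_def off_ball_def)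
    qed
    also have "\<dots> = (LINT w|circle. off_ball t \<epsilon> w) - (LINT w|circle. cauchy_kernel t \<epsilon> w)"
      using i o by (rule Bochner_Integration.integral_diff[rotated])
    finally show ?thesis by (simp add: field_simps)
  qed
  have "((\<lambda>\<epsilon>. (LINT w|circle. 1 * off_ball t \<epsilon> w) / 2) \<longlongrightarrow> (LINT w|circle. 1) / 2) (at_right 0)"
    by (intro tendsto_intros integral_off_ball t) auto
  then have *: "((\<lambda>\<epsilon>. (LINT w|circle. off_ball t \<epsilon> w) / 2) \<longlongrightarrow> 1 / 2) (at_right 0)"
    by (simp add: prob_space del: space_circle)
  show ?thesis
    by (rule Lim_transform_eventually[OF *]) 
       (use eventually_at_right_less in \<open>eventually_elim, simp add: eq\<close>)
qed

text \<open>A polynomial in \<open>z\<close> without constant term, the mean of the partial sums of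
  \<open>z + z\<^sup>2 + z\<^sup>3 + \<dots> = z / (1 - z)\<close>.\<close>
abbreviation cesaro_geometric :: "nat \<Rightarrow> complex \<Rightarrow> complex" where
  "cesaro_geometric N z \<equiv> (\<Sum>k<N. \<Sum>j<k. z^(j+1)) / of_nat N"

text \<open>With \<open>q\<close> the mean of the first \<open>N\<close> powers of \<open>z\<close>, the Cesaro mean differs from \<open>z / (1 - z)\<close> by
  \<open>z q / (1 - z)\<close>, which is of order \<open>1 / (N \<bar>1 - z\<bar>\<^sup>2)\<close>.\<close>
lemma geometric_mean_identities:
  fixes z :: complex
  assumes z: "cmod z = 1" and N: "N > 0"
  defines "q \<equiv> (\<Sum>k<N. z^k) / of_nat N"
    and "A \<equiv> cesaro_geometric N z"
  shows "(1 - z) * A = z * (1 - q)" "cmod (1 - z) * cmod q \<le> 2 / N" "cmod A \<le> N"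
proof -
  have "(1 - z) * (\<Sum>j<k. z^(j+1)) = z * (1 - z^k)" for k
  proof -
    have "(\<Sum>j<k. z^(j+1)) = z * (\<Sum>j<k. z^j)" by (simp add: sum_distrib_left)
    then show ?thesis using one_diff_power_eq[of z k] by (simp add: mult.left_commute)
  qed
  then have "(1 - z) * (\<Sum>k<N. \<Sum>j<k. z^(j+1)) = (\<Sum>k<N. z * (1 - z^k))"
    unfolding sum_distrib_left by simp
  also have "\<dots> = z * (of_nat N - (\<Sum>k<N. z^k))" by (simp add: sum_subtractf flip: sum_distrib_left)
  finally show "(1 - z) * A = z * (1 - q)" using N unfolding A_def q_def by (simp add: field_simps)
  have "(1 - z) * (\<Sum>k<N. z^k) = 1 - z^N" by (rule one_diff_power_eq[symmetric])
  then have "cmod (1 - z) * cmod (\<Sum>k<N. z^k) = cmod (1 - z^N)" by (metis norm_mult)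
  also have "\<dots> \<le> 1 + cmod (z^N)" by (metis norm_triangle_ineq4 norm_one)
  also have "\<dots> = 2" using z by (simp add: norm_power)
  finally show "cmod (1 - z) * cmod q \<le> 2 / N" unfolding q_def using N by (simp add: norm_divide divide_right_mono)
  have "cmod (\<Sum>k<N. \<Sum>j<k. z^(j+1)) \<le> (\<Sum>k<N. real N)"
  proof (rule sum_norm_le)
    fix k assume "k \<in> {..<N}"
    have "cmod (\<Sum>j<k. z^(j+1)) \<le> (\<Sum>j<k. 1)" by (rule sum_norm_le) (use z in \<open>simp add: norm_mult norm_power\<close>)
    also have "\<dots> \<le> real N" using \<open>k \<in> {..<N}\<close> by simp
    finally show "cmod (\<Sum>j<k. z^(j+1)) \<le> real N" .
  qed
  then show "cmod A \<le> N" unfolding A_def using N by (simp add: norm_divide field_simps)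
qed

text \<open>With \<open>z = w / t\<close> the Cauchy kernel is \<open>- z / (1 - z)\<close>, so the Cesaro mean cancels its
  singularity. What is left has the size of an approximate identity if the number of terms is of order
  \<open>1/\<epsilon>\<close>: outside the ball of radius \<open>\<epsilon>\<close> it is at most \<open>2 \<epsilon> / \<bar>w - t\<bar>\<^sup>2\<close>, inside at most \<open>2 / \<epsilon>\<close>.\<close>
lemma analytic_correction_bound:
  assumes t: "cmod t = 1" and w: "cmod w = 1" and e: "0 < \<epsilon>" "\<epsilon> < 1"
  defines "N \<equiv> nat \<lceil>1/\<epsilon>\<rceil>"
  shows "cmod (cauchy_kernel t \<epsilon> w + cesaro_geometric N (w * cnj t)) \<le> 4 * poisson_weight \<epsilon> (dist w t)"
proof -
  have N: "1/\<epsilon> \<le> N" "N \<le> 1/\<epsilon> + 1" "N > 0"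
    using e unfolding N_def by (auto simp: of_nat_nat intro: less_imp_le)
  define z where "z = w * cnj t"
  have z: "cmod z = 1" using t w by (simp add: z_def norm_mult)
  define q where "q = (\<Sum>k<N. z^k) / of_nat N"
  define A where "A = cesaro_geometric N z"
  note G = geometric_mean_identities[OF z N(3), folded q_def A_def]
  have tnz: "t \<noteq> 0" using t by auto
  have zt: "z = w / t" unfolding z_def cnj_circle[OF t] by (simp add: divide_inverse)
  have d: "cmod (1 - z) = dist w t"
  proof -
    have "1 - z = (t - w) / t" using tnz by (simp add: zt field_simps)
    then show ?thesis using t by (simp add: norm_divide dist_norm norm_minus_commute)
  qed
  have pos: "0 < \<epsilon>\<^sup>2 + (dist w t)\<^sup>2" using e by (simp add: add_pos_nonneg)
  show ?thesis
  proof (cases "dist w t > \<epsilon>")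
    case True
    then have "0 < dist w t" using e by linarith
    then have "w \<noteq> t" and nz: "z \<noteq> 1" using d by auto
    have "w / (w - t) = z / (z - 1)" using tnz \<open>w \<noteq> t\<close> nz by (simp add: zt field_simps)
    moreover have "A = z * (1 - q) / (1 - z)" using G(1) nz by (simp add: field_simps)
    ultimately have "cauchy_kernel t \<epsilon> w + A = z / (z - 1) + z * (1 - q) / (1 - z)"
      using True by (simp add: cauchy_kernel_def dist_norm)
    also have "\<dots> = - (z * q) / (1 - z)" using nz by (simp add: field_simps)
    finally have "cmod (cauchy_kernel t \<epsilon> w + A) = cmod q / dist w t" using z d by (simp add: norm_divide norm_mult)
    also have "\<dots> \<le> (2 / N / dist w t) / dist w t"
    proof (rule divide_right_mono)
      show "cmod q \<le> 2 / N / dist w t"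
        using G(2) True e unfolding d by (subst pos_le_divide_eq) (auto simp: mult.commute)
    qed simp
    also have "\<dots> = 2 / N / (dist w t)\<^sup>2" by (simp add: power2_eq_square)
    also have "\<dots> \<le> 2 * \<epsilon> / (dist w t)\<^sup>2"
    proof (rule divide_right_mono)
      show "2 / real N \<le> 2 * \<epsilon>" using N e by (simp add: field_simps)
    qed simp
    also have "\<dots> \<le> 4 * poisson_weight \<epsilon> (dist w t)"
    proof -
      have "\<epsilon>\<^sup>2 \<le> (dist w t)\<^sup>2" using True e by (intro power_mono) auto
      then have "2 * \<epsilon> * (\<epsilon>\<^sup>2 + (dist w t)\<^sup>2) \<le> 2 * \<epsilon> * (2 * (dist w t)\<^sup>2)" using e by (intro mult_left_mono) auto
      moreover have "0 < (dist w t)\<^sup>2" using \<open>0 < dist w t\<close> by simp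
      ultimately show ?thesis using pos by (simp add: field_simps)
    qed
    finally show ?thesis by (simp add: A_def z_def)
  next
    case False
    have "cmod (cauchy_kernel t \<epsilon> w + A) = cmod A" using False by (simp add: cauchy_kernel_def dist_norm)
    also have "\<dots> \<le> N" by (rule G(3))
    also have "\<dots> \<le> 2 / \<epsilon>"
    proof -
      have "1/\<epsilon> + 1 \<le> 2 / \<epsilon>" using e by (simp add: field_simps)
      then show ?thesis using N by linarith
    qed
    also have "\<dots> \<le> 4 * poisson_weight \<epsilon> (dist w t)"
    proof -
      have "(dist w t)\<^sup>2 \<le> \<epsilon>\<^sup>2" using False by (intro power_mono) auto
      then have "2 * (\<epsilon>\<^sup>2 + (dist w t)\<^sup>2) \<le> 4 * \<epsilon> * \<epsilon>" by (simp add: power2_eq_square)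
      then show ?thesis using pos e by (simp add: field_simps)
    qed
    finally show ?thesis by (simp add: A_def z_def)
  qed
qed

lemma analytic_L1_one: "analytic_L1 (\<lambda>_. 1)"
proof -
  show ?thesis by (auto simp: analytic_L1_def integral_powi)
qed

lemma integral_analytic_correction:
  assumes f: "analytic_L1 f"
  shows "integrable circle (\<lambda>w. f w * cesaro_geometric N (w * c))"
    and "(LINT w|circle. f w * cesaro_geometric N (w * c)) = 0"
proof -
  have fi: "integrable circle f" using f by (simp add: analytic_L1_def)
  have i: "integrable circle (\<lambda>w. f w * (w * c)^(j+1))" for j :: nat
  proof -
    have "integrable circle (\<lambda>w. c^(j+1) * (f w * w powi int (j+1)))"
      by (intro integrable_mult_right integrable_mult_powi fi)
    then show ?thesis unfolding power_int_of_nat by (simp only: power_mult_distrib mult_ac)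
  qed
  have z: "(LINT w|circle. f w * (w * c)^(j+1)) = 0" for j :: nat
  proof -
    have "(LINT w|circle. f w * (w * c)^(j+1)) = (LINT w|circle. c^(j+1) * (f w * w powi int (j+1)))"
      unfolding power_int_of_nat by (simp only: power_mult_distrib mult_ac)
    also have "\<dots> = c^(j+1) * (LINT w|circle. (f w * w powi int (j+1)))" by simp
    also have "(LINT w|circle. (f w * w powi int (j+1))) = 0" using f unfolding analytic_L1_def by simp
    finally show ?thesis by simp
  qed
  have eq: "f w * cesaro_geometric N (w * c) = (\<Sum>k<N. \<Sum>j<k. f w * (w * c)^(j+1)) / of_nat N" for w
    unfolding sum_distrib_left by (simp only: times_divide_eq_right sum_distrib_left)
  show "integrable circle (\<lambda>w. f w * cesaro_geometric N (w * c))"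
    unfolding eq by (intro Bochner_Integration.integrable_divide Bochner_Integration.integrable_sum i)
  show "(LINT w|circle. f w * cesaro_geometric N (w * c)) = 0"
    unfolding eq using i z by (simp add: Bochner_Integration.integral_sum del: power_Suc)
qed

text \<open>The corrected kernel has the same integral against \<open>f\<close> as the Cauchy kernel, because \<open>f\<close> is
  analytic, and the same total mass, because the constant 1 is analytic.\<close>
lemma cauchy_kernel_limit:
  assumes f: "analytic_L1 f" and L: "lebesgue_point f t" and t: "t \<in> sphere 0 1"
  shows "((\<lambda>\<epsilon>. LINT w|circle. f w * cauchy_kernel t \<epsilon> w) \<longlongrightarrow> f t / 2) (at_right 0)"
proof -
  have t1: "cmod t = 1" using t by simp
  have fi: "integrable circle f" using f by (simp add: analytic_L1_def)
  define A where "A \<epsilon> w = cesaro_geometric (nat \<lceil>1/\<epsilon>\<rceil>) (w * cnj t)" for \<epsilon> :: real and w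
  have Am[measurable]: "A \<epsilon> \<in> borel_measurable circle" for \<epsilon>
    unfolding A_def[abs_def] by (rule borel_imp_circle) measurable
  have AE0: "integrable circle (\<lambda>w. g w * A \<epsilon> w)" "(LINT w|circle. g w * A \<epsilon> w) = 0" if "analytic_L1 g" for g \<epsilon>
    unfolding A_def by (rule integral_analytic_correction[OF that])+
  have same: "(LINT w|circle. g w * (cauchy_kernel t \<epsilon> w + A \<epsilon> w)) = (LINT w|circle. g w * cauchy_kernel t \<epsilon> w)"
    if g: "analytic_L1 g" and e: "\<epsilon> > 0" for g \<epsilon>
  proof -
    have "integrable circle (\<lambda>w. g w * cauchy_kernel t \<epsilon> w)"
      by (rule integrable_mult_bounded[where B="1/\<epsilon>"]) (use g cauchy_kernel_bound[OF e] in \<open>auto simp: analytic_L1_def\<close>)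
    then show ?thesis using AE0[OF g, of \<epsilon>] by (simp add: distrib_left)
  qed
  have "((\<lambda>\<epsilon>. LINT w|circle. f w * (cauchy_kernel t \<epsilon> w + A \<epsilon> w)) \<longlongrightarrow> f t * (1/2)) (at_right 0)"
  proof (rule lebesgue_point_kernel_limit[OF fi L, where e="\<lambda>\<epsilon>. \<epsilon>" and C=4])
    show "\<forall>\<^sub>F i in at_right 0. \<forall>w\<in>sphere 0 1. cmod (cauchy_kernel t i w + A i w) \<le> 4 * poisson_weight i (dist w t)"
      using eventually_at_right_real[OF zero_less_one]
    proof eventually_elim
      case (elim i)
      show ?case unfolding A_def
      proof
        fix w :: complex assume "w \<in> sphere 0 1"
        then show "cmod (cauchy_kernel t i w + cesaro_geometric (nat \<lceil>1/i\<rceil>) (w * cnj t)) \<le> 4 * poisson_weight i (dist w t)"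
          using t1 elim by (intro analytic_correction_bound) auto
      qed
    qed
    show "((\<lambda>i. LINT w|circle. cauchy_kernel t i w + A i w) \<longlongrightarrow> 1 / 2) (at_right 0)"
    proof (rule Lim_transform_eventually[OF integral_cauchy_kernel[OF t]])
      show "\<forall>\<^sub>F \<epsilon> in at_right 0. (LINT w|circle. cauchy_kernel t \<epsilon> w) = (LINT w|circle. cauchy_kernel t \<epsilon> w + A \<epsilon> w)"
        using eventually_at_right_less
        by eventually_elim (use same[OF analytic_L1_one] in simp)
    qed
  qed (auto intro!: always_eventually filterlim_ident)
  then have *: "((\<lambda>\<epsilon>. LINT w|circle. f w * (cauchy_kernel t \<epsilon> w + A \<epsilon> w)) \<longlongrightarrow> f t / 2) (at_right 0)"
    by simp
  show ?thesis
  proof (rule Lim_transform_eventually[OF *])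
    show "\<forall>\<^sub>F \<epsilon> in at_right 0. (LINT w|circle. f w * (cauchy_kernel t \<epsilon> w + A \<epsilon> w)) = (LINT w|circle. f w * cauchy_kernel t \<epsilon> w)"
      using eventually_at_right_less by eventually_elim (rule same[OF f])
  qed
qed

lemma riesz_analytic:
  assumes f: "analytic_L1 f"
  shows "AE t in circle. riesz f t = f t"
proof -
  have fi: "integrable circle f" using f by (simp add: analytic_L1_def)
  show ?thesis using AE_lebesgue_point[OF fi] AE_space
  proof eventually_elim
    case (elim t)
    have "cauchy_sing f t = 2 * (f t / 2)"
      using elim fi by (intro cauchy_sing_limit cauchy_kernel_limit f) auto
    then show ?case by (simp add: riesz_def)
  qed
qed

lemma analytic_L1_mon: "n \<ge> 0 \<Longrightarrow> analytic_L1 (mon n)"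
proof -
  assume n: "n \<ge> 0"
  have "(LINT w|circle. mon n w * w powi m) = 0" if "m > 0" for m
  proof -
    have "(LINT w|circle. mon n w * w powi m) = (LINT w|circle. w powi (n + m))"
      by (intro Bochner_Integration.integral_cong) (auto simp: mon_def power_int_add circle_nz)
    then show ?thesis using that n by (simp add: integral_powi)
  qed
  then show ?thesis using integrable_powi[of n] by (simp add: analytic_L1_def mon_def[abs_def])
qed

lemma cnj_mon: "cmod t = 1 \<Longrightarrow> cnj (mon n t) = mon (-n) t"
  unfolding mon_def power_int_minus by (rule cnj_circle) simp

text \<open>On the circle the complex conjugate of the Cauchy kernel is 1 minus the kernel outside
  the truncated ball. So the principal value for \<open>e\<^sub>-\<^sub>n\<close> is obtained from that for its conjugate \<open>e\<^sub>n\<close>.\<close>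
lemma riesz_mon_negative:
  assumes n: "n > 0"
  shows "AE t in circle. riesz (mon (-n)) t = 0"
proof -
  have an: "analytic_L1 (mon n)" using n by (intro analytic_L1_mon) simp
  then have ni: "integrable circle (mon n)" by (simp add: analytic_L1_def)
  have mm[measurable]: "mon k \<in> borel_measurable circle" for k unfolding mon_def[abs_def] by measurable
  show ?thesis using AE_lebesgue_point[OF ni] AE_space
  proof eventually_elim
    case (elim t)
    have t: "t \<in> sphere 0 1" using elim by simp
    then have t1: "cmod t = 1" "t \<noteq> 0" by auto
    have L1: "((\<lambda>\<epsilon>. LINT w|circle. mon n w * cauchy_kernel t \<epsilon> w) \<longlongrightarrow> mon n t / 2) (at_right 0)"
      using elim by (intro cauchy_kernel_limit an) auto
    have L2: "((\<lambda>\<epsilon>. LINT w|circle. mon n w * off_ball t \<epsilon> w) \<longlongrightarrow> (LINT w|circle. mon n w)) (at_right 0)"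
      by (intro integral_off_ball t mm) (simp add: mon_def)
    have z: "(LINT w|circle. mon n w) = 0" using n by (simp add: mon_def integral_powi)
    have eq: "cnj ((LINT w|circle. mon n w * off_ball t \<epsilon> w) - (LINT w|circle. mon n w * cauchy_kernel t \<epsilon> w))
       = (LINT w|circle. mon (-n) w * cauchy_kernel t \<epsilon> w)" if e: "\<epsilon> > 0" for \<epsilon>
    proof -
      have i1: "integrable circle (\<lambda>w. mon n w * off_ball t \<epsilon> w)"
        by (rule integrable_mult_bounded[where B=1]) (auto simp: off_ball_def ni)
      have i2: "integrable circle (\<lambda>w. mon n w * cauchy_kernel t \<epsilon> w)"
        by (rule integrable_mult_bounded[where B="1/\<epsilon>"]) (use cauchy_kernel_bound[OF e] ni in auto)
      have "cnj ((LINT w|circle. mon n w * off_ball t \<epsilon> w) - (LINT w|circle. mon n w * cauchy_kernel t \<epsilon> w))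
        = cnj (LINT w|circle. mon n w * off_ball t \<epsilon> w - mon n w * cauchy_kernel t \<epsilon> w)"
        using i1 i2 by simp
      also have "\<dots> = (LINT w|circle. cnj (mon n w * off_ball t \<epsilon> w - mon n w * cauchy_kernel t \<epsilon> w))"
        by (simp only: Bochner_Integration.integral_cnj)
      also have "\<dots> = (LINT w|circle. mon (-n) w * cauchy_kernel t \<epsilon> w)"
      proof (intro Bochner_Integration.integral_cong refl)
        fix w assume "w \<in> space circle"
        then have w: "cmod w = 1" "w \<noteq> 0" by auto
        have "cnj (off_ball t \<epsilon> w - cauchy_kernel t \<epsilon> w) = cauchy_kernel t \<epsilon> w"
        proof (cases "cmod (w - t) > \<epsilon>")
          case True
          then have ne: "w \<noteq> t" using e by auto
          have "cnj (1 - w / (w - t)) = 1 - inverse w / (inverse w - inverse t)"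
            using w t1 by (simp add: cnj_circle)
          also have "\<dots> = w / (w - t)" using w t1 ne by (simp add: field_simps)
          finally show ?thesis using True by (simp add: off_ball_def cauchy_kernel_def)
        qed (simp add: off_ball_def cauchy_kernel_def)
        moreover have "cnj (mon n w) = mon (-n) w"
          by (rule cnj_mon[OF w(1)])
        ultimately show "cnj (mon n w * off_ball t \<epsilon> w - mon n w * cauchy_kernel t \<epsilon> w) = mon (-n) w * cauchy_kernel t \<epsilon> w"
          by (metis complex_cnj_mult right_diff_distrib)
      qed
      finally show ?thesis .
    qed
    have "((\<lambda>\<epsilon>. cnj ((LINT w|circle. mon n w * off_ball t \<epsilon> w) - (LINT w|circle. mon n w * cauchy_kernel t \<epsilon> w))) \<longlongrightarrow> cnj (0 - mon n t / 2)) (at_right 0)"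
      by (intro tendsto_intros L1 L2[unfolded z])
    moreover have "cnj (0 - mon n t / 2) = - mon (-n) t / 2"
      using cnj_mon[OF t1(1)] by simp
    ultimately have L3: "((\<lambda>\<epsilon>. cnj ((LINT w|circle. mon n w * off_ball t \<epsilon> w) - (LINT w|circle. mon n w * cauchy_kernel t \<epsilon> w))) \<longlongrightarrow> - mon (-n) t / 2) (at_right 0)"
      by simp
    have "((\<lambda>\<epsilon>. LINT w|circle. mon (-n) w * cauchy_kernel t \<epsilon> w) \<longlongrightarrow> - mon (-n) t / 2) (at_right 0)"
    proof (rule Lim_transform_eventually[OF L3])
      show "\<forall>\<^sub>F \<epsilon> in at_right 0. cnj ((LINT w|circle. mon n w * off_ball t \<epsilon> w) - (LINT w|circle. mon n w * cauchy_kernel t \<epsilon> w))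
       = (LINT w|circle. mon (-n) w * cauchy_kernel t \<epsilon> w)"
        using eventually_at_right_less by eventually_elim (rule eq)
    qed
    then have "cauchy_sing (mon (-n)) t = 2 * (- mon (-n) t / 2)" by (rule cauchy_sing_limit[OF mm])
    then show ?case by (simp add: riesz_def)
  qed
qed

section \<open>Products of analytic functions\<close>

text \<open>The Fejer kernel as a multiple of a square, so that it is visibly nonnegative.\<close>
definition fejer :: "nat \<Rightarrow> complex \<Rightarrow> complex" where
  "fejer N z = of_real ((cmod (\<Sum>k<N. z^k))\<^sup>2 / N)"

lemma fejer_expand:
  assumes w: "cmod w = 1" and t: "cmod t = 1"
  shows "fejer N (w * cnj t) = (\<Sum>k<N. \<Sum>m<N. w powi (int k - int m) * t powi (int m - int k)) / of_nat N"
proof -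
  have nz: "w \<noteq> 0" "t \<noteq> 0" using assms by auto
  define z where "z = w * cnj t"
  have "(complex_of_real (cmod (\<Sum>k<N. z^k)))\<^sup>2 = (\<Sum>k<N. z^k) * cnj (\<Sum>m<N. z^m)"
    using complex_norm_square by simp
  also have "\<dots> = (\<Sum>k<N. \<Sum>m<N. z^k * cnj z^m)"
    by (simp add: sum_product)
  also have "\<dots> = (\<Sum>k<N. \<Sum>m<N. w powi (int k - int m) * t powi (int m - int k))"
  proof (intro sum.cong refl)
    fix k m
    show "z^k * cnj z^m = w powi (int k - int m) * t powi (int m - int k)"
    proof -
      have "cnj z = inverse w * t" by (simp add: z_def cnj_circle[OF w])
      moreover have "z = w * inverse t" by (simp add: z_def cnj_circle[OF t])
      ultimately have "z^k * cnj z^m = (w * inverse t)^k * (inverse w * t)^m" by simp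
      then show ?thesis
        using nz by (simp add: power_int_diff power_mult_distrib power_inverse divide_inverse mult_ac)
    qed
  qed
  finally show ?thesis by (simp add: fejer_def z_def)
qed

lemma fejer_bound:
  assumes w: "cmod w = 1" and t: "cmod t = 1" and N: "N > 0"
  shows "cmod (fejer N (w * cnj t)) \<le> 8 * poisson_weight (1/N) (dist w t)"
proof -
  define e where "e = 1 / real N"
  have e: "e > 0" "real N = 1 / e" using N by (auto simp: e_def)
  define z where "z = w * cnj t"
  have z: "cmod z = 1" using t w by (simp add: z_def norm_mult)
  define q where "q = (\<Sum>k<N. z^k) / of_nat N"
  have G: "cmod (1 - z) * cmod q \<le> 2 / N" unfolding q_def by (rule geometric_mean_identities(2)[OF z N])
  have d: "cmod (1 - z) = dist w t"
  proof -
    have "cmod (1 - z) = cmod (t * (1 - z))" using t by (simp add: norm_mult)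
    also have "t * (1 - z) = t - w * (t * cnj t)" by (simp add: z_def algebra_simps)
    also have "t * cnj t = 1" using t complex_norm_square[of t] by simp
    finally show ?thesis by (simp add: dist_norm norm_minus_commute)
  qed
  have F: "cmod (fejer N z) = (cmod q)\<^sup>2 / e"
  proof -
    have "(\<Sum>k<N. z^k) = of_nat N * q" using N by (simp add: q_def)
    then have "cmod (\<Sum>k<N. z^k) = N * cmod q" by (simp add: norm_mult)
    then have "fejer N z = of_real ((real N * cmod q)\<^sup>2 / real N)" unfolding fejer_def by (simp only:)
    then have "cmod (fejer N z) = (real N * cmod q)\<^sup>2 / real N" by (simp only: norm_of_real) simp
    then show ?thesis using e by (simp add: power2_eq_square)
  qed
  have pos: "0 < e\<^sup>2 + (dist w t)\<^sup>2" using e by (simp add: add_pos_nonneg)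
  have "cmod (fejer N z) \<le> 8 * (poisson_weight e (dist w t))"
  proof (cases "dist w t > e")
    case True
    then have dp: "dist w t > 0" using e by linarith
    have "cmod q \<le> 2 * e / dist w t"
      using G dp e unfolding d by (subst pos_le_divide_eq) (auto simp: mult.commute)
    then have "(cmod q)\<^sup>2 \<le> (2 * e / dist w t)\<^sup>2" by (intro power_mono) auto
    then have "cmod (fejer N z) \<le> (2 * e / dist w t)\<^sup>2 / e"
      unfolding F using e by (intro divide_right_mono) auto
    also have "\<dots> = 4 * e / (dist w t)\<^sup>2" using e by (simp add: power_divide power_mult_distrib power2_eq_square)
    also have "\<dots> \<le> 8 * (poisson_weight e (dist w t))"
    proof -
      have "e\<^sup>2 \<le> (dist w t)\<^sup>2" using True e by (intro power_mono) auto
      then have "4 * e * (e\<^sup>2 + (dist w t)\<^sup>2) \<le> 4 * e * (2 * (dist w t)\<^sup>2)" using e by (intro mult_left_mono) auto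
      moreover have "0 < (dist w t)\<^sup>2" using dp by simp
      ultimately show ?thesis using pos by (simp add: field_simps)
    qed
    finally show ?thesis .
  next
    case False
    have "cmod (\<Sum>k<N. z^k) \<le> (\<Sum>k<N. 1)" by (rule sum_norm_le) (use z in \<open>simp add: norm_power\<close>)
    then have "cmod q \<le> 1" using N by (simp add: q_def norm_divide)
    then have "(cmod q)\<^sup>2 \<le> 1" by (simp add: power_le_one)
    then have "cmod (fejer N z) \<le> 1 / e" unfolding F using e by (intro divide_right_mono) auto
    also have "\<dots> \<le> 8 * (poisson_weight e (dist w t))"
    proof -
      have "(dist w t)\<^sup>2 \<le> e\<^sup>2" using False by (intro power_mono) auto
      then have "e\<^sup>2 + (dist w t)\<^sup>2 \<le> 8 * e * e" by (simp add: power2_eq_square) (smt (verit) mult_nonneg_nonneg e)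
      then show ?thesis using pos e by (simp add: field_simps)
    qed
    finally show ?thesis .
  qed
  then show ?thesis by (simp only: z_def e_def)
qed

lemma fejer_measurable [measurable]: "(\<lambda>w. fejer N (w * c)) \<in> borel_measurable circle"
  unfolding fejer_def by (rule borel_imp_circle) measurable

definition cesaro_mean :: "(complex \<Rightarrow> complex) \<Rightarrow> nat \<Rightarrow> complex \<Rightarrow> complex" where
  "cesaro_mean h N t = (LINT w|circle. h w * fejer N (w * cnj t))"

lemma cesaro_mean_eq:
  assumes h: "integrable circle h" and t: "cmod t = 1"
  shows "cesaro_mean h N t = (\<Sum>k<N. \<Sum>m<N. (LINT w|circle. h w * w powi (int k - int m)) * t powi (int m - int k)) / of_nat N"
proof -
  have "cesaro_mean h N t = (LINT w|circle. (\<Sum>k<N. \<Sum>m<N. h w * w powi (int k - int m) * t powi (int m - int k)) / of_nat N)"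
    unfolding cesaro_mean_def
    by (intro Bochner_Integration.integral_cong refl)
       (simp add: fejer_expand[OF _ t] sum_distrib_left mult.assoc)
  also have "\<dots> = (\<Sum>k<N. \<Sum>m<N. (LINT w|circle. h w * w powi (int k - int m) * t powi (int m - int k))) / of_nat N"
    using integrable_mult_powi[OF h] by (simp add: Bochner_Integration.integral_sum Bochner_Integration.integrable_sum)
  finally show ?thesis by simp
qed

lemma integral_fejer:
  assumes t: "cmod t = 1" and N: "N > 0"
  shows "(LINT w|circle. fejer N (w * cnj t)) = 1"
proof -
  have "(LINT w|circle. fejer N (w * cnj t)) = cesaro_mean (\<lambda>_. 1) N t" by (simp add: cesaro_mean_def)
  also have "\<dots> = (\<Sum>k<N. \<Sum>m<N. (LINT w|circle. 1 * w powi (int k - int m)) * t powi (int m - int k)) / of_nat N"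
    by (rule cesaro_mean_eq[OF _ t]) simp
  also have "(\<Sum>k<N. \<Sum>m<N. (LINT w|circle. 1 * w powi (int k - int m)) * t powi (int m - int k)) = (\<Sum>k<N. 1)"
  proof (rule sum.cong[OF refl])
    fix k assume k: "k \<in> {..<N}"
    have "(\<Sum>m<N. (LINT w|circle. 1 * w powi (int k - int m)) * t powi (int m - int k)) = (\<Sum>m<N. if m = k then 1 else 0)"
      by (intro sum.cong) (auto simp: integral_powi)
    then show "(\<Sum>m<N. (LINT w|circle. 1 * w powi (int k - int m)) * t powi (int m - int k)) = 1" using k by simp
  qed
  also have "(\<Sum>k<N. 1) / of_nat N = (1::complex)" using N by simp
  finally show ?thesis .
qed

lemma cesaro_mean_bound:
  assumes h: "integrable circle h" and B: "AE w in circle. cmod (h w) \<le> B" and t: "cmod t = 1" and N: "N > 0"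
  shows "cmod (cesaro_mean h N t) \<le> B"
proof -
  have Fi: "integrable circle (\<lambda>w. fejer N (w * cnj t))"
    using not_integrable_integral_eq[of circle "\<lambda>w. fejer N (w * cnj t)"] integral_fejer[OF t N] by fastforce
  have Ri: "integrable circle (\<lambda>w. B * Re (fejer N (w * cnj t)))" using Fi by (intro integrable_mult_right integrable_Re)
  have fb: "AE w in circle. cmod (h w * fejer N (w * cnj t)) \<le> B * Re (fejer N (w * cnj t))"
    using B
  proof eventually_elim
    case (elim w)
    have "cmod (fejer N (w * cnj t)) = Re (fejer N (w * cnj t))" unfolding fejer_def norm_of_real Re_complex_of_real by simp
    then show ?case using elim unfolding norm_mult by (metis mult_right_mono norm_ge_zero)
  qed
  have hF: "integrable circle (\<lambda>w. h w * fejer N (w * cnj t))"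
    by (rule Bochner_Integration.integrable_bound[OF Ri]) (use h fb in \<open>auto elim!: eventually_mono\<close>)
  have "cmod (cesaro_mean h N t) \<le> (LINT w|circle. cmod (h w * fejer N (w * cnj t)))"
    unfolding cesaro_mean_def by (rule integral_norm_bound)
  also have "\<dots> \<le> (LINT w|circle. B * Re (fejer N (w * cnj t)))"
    using hF Ri fb by (intro integral_mono_AE) auto
  also have "\<dots> = B * Re (LINT w|circle. fejer N (w * cnj t))" using Fi by simp
  also have "\<dots> = B" by (simp add: integral_fejer[OF t N])
  finally show ?thesis .
qed

lemma cesaro_mean_AE_tendsto:
  assumes h: "integrable circle h"
  shows "AE t in circle. (\<lambda>N. cesaro_mean h (Suc N) t) \<longlonglongrightarrow> h t"
  using AE_lebesgue_point[OF h] AE_space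
proof eventually_elim
  case (elim t)
  then have t: "cmod t = 1" by simp
  have "(\<lambda>N. LINT w|circle. h w * fejer (Suc N) (w * cnj t)) \<longlonglongrightarrow> h t * 1"
  proof (rule lebesgue_point_kernel_limit[OF h elim(1), where e="\<lambda>N. 1 / real (Suc N)" and C=8])
    show "filterlim (\<lambda>N. 1 / real (Suc N)) (at_right 0) sequentially"
      unfolding filterlim_at using LIMSEQ_Suc[OF lim_1_over_n] by (auto intro!: always_eventually)
    show "\<forall>\<^sub>F i in sequentially. \<forall>w\<in>sphere 0 1. cmod (fejer (Suc i) (w * cnj t)) \<le> 8 * poisson_weight (1 / real (Suc i)) (dist w t)"
      by (intro always_eventually allI ballI fejer_bound t) auto
  qed (auto simp: integral_fejer[OF t])
  then show ?case by (simp add: cesaro_mean_def)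
qed

text \<open>The Cesaro means of \<open>h\<close> are analytic polynomials, for which the claim is a finite sum of
  Fourier coefficients of \<open>f\<close>. They are bounded by \<open>B\<close> and converge to \<open>h\<close> almost everywhere, so the
  claim passes to \<open>h\<close> by dominated convergence with the majorant \<open>B \<bar>f\<bar>\<close>.\<close>
lemma analytic_L1_mult:
  assumes h: "analytic_L1 h" and f: "analytic_L1 f" and B: "AE w in circle. cmod (h w) \<le> B"
  shows "analytic_L1 (\<lambda>w. h w * f w)"
proof -
  have hi: "integrable circle h" and fi: "integrable circle f" using h f by (auto simp: analytic_L1_def)
  have [measurable]: "h \<in> borel_measurable circle" "f \<in> borel_measurable circle" using hi fi by auto
  have hfi: "integrable circle (\<lambda>w. h w * f w)"
    using integrable_mult_bounded[OF fi _ B] by (simp add: mult.commute)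
  have "(LINT w|circle. h w * f w * w powi n) = 0" if n: "n > 0" for n
  proof -
    define \<sigma> where "\<sigma> N t = (\<Sum>k<Suc N. \<Sum>m<Suc N. (LINT w|circle. h w * w powi (int k - int m)) * t powi (int m - int k)) / of_nat (Suc N)" for N t
    have \<sigma>: "cesaro_mean h (Suc N) t = \<sigma> N t" if "cmod t = 1" for N t
      unfolding \<sigma>_def by (rule cesaro_mean_eq[OF hi that])
    have [measurable]: "\<sigma> N \<in> borel_measurable circle" for N
      unfolding \<sigma>_def[abs_def] by measurable
    have zero: "(LINT t|circle. \<sigma> N t * (f t * t powi n)) = 0" for N
    proof -
      have tm: "(LINT t|circle. (LINT w|circle. h w * w powi (int k - int m)) * (f t * t powi (int m - int k + n))) = 0" for k m
      proof (cases "int k - int m > 0")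
        case True
        then have "(LINT w|circle. h w * w powi (int k - int m)) = 0" using h by (simp add: analytic_L1_def)
        then show ?thesis by simp
      next
        case False
        then have "int m - int k + n > 0" using n by simp
        then have "(LINT t|circle. f t * t powi (int m - int k + n)) = 0" using f unfolding analytic_L1_def by blast
        then show ?thesis by simp
      qed
      have "(LINT t|circle. \<sigma> N t * (f t * t powi n)) = (LINT t|circle. (\<Sum>k<Suc N. \<Sum>m<Suc N. (LINT w|circle. h w * w powi (int k - int m)) * (f t * t powi (int m - int k + n))) / of_nat (Suc N))"
      proof (intro Bochner_Integration.integral_cong refl)
        fix t assume "t \<in> space circle"
        then have tnz: "t \<noteq> 0" by auto
        show "\<sigma> N t * (f t * t powi n) = (\<Sum>k<Suc N. \<Sum>m<Suc N. (LINT w|circle. h w * w powi (int k - int m)) * (f t * t powi (int m - int k + n))) / of_nat (Suc N)"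
          unfolding \<sigma>_def times_divide_eq_left sum_distrib_right
          using tnz by (intro arg_cong2[where f="(/)"] sum.cong refl) (simp add: power_int_add)
      qed
      also have "\<dots> = (\<Sum>k<Suc N. \<Sum>m<Suc N. (LINT t|circle. (LINT w|circle. h w * w powi (int k - int m)) * (f t * t powi (int m - int k + n)))) / of_nat (Suc N)"
        by (simp only: integral_divide_zero Bochner_Integration.integral_sum Bochner_Integration.integrable_sum
            integrable_mult_right integrable_mult_powi[OF fi])
      also have "\<dots> = 0" unfolding tm by simp
      finally show ?thesis .
    qed
    have "(\<lambda>N. LINT t|circle. \<sigma> N t * (f t * t powi n)) \<longlonglongrightarrow> (LINT t|circle. h t * (f t * t powi n))"
    proof (rule integral_dominated_convergence[where w="\<lambda>t. B * cmod (f t)"])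
      show "integrable circle (\<lambda>t. B * cmod (f t))" using fi by auto
      show "AE t in circle. (\<lambda>N. \<sigma> N t * (f t * t powi n)) \<longlonglongrightarrow> h t * (f t * t powi n)"
        using cesaro_mean_AE_tendsto[OF hi] AE_space
      proof eventually_elim
        case (elim t)
        then have "(\<lambda>N. \<sigma> N t) \<longlonglongrightarrow> h t" using \<sigma>[of t] by simp
        then show ?case by (intro tendsto_intros)
      qed
      show "AE t in circle. norm (\<sigma> N t * (f t * t powi n)) \<le> B * cmod (f t)" for N
        using AE_space
      proof eventually_elim
        case (elim t)
        then have t: "cmod t = 1" by simp
        have "cmod (\<sigma> N t) \<le> B" using cesaro_mean_bound[OF hi B t, of "Suc N"] \<sigma>[OF t] by simp
        then show ?case using t by (simp add: norm_mult mult_right_mono)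
      qed
    qed measurable
    then have "(LINT t|circle. h t * (f t * t powi n)) = 0" unfolding zero by (simp add: LIMSEQ_const_iff)
    then show ?thesis by (simp add: mult.assoc)
  qed
  then show ?thesis using hfi by (simp add: analytic_L1_def)
qed

section \<open>Banach function spaces\<close>

lemma mon_measurable [measurable]: "mon n \<in> borel_measurable circle"
  unfolding mon_def[abs_def] by measurable

lemma cmod_mon: "w \<in> space circle \<Longrightarrow> cmod (mon n w) = 1"
  by (simp add: mon_def)

lemma mon_add: "w \<in> space circle \<Longrightarrow> mon m w * mon n w = mon (m + n) w"
  by (auto simp: mon_def power_int_add circle_nz)

lemma mon_0 [simp]: "mon 0 w = 1" by (simp add: mon_def)

lemma cmod_measurable_ennreal:
  assumes [measurable]: "f \<in> borel_measurable circle"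
  shows "(\<lambda>t. ennreal (cmod (f t))) \<in> borel_measurable circle"
  by measurable

locale function_space =
  fixes \<rho> :: "(complex \<Rightarrow> ennreal) \<Rightarrow> ennreal"
  assumes bfn: "banach_function_norm \<rho>"
begin

abbreviation X where "X \<equiv> bfs \<rho>"
abbreviation H where "H \<equiv> hardy \<rho>"
abbreviation N where "N \<equiv> bfs_norm \<rho>"

lemma rho_zero: "f \<in> borel_measurable circle \<Longrightarrow> \<rho> f = 0 \<longleftrightarrow> (AE t in circle. f t = 0)"
  using bfn unfolding banach_function_norm_def by blast
lemma rho_scale: "f \<in> borel_measurable circle \<Longrightarrow> a \<ge> 0 \<Longrightarrow> \<rho> (\<lambda>t. ennreal a * f t) = ennreal a * \<rho> f"
  using bfn unfolding banach_function_norm_def by blast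
lemma rho_add: "f \<in> borel_measurable circle \<Longrightarrow> g \<in> borel_measurable circle \<Longrightarrow> \<rho> (\<lambda>t. f t + g t) \<le> \<rho> f + \<rho> g"
  using bfn unfolding banach_function_norm_def by blast
lemma rho_mono: "f \<in> borel_measurable circle \<Longrightarrow> g \<in> borel_measurable circle \<Longrightarrow> AE t in circle. g t \<le> f t \<Longrightarrow> \<rho> g \<le> \<rho> f"
  using bfn unfolding banach_function_norm_def by blast
lemma rho_incseq: "f \<in> borel_measurable circle \<Longrightarrow> (\<And>n::nat. F n \<in> borel_measurable circle) \<Longrightarrow> 
  AE t in circle. incseq (\<lambda>n. F n t) \<and> (\<lambda>n. F n t) \<longlonglongrightarrow> f t \<Longrightarrow> (\<lambda>n. \<rho> (F n)) \<longlonglongrightarrow> \<rho> f"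
  using bfn unfolding banach_function_norm_def by blast
lemma rho_one: "\<rho> (\<lambda>t. 1) < \<infinity>"
  using bfn unfolding banach_function_norm_def by blast
lemma rho_L1: "\<exists>C::real. C > 0 \<and> (\<forall>f\<in>borel_measurable circle. (\<integral>\<^sup>+t. f t \<partial>circle) \<le> ennreal C * \<rho> f)"
  using bfn unfolding banach_function_norm_def by blast

lemma X_measurable [measurable_dest]: "f \<in> X \<Longrightarrow> f \<in> borel_measurable circle"
  by (simp add: bfs_def)

lemma ennreal_N: "f \<in> X \<Longrightarrow> ennreal (N f) = \<rho> (\<lambda>t. ennreal (cmod (f t)))"
  by (simp add: bfs_def bfs_norm_def)

lemma N_nonneg [simp]: "N f \<ge> 0" by (simp add: bfs_norm_def)

lemma X_dominated:
  assumes f: "f \<in> borel_measurable circle" and g: "g \<in> X" and c: "c \<ge> 0" and le: "AE t in circle. cmod (f t) \<le> c * cmod (g t)"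
  shows "f \<in> X" "N f \<le> c * N g"
proof -
  have "\<rho> (\<lambda>t. ennreal (cmod (f t))) \<le> \<rho> (\<lambda>t. ennreal c * ennreal (cmod (g t)))"
    by (intro rho_mono) (use f g c le in \<open>auto intro!: cmod_measurable_ennreal X_measurable borel_measurable_times_ennreal elim!: eventually_mono simp: ennreal_leI simp flip: ennreal_mult\<close>)
  also have "\<dots> = ennreal c * ennreal (N g)"
    using g c by (simp add: rho_scale cmod_measurable_ennreal X_measurable ennreal_N)
  also have "\<dots> = ennreal (c * N g)" using c by (simp add: ennreal_mult)
  finally have le: "\<rho> (\<lambda>t. ennreal (cmod (f t))) \<le> ennreal (c * N g)" .
  show fX: "f \<in> X" using f le_less_trans[OF le, of \<infinity>] by (simp add: bfs_def)
  show "N f \<le> c * N g" using le c by (simp add: ennreal_N[OF fX, symmetric])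
qed

lemma X_AE_cong:
  assumes f: "f \<in> X" and g: "g \<in> borel_measurable circle" and eq: "AE t in circle. f t = g t"
  shows "g \<in> X" "N g = N f"
proof -
  have "AE t in circle. cmod (g t) \<le> 1 * cmod (f t)" using eq by eventually_elim simp
  from X_dominated[OF g f _ this] have gX: "g \<in> X" and 1: "N g \<le> N f" by auto
  show "g \<in> X" by (rule gX)
  have "AE t in circle. cmod (f t) \<le> 1 * cmod (g t)" using eq by eventually_elim simp
  from X_dominated[OF X_measurable[OF f] gX _ this] 1 show "N g = N f" by auto
qed

lemma X_scale: 
  assumes f: "f \<in> X" shows "(\<lambda>t. c * f t) \<in> X" "N (\<lambda>t. c * f t) = cmod c * N f"
proof -
  have m: "(\<lambda>t. c * f t) \<in> borel_measurable circle" using X_measurable[OF f] by measurable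
  from X_dominated[OF m f, of "cmod c"] show cX: "(\<lambda>t. c * f t) \<in> X" by (simp add: norm_mult)
  have "ennreal (N (\<lambda>t. c * f t)) = \<rho> (\<lambda>t. ennreal (cmod c) * ennreal (cmod (f t)))"
    unfolding ennreal_N[OF cX] norm_mult by (simp add: ennreal_mult)
  also have "\<dots> = ennreal (cmod c) * ennreal (N f)"
    using f by (subst rho_scale) (auto intro: cmod_measurable_ennreal X_measurable simp: ennreal_N)
  finally show "N (\<lambda>t. c * f t) = cmod c * N f" by (simp flip: ennreal_mult)
qed

lemma X_add:
  assumes f: "f \<in> X" and g: "g \<in> X" shows "(\<lambda>t. f t + g t) \<in> X" "N (\<lambda>t. f t + g t) \<le> N f + N g"
proof -
  have m: "(\<lambda>t. f t + g t) \<in> borel_measurable circle" using f g by measurable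
  have "\<rho> (\<lambda>t. ennreal (cmod (f t + g t))) \<le> \<rho> (\<lambda>t. ennreal (cmod (f t)) + ennreal (cmod (g t)))"
    by (intro rho_mono) (use f g m in \<open>auto intro!: cmod_measurable_ennreal X_measurable borel_measurable_add ennreal_leI norm_triangle_ineq simp flip: ennreal_plus\<close>)
  also have "\<dots> \<le> ennreal (N f) + ennreal (N g)"
    unfolding ennreal_N[OF f] ennreal_N[OF g] using f g by (intro rho_add cmod_measurable_ennreal X_measurable)
  also have "\<dots> = ennreal (N f + N g)" by simp
  finally have le: "\<rho> (\<lambda>t. ennreal (cmod (f t + g t))) \<le> ennreal (N f + N g)" .
  show fX: "(\<lambda>t. f t + g t) \<in> X" using m le_less_trans[OF le, of \<infinity>] by (simp add: bfs_def)
  show "N (\<lambda>t. f t + g t) \<le> N f + N g" using le by (simp add: ennreal_N[OF fX, symmetric] add_nonneg_nonneg del: ennreal_plus)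
qed

lemma X_diff:
  assumes f: "f \<in> X" and g: "g \<in> X" shows "(\<lambda>t. f t - g t) \<in> X" "N (\<lambda>t. f t - g t) \<le> N f + N g"
  using X_add[OF f X_scale(1)[OF g, of "-1"]] X_scale(2)[OF g, of "-1"] by auto

lemma N_zero_iff: "f \<in> X \<Longrightarrow> N f = 0 \<longleftrightarrow> (AE t in circle. f t = 0)"
proof -
  assume f: "f \<in> X"
  have "N f = 0 \<longleftrightarrow> ennreal (N f) = 0" by simp
  also have "\<dots> \<longleftrightarrow> (AE t in circle. ennreal (cmod (f t)) = 0)"
    unfolding ennreal_N[OF f] using f by (intro rho_zero cmod_measurable_ennreal X_measurable)
  finally show ?thesis by simp
qed

lemma one_in_X: "(\<lambda>t. 1) \<in> X" using rho_one by (simp add: bfs_def)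

lemma X_bounded:
  assumes f: "f \<in> borel_measurable circle" and B: "AE t in circle. cmod (f t) \<le> B"
  shows "f \<in> X"
proof (rule X_dominated(1)[OF f one_in_X, of "\<bar>B\<bar>"])
  show "AE t in circle. cmod (f t) \<le> \<bar>B\<bar> * cmod 1" using B by eventually_elim simp
qed simp

lemma zero_in_X: "(\<lambda>t. 0) \<in> X" by (rule X_bounded[where B=0]) auto

lemma N_0 [simp]: "N (\<lambda>t. 0) = 0" by (subst N_zero_iff[OF zero_in_X]) simp

lemma X_mult:
  assumes f: "f \<in> X" and a: "a \<in> borel_measurable circle" and B: "AE t in circle. cmod (a t) \<le> B" "B \<ge> 0"
  shows "(\<lambda>t. a t * f t) \<in> X" "N (\<lambda>t. a t * f t) \<le> B * N f"
proof -
  have m: "(\<lambda>t. a t * f t) \<in> borel_measurable circle" using a X_measurable[OF f] by measurable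
  have "AE t in circle. cmod (a t * f t) \<le> B * cmod (f t)"
    using B(1) by eventually_elim (simp add: norm_mult mult_right_mono)
  from X_dominated[OF m f B(2) this] show "(\<lambda>t. a t * f t) \<in> X" "N (\<lambda>t. a t * f t) \<le> B * N f" by auto
qed

lemma X_mon:
  assumes f: "f \<in> X" shows "(\<lambda>t. mon n t * f t) \<in> X" "N (\<lambda>t. mon n t * f t) = N f"
proof -
  have b: "AE t in circle. cmod (mon m t) \<le> 1" for m by (rule AE_I2) (simp add: cmod_mon del: space_circle)
  have *: "(\<lambda>t. mon m t * g t) \<in> X \<and> N (\<lambda>t. mon m t * g t) \<le> N g" if "g \<in> X" for g m
    using X_mult[OF that mon_measurable b] by auto
  show mX: "(\<lambda>t. mon n t * f t) \<in> X" using * f by blast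
  have le: "N (\<lambda>t. mon n t * f t) \<le> N f" using * f by blast
  have "N (\<lambda>t. mon (-n) t * (mon n t * f t)) \<le> N (\<lambda>t. mon n t * f t)" using *[OF mX] by blast
  moreover have "N (\<lambda>t. mon (-n) t * (mon n t * f t)) = N f"
  proof (rule X_AE_cong(2)[OF f])
    show "(\<lambda>t. mon (-n) t * (mon n t * f t)) \<in> borel_measurable circle" using X_measurable[OF f] by measurable
    show "AE t in circle. f t = mon (-n) t * (mon n t * f t)"
      by (rule AE_I2) (simp add: mult.assoc[symmetric] mon_add del: space_circle)
  qed
  ultimately show "N (\<lambda>t. mon n t * f t) = N f" using le by linarith
qed

lemma X_L1: 
  "\<exists>C>0. \<forall>f\<in>X. integrable circle f \<and> (LINT t|circle. cmod (f t)) \<le> C * N f"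
proof -
  obtain C :: real where C: "C > 0" "\<forall>f\<in>borel_measurable circle. (\<integral>\<^sup>+t. f t \<partial>circle) \<le> ennreal C * \<rho> f"
    using rho_L1 by blast
  have le: "(\<integral>\<^sup>+t. ennreal (cmod (f t)) \<partial>circle) \<le> ennreal (C * N f)" if f: "f \<in> X" for f
    using C(2)[rule_format, OF cmod_measurable_ennreal[OF X_measurable[OF f]]] C(1) ennreal_N[OF f]
    by (simp add: ennreal_mult)
  have i: "integrable circle f" if f: "f \<in> X" for f
    unfolding integrable_iff_bounded using X_measurable[OF f] le_less_trans[OF le[OF f], of \<infinity>] by simp
  show ?thesis
  proof (intro exI[of _ C] conjI ballI C(1) i)
    fix f assume f: "f \<in> X"
    have "ennreal (LINT t|circle. cmod (f t)) = (\<integral>\<^sup>+t. ennreal (cmod (f t)) \<partial>circle)"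
      using i[OF f] by (intro nn_integral_eq_integral[symmetric]) auto
    also have "\<dots> \<le> ennreal (C * N f)" by (rule le[OF f])
    finally show "(LINT t|circle. cmod (f t)) \<le> C * N f" using C(1) by simp
  qed
qed

lemma X_integrable: "f \<in> X \<Longrightarrow> integrable circle f"
  using X_L1 by blast

text \<open>The Fatou property: (A3) is applied to the increasing sequence of the infima over tails.\<close>
lemma X_fatou:
  assumes F: "\<And>n. F n \<in> X" "\<And>n. N (F n) \<le> M" and lim: "AE t in circle. (\<lambda>n. F n t) \<longlonglongrightarrow> f t"
    and f[measurable]: "f \<in> borel_measurable circle"
  shows "f \<in> X" "N f \<le> M"
proof -
  have M: "M \<ge> 0" using F(2)[of 0] N_nonneg[of "F 0"] by linarith
  have Fm[measurable]: "F n \<in> borel_measurable circle" for n using F(1) by (rule X_measurable)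
  define G where "G n t = (INF k. ennreal (cmod (F (n + k) t)))" for n t
  have Gm[measurable]: "G n \<in> borel_measurable circle" for n unfolding G_def[abs_def] by measurable
  have le: "\<rho> (G n) \<le> ennreal M" for n
  proof -
    have "\<rho> (G n) \<le> \<rho> (\<lambda>t. ennreal (cmod (F n t)))"
      by (intro rho_mono AE_I2) (auto simp: G_def intro!: INF_lower2[of 0])
    also have "\<dots> \<le> ennreal M" using F by (simp add: ennreal_leI flip: ennreal_N)
    finally show ?thesis .
  qed
  have "(\<lambda>n. \<rho> (G n)) \<longlonglongrightarrow> \<rho> (\<lambda>t. ennreal (cmod (f t)))"
  proof (rule rho_incseq)
    show "AE t in circle. incseq (\<lambda>n. G n t) \<and> (\<lambda>n. G n t) \<longlonglongrightarrow> ennreal (cmod (f t))"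
      using lim
    proof eventually_elim
      case (elim t)
      have inc: "incseq (\<lambda>n. G n t)"
        unfolding G_def
      proof (rule incseq_SucI, rule INF_greatest)
        fix n k show "(INF k. ennreal (cmod (F (n + k) t))) \<le> ennreal (cmod (F (Suc n + k) t))"
          by (rule INF_lower2[of "Suc k"]) auto
      qed
      have "(\<lambda>n. ennreal (cmod (F n t))) \<longlonglongrightarrow> ennreal (cmod (f t))"
        using elim by (intro tendsto_ennrealI tendsto_norm)
      then have "liminf (\<lambda>n. ennreal (cmod (F n t))) = ennreal (cmod (f t))"
        by (intro lim_imp_Liminf) auto
      moreover have "liminf (\<lambda>n. ennreal (cmod (F n t))) = (SUP n. G n t)"
      proof -
        have "(INF m\<in>{n..}. ennreal (cmod (F m t))) = G n t" for n
        proof -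
          have "{n..} = range (\<lambda>k. n + k)" by (metis image_add_atLeast add.right_neutral atLeast_0)
          then show ?thesis by (simp add: G_def image_image)
        qed
        then show ?thesis by (simp add: liminf_SUP_INF)
      qed
      ultimately show ?case using inc LIMSEQ_SUP[OF inc] by simp
    qed
  qed auto
  then have *: "\<rho> (\<lambda>t. ennreal (cmod (f t))) \<le> ennreal M"
    by (rule LIMSEQ_le_const2) (use le in auto)
  show fX: "f \<in> X" using f le_less_trans[OF *, of \<infinity>] by (simp add: bfs_def)
  show "N f \<le> M" using * M by (simp add: ennreal_N[OF fX, symmetric])
qed

lemma X_sum:
  assumes "finite I" "\<And>i. i \<in> I \<Longrightarrow> F i \<in> X"
  shows "(\<lambda>t. \<Sum>i\<in>I. F i t) \<in> X \<and> N (\<lambda>t. \<Sum>i\<in>I. F i t) \<le> (\<Sum>i\<in>I. N (F i))"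
  using assms
proof (induction I rule: finite_induct)
  case empty
  then show ?case by (simp add: zero_in_X)
next
  case (insert i I)
  then have "F i \<in> X" "(\<lambda>t. \<Sum>i\<in>I. F i t) \<in> X" "N (\<lambda>t. \<Sum>i\<in>I. F i t) \<le> (\<Sum>i\<in>I. N (F i))" by auto
  from X_add[OF this(1,2)] this(3) insert(1,2) show ?case by simp
qed

lemma hardy_iff: "f \<in> H \<longleftrightarrow> f \<in> X \<and> analytic_L1 f"
  using X_integrable by (auto simp: hardy_def analytic_L1_iff)

lemma hardy_X: "f \<in> H \<Longrightarrow> f \<in> X" by (simp add: hardy_iff)

lemma analytic_add: "analytic_L1 f \<Longrightarrow> analytic_L1 g \<Longrightarrow> analytic_L1 (\<lambda>t. f t + g t)"
  by (auto simp: analytic_L1_def distrib_right integrable_mult_powi)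
lemma analytic_scale: "analytic_L1 f \<Longrightarrow> analytic_L1 (\<lambda>t. c * f t)"
  by (auto simp: analytic_L1_def mult.assoc)
lemma analytic_AE_cong: 
  assumes f: "analytic_L1 f" and g[measurable]: "g \<in> borel_measurable circle" and eq: "AE t in circle. f t = g t"
  shows "analytic_L1 g"
proof -
  have [measurable]: "f \<in> borel_measurable circle" using f by (auto simp: analytic_L1_def)
  have "integrable circle g" using f eq by (subst integrable_cong_AE[of g _ f]) (auto simp: analytic_L1_def elim!: eventually_mono)
  moreover have "(LINT w|circle. g w * w powi n) = (LINT w|circle. f w * w powi n)" for n
    using eq by (intro integral_cong_AE) (auto elim!: eventually_mono)
  ultimately show ?thesis using f by (simp add: analytic_L1_def)
qed

lemma hardy_add: "f \<in> H \<Longrightarrow> g \<in> H \<Longrightarrow> (\<lambda>t. f t + g t) \<in> H"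
  by (simp add: hardy_iff X_add analytic_add)
lemma hardy_scale: "f \<in> H \<Longrightarrow> (\<lambda>t. c * f t) \<in> H"
  by (simp add: hardy_iff X_scale analytic_scale)
lemma hardy_diff: "f \<in> H \<Longrightarrow> g \<in> H \<Longrightarrow> (\<lambda>t. f t - g t) \<in> H"
  using hardy_add[of f "\<lambda>t. -1 * g t"] hardy_scale[of g "-1"] by simp
lemma hardy_AE_cong: "f \<in> H \<Longrightarrow> g \<in> borel_measurable circle \<Longrightarrow> AE t in circle. f t = g t \<Longrightarrow> g \<in> H"
  unfolding hardy_iff by (blast intro: X_AE_cong(1) analytic_AE_cong)
lemma hardy_0: "(\<lambda>t. 0) \<in> H"
  by (simp add: hardy_iff zero_in_X analytic_L1_def)
lemma hardy_1: "(\<lambda>t. 1) \<in> H"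
  by (simp add: hardy_iff one_in_X analytic_L1_one)

lemma hardy_mult:
  assumes f: "f \<in> H" and h: "analytic_L1 h" and B: "AE t in circle. cmod (h t) \<le> B" "B \<ge> 0"
  shows "(\<lambda>t. h t * f t) \<in> H" "N (\<lambda>t. h t * f t) \<le> B * N f"
  using X_mult[OF hardy_X[OF f] _ B] analytic_L1_mult[OF h _ B(1), of f] f h
  by (auto simp: hardy_iff analytic_L1_def[of h])

lemma hardy_mon:
  assumes f: "f \<in> H" and n: "n \<ge> 0" shows "(\<lambda>t. mon n t * f t) \<in> H"
proof -
  have b: "AE t in circle. cmod (mon n t) \<le> 1" by (rule AE_I2) (simp add: cmod_mon del: space_circle)
  show ?thesis by (rule hardy_mult(1)[OF f analytic_L1_mon[OF n] b]) simp
qed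

text \<open>The norms of the powers of \<open>h\<close> grow at most like \<open>M\<^sup>k\<close>, hence by (A5) so do their integrals. A set
  of positive measure on which \<open>\<bar>h\<bar>\<close> exceeds \<open>M + e\<close> would make them grow like \<open>(M + e)\<^sup>k\<close>.\<close>
lemma power_sequence_bound:
  assumes h[measurable]: "h \<in> borel_measurable circle" and hX: "\<And>k. (\<lambda>t. h t ^ k) \<in> X" and M: "M \<ge> 0"
    and step: "\<And>k. N (\<lambda>t. h t * h t ^ k) \<le> M * N (\<lambda>t. h t ^ k)"
  shows "AE t in circle. cmod (h t) \<le> M"
proof -
  obtain C where C0: "C > 0" "\<forall>f\<in>X. integrable circle f \<and> (LINT t|circle. cmod (f t)) \<le> C * N f" using X_L1 by blast
  then have C: "C > 0" "\<And>f. f \<in> X \<Longrightarrow> (LINT t|circle. cmod (f t)) \<le> C * N f" by simp_all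
  have Nk: "N (\<lambda>t. h t ^ k) \<le> M ^ k * N (\<lambda>t. 1)" for k
  proof (induction k)
    case (Suc k)
    have "N (\<lambda>t. h t ^ Suc k) \<le> M * N (\<lambda>t. h t ^ k)" using step[of k] by simp
    also have "\<dots> \<le> M * (M ^ k * N (\<lambda>t. 1))" using Suc M by (rule mult_left_mono)
    finally show ?case by (simp add: mult.assoc)
  qed simp
  have ae: "AE t in circle. cmod (h t) \<le> M + e" if e: "e > 0" for e
  proof (rule ccontr)
    assume nAE: "\<not> (AE t in circle. cmod (h t) \<le> M + e)"
    define E where "E = {t \<in> space circle. \<not> cmod (h t) \<le> M + e}"
    have Em[measurable]: "E \<in> sets circle" unfolding E_def by measurable
    have "emeasure circle E \<noteq> 0" using nAE AE_iff_measurable[OF Em E_def[symmetric]] by simp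
    then have mE: "measure circle E > 0" by (simp add: emeasure_eq_measure zero_less_measure_iff)
    have key: "(M + e) ^ k * measure circle E \<le> C * (M ^ k * N (\<lambda>t. 1))" for k
    proof -
      have "(M + e) ^ k * measure circle E = (LINT t|circle. (M + e) ^ k * indicat_real E t)"
        using sets.sets_into_space[OF Em] by (simp add: Int_absorb2 del: space_circle)
      also have "\<dots> \<le> (LINT t|circle. cmod (h t ^ k))"
      proof (rule Bochner_Integration.integral_mono)
        show "integrable circle (\<lambda>t. (M + e) ^ k * indicat_real E t)"
          by (intro integrable_mult_right integrable_real_indicator) (auto simp: less_top[symmetric])
        show "integrable circle (\<lambda>t. cmod (h t ^ k))" using X_integrable[OF hX[of k]] by (rule integrable_norm)
        show "(M + e) ^ k * indicat_real E t \<le> cmod (h t ^ k)" for t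
          using M e by (auto simp: E_def indicator_def norm_power intro!: power_mono)
      qed
      also have "\<dots> \<le> C * N (\<lambda>t. h t ^ k)" by (rule C(2)[OF hX])
      also have "\<dots> \<le> C * (M ^ k * N (\<lambda>t. 1))" using C(1) Nk by (intro mult_left_mono) auto
      finally show ?thesis .
    qed
    have q: "0 \<le> M / (M + e)" "M / (M + e) < 1" using M e by auto
    have "(\<lambda>k. C * N (\<lambda>t. 1) * (M / (M + e)) ^ k) \<longlonglongrightarrow> C * N (\<lambda>t. 1) * 0"
      by (intro tendsto_intros LIMSEQ_realpow_zero q)
    moreover have "measure circle E \<le> C * N (\<lambda>t. 1) * (M / (M + e)) ^ k" for k
    proof -
      have "0 < (M + e) ^ k" using M e by simp
      then show ?thesis using key[of k] by (simp add: power_divide pos_le_divide_eq mult_ac)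
    qed
    ultimately have "measure circle E \<le> C * N (\<lambda>t. 1) * 0"
      by (intro LIMSEQ_le_const) auto
    then show False using mE by simp
  qed
  have "AE t in circle. \<forall>n::nat. cmod (h t) \<le> M + 1 / (real n + 1)"
    unfolding AE_all_countable by (intro allI ae) simp
  then show ?thesis
  proof eventually_elim
    case (elim t)
    show ?case
    proof (rule field_le_epsilon)
      fix e :: real assume e: "e > 0"
      obtain n :: nat where "1 / of_nat (Suc n) < e" by (rule nat_approx_posE[OF e])
      then have "1 / (real n + 1) < e" by (simp add: add.commute)
      then show "cmod (h t) \<le> M + e" using elim[rule_format, of n] by linarith
    qed
  qed
qed

end

lemma Linf_bound:
  assumes a: "a \<in> Linf"
  shows "a \<in> borel_measurable circle" "AE t in circle. cmod (a t) \<le> Linf_norm a" "Linf_norm a \<ge> 0"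
proof -
  have fin: "esssup circle (\<lambda>t. ennreal (cmod (a t))) < \<infinity>" using a by (simp add: bfs_def)
  show "a \<in> borel_measurable circle" using a by (simp add: bfs_def)
  show "Linf_norm a \<ge> 0" by (simp add: bfs_norm_def)
  have "AE t in circle. ennreal (cmod (a t)) \<le> esssup circle (\<lambda>t. ennreal (cmod (a t)))" by (rule esssup_AE)
  then show "AE t in circle. cmod (a t) \<le> Linf_norm a"
  proof eventually_elim
    case (elim t)
    have "ennreal (cmod (a t)) \<le> ennreal (Linf_norm a)" using elim fin by (simp add: bfs_norm_def)
    then show ?case by (simp add: bfs_norm_def)
  qed
qed

lemma Linf_I:
  assumes a: "a \<in> borel_measurable circle" and B: "AE t in circle. cmod (a t) \<le> B" "B \<ge> 0"
  shows "a \<in> Linf" "Linf_norm a \<le> B"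
proof -
  have m: "(\<lambda>t. ennreal (cmod (a t))) \<in> borel_measurable circle" using a by (rule cmod_measurable_ennreal)
  have le: "esssup circle (\<lambda>t. ennreal (cmod (a t))) \<le> ennreal B"
    using B by (intro esssup_I[OF m]) (auto elim!: eventually_mono intro: ennreal_leI)
  show "a \<in> Linf" using a le_less_trans[OF le, of \<infinity>] by (simp add: bfs_def)
  show "Linf_norm a \<le> B" unfolding bfs_norm_def using le B by (intro enn2real_leI) 
qed

section \<open>Bounded and compact operators on the abstract Hardy space\<close>

context function_space
begin

abbreviation bop where "bop \<equiv> bounded_op H N"
abbreviation cop where "cop \<equiv> compact_op H N"

lemma bopD:
  assumes "bop A"
  shows "f \<in> H \<Longrightarrow> A f \<in> H"
    "f \<in> H \<Longrightarrow> g \<in> H \<Longrightarrow> AE t in circle. A (\<lambda>s. f s + g s) t = A f t + A g t"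
    "f \<in> H \<Longrightarrow> AE t in circle. A (\<lambda>s. c * f s) t = c * A f t"
    "\<exists>C\<ge>0. \<forall>f\<in>H. N (A f) \<le> C * N f"
proof -
  show "f \<in> H \<Longrightarrow> A f \<in> H"
    "f \<in> H \<Longrightarrow> g \<in> H \<Longrightarrow> AE t in circle. A (\<lambda>s. f s + g s) t = A f t + A g t"
    "f \<in> H \<Longrightarrow> AE t in circle. A (\<lambda>s. c * f s) t = c * A f t"
    using assms unfolding bounded_op_def by blast+
  obtain C where "\<forall>f\<in>H. N (A f) \<le> C * N f" using assms unfolding bounded_op_def by blast
  then have "\<forall>f\<in>H. N (A f) \<le> max C 0 * N f"
    by (meson N_nonneg max.cobounded1 mult_right_mono order_trans)
  then show "\<exists>C\<ge>0. \<forall>f\<in>H. N (A f) \<le> C * N f" by (intro exI[of _ "max C 0"]) auto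
qed

text \<open>Operators act on functions, so this compatibility with equality almost everywhere has to
  be derived: the difference of the two arguments has norm 0, hence so has its image. The space \<open>W\<close> is
  taken to be the whole function space or its Hardy space.\<close>
lemma AE_cong_of_bounded:
  assumes W: "\<And>f g. f \<in> W \<Longrightarrow> g \<in> W \<Longrightarrow> (\<lambda>t. g t - f t) \<in> W" and WX: "W \<subseteq> X"
    and A: "bounded_op W N A" and f: "f \<in> W" and g: "g \<in> W" and eq: "AE t in circle. f t = g t"
  shows "AE t in circle. A f t = A g t"
proof -
  define d where "d t = g t - f t" for t
  have d: "d \<in> W" unfolding d_def using W f g by blast
  have "AE t in circle. d t = 0" using eq unfolding d_def by eventually_elim simp
  then have "N d = 0" using N_zero_iff d WX by blast
  moreover obtain C where "\<forall>f\<in>W. N (A f) \<le> C * N f" using A unfolding bounded_op_def by blast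
  ultimately have "N (A d) \<le> 0" using d by fastforce
  then have "N (A d) = 0" using N_nonneg[of "A d"] by linarith
  moreover have "A d \<in> X" using A d WX unfolding bounded_op_def by blast
  ultimately have "AE t in circle. A d t = 0" using N_zero_iff by blast
  moreover have "AE t in circle. A (\<lambda>s. f s + d s) t = A f t + A d t"
    using A f d unfolding bounded_op_def by blast
  moreover have "(\<lambda>s. f s + d s) = g" by (simp add: d_def)
  ultimately show ?thesis by (auto elim: eventually_elim2)
qed

lemma bop_cong:
  assumes "bop A" "f \<in> H" "g \<in> H" "AE t in circle. f t = g t"
  shows "AE t in circle. A f t = A g t"
  by (rule AE_cong_of_bounded[OF _ _ assms]) (auto intro: hardy_diff hardy_X)

lemma bopI:
  assumes "\<And>f. f \<in> H \<Longrightarrow> A f \<in> H"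
    "\<And>f g. f \<in> H \<Longrightarrow> g \<in> H \<Longrightarrow> AE t in circle. A (\<lambda>s. f s + g s) t = A f t + A g t"
    "\<And>f c. f \<in> H \<Longrightarrow> AE t in circle. A (\<lambda>s. c * f s) t = c * A f t"
    "\<And>f. f \<in> H \<Longrightarrow> N (A f) \<le> C * N f"
  shows "bop A"
  unfolding bounded_op_def using assms by blast

lemma bop_AE_cong:
  assumes A: "bop A" and B: "\<And>f. f \<in> H \<Longrightarrow> B f \<in> borel_measurable circle" and eq: "\<And>f. f \<in> H \<Longrightarrow> AE t in circle. A f t = B f t"
  shows "bop B"
proof -
  obtain C where C: "\<forall>f\<in>H. N (A f) \<le> C * N f" using bopD(4)[OF A] by blast
  show ?thesis
  proof (rule bopI[of _ C])
    fix f g c assume f: "f \<in> H"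
    show "B f \<in> H" using hardy_AE_cong[OF bopD(1)[OF A f] B[OF f] eq[OF f]] .
    show "N (B f) \<le> C * N f" using X_AE_cong(2)[OF hardy_X[OF bopD(1)[OF A f]] B[OF f] eq[OF f]] C f by simp
    show "AE t in circle. B (\<lambda>s. c * f s) t = c * B f t"
      using eq[OF f] eq[OF hardy_scale[OF f, of c]] bopD(3)[OF A f, of c] by eventually_elim simp
  next
    fix f g assume f: "f \<in> H" and g: "g \<in> H"
    show "AE t in circle. B (\<lambda>s. f s + g s) t = B f t + B g t"
      using eq[OF f] eq[OF g] eq[OF hardy_add[OF f g]] bopD(2)[OF A f g] by eventually_elim simp
  qed
qed

lemma bop_comp:
  assumes A: "bop A" and B: "bop B" shows "bop (\<lambda>f. A (B f))"
proof -
  obtain C where C: "C \<ge> 0" "\<forall>f\<in>H. N (A f) \<le> C * N f" using bopD(4)[OF A] by blast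
  obtain D where D: "D \<ge> 0" "\<forall>f\<in>H. N (B f) \<le> D * N f" using bopD(4)[OF B] by blast
  show ?thesis
  proof (rule bopI[of _ "C * D"])
    fix f c assume f: "f \<in> H"
    have Bf: "B f \<in> H" by (rule bopD(1)[OF B f])
    show "A (B f) \<in> H" by (rule bopD(1)[OF A Bf])
    have "N (A (B f)) \<le> C * N (B f)" using C Bf by blast
    also have "\<dots> \<le> C * (D * N f)" using C D f by (intro mult_left_mono) auto
    finally show "N (A (B f)) \<le> C * D * N f" by (simp add: mult.assoc)
    have "AE t in circle. A (B (\<lambda>s. c * f s)) t = A (\<lambda>s. c * B f s) t"
      by (rule bop_cong[OF A bopD(1)[OF B hardy_scale[OF f]] hardy_scale[OF Bf] bopD(3)[OF B f]])
    then show "AE t in circle. A (B (\<lambda>s. c * f s)) t = c * A (B f) t"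
      using bopD(3)[OF A Bf, of c] by eventually_elim simp
  next
    fix f g assume f: "f \<in> H" and g: "g \<in> H"
    have Bf: "B f \<in> H" "B g \<in> H" using bopD(1)[OF B] f g by auto
    have "AE t in circle. A (B (\<lambda>s. f s + g s)) t = A (\<lambda>s. B f s + B g s) t"
      by (rule bop_cong[OF A bopD(1)[OF B hardy_add[OF f g]] hardy_add[OF Bf] bopD(2)[OF B f g]])
    then show "AE t in circle. A (B (\<lambda>s. f s + g s)) t = A (B f) t + A (B g) t"
      using bopD(2)[OF A Bf] by eventually_elim simp
  qed
qed

lemma bop_add:
  assumes A: "bop A" and B: "bop B" shows "bop (\<lambda>f t. A f t + B f t)"
proof -
  obtain C where C: "C \<ge> 0" "\<forall>f\<in>H. N (A f) \<le> C * N f" using bopD(4)[OF A] by blast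
  obtain D where D: "D \<ge> 0" "\<forall>f\<in>H. N (B f) \<le> D * N f" using bopD(4)[OF B] by blast
  show ?thesis
  proof (rule bopI[of _ "C + D"])
    fix f c assume f: "f \<in> H"
    have Af: "A f \<in> H" "B f \<in> H" using bopD(1)[OF A f] bopD(1)[OF B f] .
    show "(\<lambda>t. A f t + B f t) \<in> H" by (rule hardy_add[OF Af])
    show "N (\<lambda>t. A f t + B f t) \<le> (C + D) * N f"
      using X_add(2)[OF hardy_X[OF Af(1)] hardy_X[OF Af(2)]] C D f by (simp add: distrib_right) (smt (verit))
    show "AE t in circle. A (\<lambda>s. c * f s) t + B (\<lambda>s. c * f s) t = c * (A f t + B f t)"
      using bopD(3)[OF A f, of c] bopD(3)[OF B f, of c] by eventually_elim (simp add: distrib_left)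
  next
    fix f g assume f: "f \<in> H" and g: "g \<in> H"
    show "AE t in circle. A (\<lambda>s. f s + g s) t + B (\<lambda>s. f s + g s) t = A f t + B f t + (A g t + B g t)"
      using bopD(2)[OF A f g] bopD(2)[OF B f g] by eventually_elim simp
  qed
qed

lemma bop_mult:
  assumes h: "analytic_L1 h" and B: "AE t in circle. cmod (h t) \<le> B" "B \<ge> 0"
  shows "bop (\<lambda>f t. h t * f t)"
  by (rule bopI[of _ B]) (use hardy_mult[OF _ h B] in \<open>auto simp: distrib_left\<close>)

lemma bop_uminus: "bop A \<Longrightarrow> bop (\<lambda>f t. - A f t)"
  using bop_comp[OF bop_mult[of "\<lambda>_. -1" 1], of A] analytic_scale[OF analytic_L1_one, of "-1"] by simp

lemma bop_diff: "bop A \<Longrightarrow> bop B \<Longrightarrow> bop (\<lambda>f t. A f t - B f t)"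
  using bop_add[of A "\<lambda>f t. - B f t"] bop_uminus[of B] by simp

lemma copD:
  assumes "cop K" "\<And>n::nat. f n \<in> H" "\<And>n. N (f n) \<le> 1"
  obtains r g where "strict_mono r" "g \<in> H" "(\<lambda>n. N (\<lambda>t. K (f (r n)) t - g t)) \<longlonglongrightarrow> 0"
proof -
  have "\<exists>r g. strict_mono r \<and> g \<in> H \<and> (\<lambda>n. N (\<lambda>t. K (f (r n)) t - g t)) \<longlonglongrightarrow> 0"
    using assms(1)[unfolded compact_op_def, THEN conjunct2, rule_format, of f] assms(2,3) by simp
  then show ?thesis using that by blast
qed

lemma cop_bop: "cop K \<Longrightarrow> bop K" by (simp add: compact_op_def)

lemma cop_zero: "cop (\<lambda>f t. 0)"
  unfolding compact_op_def
proof (intro conjI allI impI)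
  show "bop (\<lambda>f t. 0)" by (rule bopI[of _ 0]) (auto simp: hardy_0)
  fix f assume "\<forall>n::nat. f n \<in> H \<and> N (f n) \<le> 1"
  show "\<exists>(r::nat \<Rightarrow> nat) g. strict_mono r \<and> g \<in> H \<and> (\<lambda>n::nat. N (\<lambda>t. 0 - g t)) \<longlonglongrightarrow> 0"
    by (intro exI[of _ "\<lambda>n. n"] exI[of _ "\<lambda>_. 0"]) (auto simp: hardy_0 strict_mono_def)
qed

lemma cop_AE_cong:
  assumes K: "cop K" and L: "\<And>f. f \<in> H \<Longrightarrow> L f \<in> borel_measurable circle" and eq: "\<And>f. f \<in> H \<Longrightarrow> AE t in circle. K f t = L f t"
  shows "cop L"
  unfolding compact_op_def
proof (intro conjI allI impI)
  show "bop L" by (rule bop_AE_cong[OF cop_bop[OF K] L eq])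
  fix f assume f: "\<forall>n::nat. f n \<in> H \<and> N (f n) \<le> 1"
  obtain r g where rg: "strict_mono r" "g \<in> H" "(\<lambda>n. N (\<lambda>t. K (f (r n)) t - g t)) \<longlonglongrightarrow> 0"
    using copD[OF K, of f] f by blast
  have "N (\<lambda>t. L (f n) t - g t) = N (\<lambda>t. K (f n) t - g t)" for n
  proof (rule X_AE_cong(2))
    show "(\<lambda>t. K (f n) t - g t) \<in> X" using f rg bopD(1)[OF cop_bop[OF K]] by (intro hardy_X hardy_diff) auto
    show "(\<lambda>t. L (f n) t - g t) \<in> borel_measurable circle"
      using L f X_measurable[OF hardy_X[OF rg(2)]] by (intro borel_measurable_diff) auto
    show "AE t in circle. K (f n) t - g t = L (f n) t - g t"
      using eq[of "f n"] f by (auto elim: eventually_mono)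
  qed
  then show "\<exists>r g. strict_mono r \<and> g \<in> H \<and> (\<lambda>n. N (\<lambda>t. L (f (r n)) t - g t)) \<longlonglongrightarrow> 0"
    using rg by (intro exI[of _ r] exI[of _ g]) simp
qed

lemma cop_add:
  assumes K: "cop K" and L: "cop L" shows "cop (\<lambda>f t. K f t + L f t)"
  unfolding compact_op_def
proof (intro conjI allI impI)
  show "bop (\<lambda>f t. K f t + L f t)" by (rule bop_add[OF cop_bop[OF K] cop_bop[OF L]])
  fix f assume f: "\<forall>n::nat. f n \<in> H \<and> N (f n) \<le> 1"
  obtain r g where rg: "strict_mono r" "g \<in> H" "(\<lambda>n. N (\<lambda>t. K (f (r n)) t - g t)) \<longlonglongrightarrow> 0"
    using copD[OF K, of f] f by blast
  obtain s k where sk: "strict_mono s" "k \<in> H" "(\<lambda>n. N (\<lambda>t. L (f (r (s n))) t - k t)) \<longlonglongrightarrow> 0"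
    using copD[OF L, of "\<lambda>n. f (r n)"] f by blast
  have KH: "K (f n) \<in> H" "L (f n) \<in> H" for n using f bopD(1)[OF cop_bop[OF K]] bopD(1)[OF cop_bop[OF L]] by auto
  have lim: "(\<lambda>n. N (\<lambda>t. K (f (r (s n))) t - g t) + N (\<lambda>t. L (f (r (s n))) t - k t)) \<longlonglongrightarrow> 0 + 0"
    using LIMSEQ_subseq_LIMSEQ[OF rg(3) sk(1)] sk(3) by (intro tendsto_add) (auto simp: o_def)
  have "(\<lambda>n. N (\<lambda>t. K (f ((r \<circ> s) n)) t + L (f ((r \<circ> s) n)) t - (g t + k t))) \<longlonglongrightarrow> 0"
  proof (rule tendsto_sandwich[OF _ _ tendsto_const lim[simplified]])
    show "\<forall>\<^sub>F n in sequentially. N (\<lambda>t. K (f ((r \<circ> s) n)) t + L (f ((r \<circ> s) n)) t - (g t + k t)) \<le> N (\<lambda>t. K (f (r (s n))) t - g t) + N (\<lambda>t. L (f (r (s n))) t - k t)"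
    proof (intro always_eventually allI)
      fix n
      have "(\<lambda>t. K (f (r (s n))) t - g t) \<in> X" "(\<lambda>t. L (f (r (s n))) t - k t) \<in> X"
        using KH rg sk by (auto intro!: hardy_X hardy_diff)
      from X_add(2)[OF this] show "N (\<lambda>t. K (f ((r \<circ> s) n)) t + L (f ((r \<circ> s) n)) t - (g t + k t)) \<le> N (\<lambda>t. K (f (r (s n))) t - g t) + N (\<lambda>t. L (f (r (s n))) t - k t)"
        by (simp add: algebra_simps)
    qed
  qed (auto intro!: always_eventually)
  then show "\<exists>r ga. strict_mono r \<and> ga \<in> H \<and> (\<lambda>n. N (\<lambda>t. K (f (r n)) t + L (f (r n)) t - ga t)) \<longlonglongrightarrow> 0"
    using rg sk by (intro exI[of _ "r \<circ> s"] exI[of _ "\<lambda>t. g t + k t"]) (auto intro: strict_mono_o hardy_add)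
qed

lemma cop_comp_left:
  assumes A: "bop A" and K: "cop K" shows "cop (\<lambda>f. A (K f))"
  unfolding compact_op_def
proof (intro conjI allI impI)
  show "bop (\<lambda>f. A (K f))" by (rule bop_comp[OF A cop_bop[OF K]])
  obtain C where C: "C \<ge> 0" "\<forall>f\<in>H. N (A f) \<le> C * N f" using bopD(4)[OF A] by blast
  fix f assume f: "\<forall>n::nat. f n \<in> H \<and> N (f n) \<le> 1"
  obtain r g where rg: "strict_mono r" "g \<in> H" "(\<lambda>n. N (\<lambda>t. K (f (r n)) t - g t)) \<longlonglongrightarrow> 0"
    using copD[OF K, of f] f by blast
  have KH: "K (f n) \<in> H" for n using f bopD(1)[OF cop_bop[OF K]] by auto
  have "(\<lambda>n. N (\<lambda>t. A (K (f (r n))) t - A g t)) \<longlonglongrightarrow> 0"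
  proof (rule tendsto_sandwich[OF _ _ tendsto_const])
    show "(\<lambda>n. C * N (\<lambda>t. K (f (r n)) t - g t)) \<longlonglongrightarrow> 0" using tendsto_mult[OF tendsto_const rg(3), of C] by simp
    show "\<forall>\<^sub>F n in sequentially. N (\<lambda>t. A (K (f (r n))) t - A g t) \<le> C * N (\<lambda>t. K (f (r n)) t - g t)"
    proof (intro always_eventually allI)
      fix n
      define u where "u t = K (f (r n)) t - g t" for t
      have u: "u \<in> H" unfolding u_def by (rule hardy_diff[OF KH rg(2)])
      have "AE t in circle. A (\<lambda>s. u s + g s) t = A u t + A g t" by (rule bopD(2)[OF A u rg(2)])
      moreover have "(\<lambda>s. u s + g s) = K (f (r n))" by (simp add: u_def)
      ultimately have "AE t in circle. A u t = A (K (f (r n))) t - A g t" by auto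
      then have "N (\<lambda>t. A (K (f (r n))) t - A g t) = N (A u)"
        by (intro X_AE_cong(2)[OF hardy_X[OF bopD(1)[OF A u]]] X_measurable[OF hardy_X] hardy_diff bopD(1)[OF A] KH rg(2))
      also have "\<dots> \<le> C * N u" using C u by blast
      finally show "N (\<lambda>t. A (K (f (r n))) t - A g t) \<le> C * N (\<lambda>t. K (f (r n)) t - g t)" by (simp add: u_def[abs_def])
    qed
  qed (auto intro!: always_eventually)
  then show "\<exists>r ga. strict_mono r \<and> ga \<in> H \<and> (\<lambda>n. N (\<lambda>t. A (K (f (r n))) t - ga t)) \<longlonglongrightarrow> 0"
    using rg bopD(1)[OF A rg(2)] by blast
qed

text \<open>The images under \<open>A\<close> of a sequence in the unit ball have norms at most \<open>C\<close>; they are scaled back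
  into the unit ball before the compactness of \<open>K\<close> is used.\<close>
lemma cop_comp_right:
  assumes K: "cop K" and A: "bop A" shows "cop (\<lambda>f. K (A f))"
  unfolding compact_op_def
proof (intro conjI allI impI)
  show "bop (\<lambda>f. K (A f))" by (rule bop_comp[OF cop_bop[OF K] A])
  obtain C0 where C0: "C0 \<ge> 0" "\<forall>f\<in>H. N (A f) \<le> C0 * N f" using bopD(4)[OF A] by blast
  define C where "C = C0 + 1"
  have C: "C > 0" "\<And>f. f \<in> H \<Longrightarrow> N (A f) \<le> C * N f"
    using C0 by (auto simp: C_def distrib_right intro: add_increasing2)
  fix f assume f: "\<forall>n::nat. f n \<in> H \<and> N (f n) \<le> 1"
  have AH: "A (f n) \<in> H" for n using f bopD(1)[OF A] by auto
  define c :: complex where "c = of_real (1/C)"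
  have c: "cmod c = 1/C" using C(1) by (simp add: c_def norm_divide)
  define u where "u n t = c * A (f n) t" for n t
  have u: "u n \<in> H" for n unfolding u_def by (rule hardy_scale[OF AH])
  have u1: "N (u n) \<le> 1" for n
  proof -
    have "N (A (f n)) \<le> C * 1" using C(2)[of "f n"] f C(1) by (meson mult_left_mono less_imp_le order_trans)
    moreover have "N (u n) = 1/C * N (A (f n))" unfolding u_def X_scale(2)[OF hardy_X[OF AH]] c by simp
    ultimately show ?thesis using C(1) by simp
  qed
  obtain r g where rg: "strict_mono r" "g \<in> H" "(\<lambda>n. N (\<lambda>t. K (u (r n)) t - g t)) \<longlonglongrightarrow> 0"
    using copD[OF K, of u] u u1 by blast
  have "N (\<lambda>t. K (A (f n)) t - of_real C * g t) = C * N (\<lambda>t. K (u n) t - g t)" for n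
  proof -
    have KH: "K (u n) \<in> H" "K (A (f n)) \<in> H" using bopD(1)[OF cop_bop[OF K]] u AH by auto
    have "(\<lambda>s. of_real C * u n s) = A (f n)" using C(1) by (auto simp: u_def c_def)
    then have "AE t in circle. K (A (f n)) t = of_real C * K (u n) t"
      using bopD(3)[OF cop_bop[OF K] u[of n], of "of_real C"] by simp
    then have "AE t in circle. of_real C * (K (u n) t - g t) = K (A (f n)) t - of_real C * g t"
      by eventually_elim (simp add: algebra_simps)
    then have "N (\<lambda>t. K (A (f n)) t - of_real C * g t) = N (\<lambda>t. of_real C * (K (u n) t - g t))"
      using KH rg(2) by (intro X_AE_cong(2)) (auto intro!: hardy_X X_measurable hardy_diff hardy_scale)
    also have "\<dots> = C * N (\<lambda>t. K (u n) t - g t)"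
      using KH rg(2) C(1) by (subst X_scale(2)) (auto intro!: hardy_X hardy_diff)
    finally show ?thesis .
  qed
  then have "(\<lambda>n. N (\<lambda>t. K (A (f (r n))) t - of_real C * g t)) \<longlonglongrightarrow> 0"
    using tendsto_mult[OF tendsto_const rg(3), of C] by simp
  then show "\<exists>r ga. strict_mono r \<and> ga \<in> H \<and> (\<lambda>n. N (\<lambda>t. K (A (f (r n))) t - ga t)) \<longlonglongrightarrow> 0"
    using rg hardy_scale[OF rg(2), of "of_real C"] by blast
qed

text \<open>By induction from \<open>T\<^sup>n\<^sup>+\<^sup>1 - A\<^sup>n\<^sup>+\<^sup>1 = T (T\<^sup>n - A\<^sup>n) + (T - A) A\<^sup>n\<close>.\<close>
lemma compact_power_diff:
  assumes T: "bop T" and A: "bop A" and K: "cop (\<lambda>f t. T f t - A f t)" and B: "bop B"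
  shows "bop (\<lambda>f. (T ^^ n) (B f)) \<and> bop (\<lambda>f. (A ^^ n) (B f)) \<and> cop (\<lambda>f t. (T ^^ n) (B f) t - (A ^^ n) (B f) t)"
proof (induction n)
  case 0
  show ?case using B cop_zero by simp
next
  case (Suc n)
  then have T': "bop (\<lambda>f. (T ^^ n) (B f))" and A': "bop (\<lambda>f. (A ^^ n) (B f))"
    and D: "cop (\<lambda>f t. (T ^^ n) (B f) t - (A ^^ n) (B f) t)" by auto
  have T2: "bop (\<lambda>f. (T ^^ Suc n) (B f))" and A2: "bop (\<lambda>f. (A ^^ Suc n) (B f))"
    using bop_comp[OF T T'] bop_comp[OF A A'] by auto
  have "cop (\<lambda>f t. T (\<lambda>s. (T ^^ n) (B f) s - (A ^^ n) (B f) s) t + (T ((A ^^ n) (B f)) t - A ((A ^^ n) (B f)) t))"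
    by (rule cop_add[OF cop_comp_left[OF T D] cop_comp_right[OF K A']])
  then have "cop (\<lambda>f t. (T ^^ Suc n) (B f) t - (A ^^ Suc n) (B f) t)"
  proof (rule cop_AE_cong)
    fix f assume f: "f \<in> H"
    define u where "u = (T ^^ n) (B f)"
    define v where "v = (A ^^ n) (B f)"
    have u: "u \<in> H" and v: "v \<in> H" using bopD(1)[OF T' f] bopD(1)[OF A' f] by (auto simp: u_def v_def)
    show "(\<lambda>t. (T ^^ Suc n) (B f) t - (A ^^ Suc n) (B f) t) \<in> borel_measurable circle"
      using bopD(1)[OF T2 f] bopD(1)[OF A2 f] by (intro X_measurable hardy_X hardy_diff)
    have Tu: "(T ^^ Suc n) (B f) = T u" "(A ^^ Suc n) (B f) = A v" by (simp_all add: u_def v_def)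
    have "AE t in circle. T (\<lambda>s. (u s - v s) + v s) t = T (\<lambda>s. u s - v s) t + T v t"
      by (rule bopD(2)[OF T hardy_diff[OF u v] v])
    moreover have "(\<lambda>s. (u s - v s) + v s) = u" by simp
    ultimately have "AE t in circle. T u t = T (\<lambda>s. u s - v s) t + T v t" by (simp only:)
    then show "AE t in circle. T (\<lambda>s. (T ^^ n) (B f) s - (A ^^ n) (B f) s) t + (T ((A ^^ n) (B f)) t - A ((A ^^ n) (B f)) t) = (T ^^ Suc n) (B f) t - (A ^^ Suc n) (B f) t"
      unfolding Tu u_def[symmetric] v_def[symmetric] by eventually_elim simp
  qed
  then show ?case using T2 A2 by blast
qed

text \<open>What the comparison of operator norms requires: homogeneity, for the passage to unit vectors,
  and a bound. The values are only placed in the full space, which is evident for a Toeplitz operator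
  with an arbitrary bounded symbol.\<close>
definition homog_bounded where
  "homog_bounded A \<longleftrightarrow> (\<forall>f\<in>H. A f \<in> X) \<and> (\<forall>f\<in>H. \<forall>c. AE t in circle. A (\<lambda>s. c * f s) t = c * A f t) \<and>
     (\<exists>C. \<forall>f\<in>H. N (A f) \<le> C * N f)"

lemma bop_homog: "bop A \<Longrightarrow> homog_bounded A"
  unfolding homog_bounded_def bounded_op_def using hardy_X by blast

lemma op_norm_bound:
  assumes A: "homog_bounded A"
  shows "op_norm H N A \<ge> 0" "f \<in> H \<Longrightarrow> N (A f) \<le> op_norm H N A * N f"
proof -
  obtain C where C: "\<forall>f\<in>H. N (A f) \<le> C * N f" using A unfolding homog_bounded_def by blast
  have bdd: "bdd_above ((\<lambda>f. N (A f)) ` {f \<in> H. N f \<le> 1})"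
  proof (rule bdd_aboveI2)
    fix f assume f: "f \<in> {f \<in> H. N f \<le> 1}"
    have "N (A f) \<le> C * N f" using C f by blast
    also have "\<dots> \<le> \<bar>C\<bar> * 1" using f by (intro mult_mono) auto
    finally show "N (A f) \<le> \<bar>C\<bar>" by simp
  qed
  have up: "N (A f) \<le> op_norm H N A" if "f \<in> H" "N f \<le> 1" for f
    unfolding op_norm_def using that by (intro cSUP_upper bdd) auto
  have "0 \<le> N (A (\<lambda>_. 0))" by simp
  also have "\<dots> \<le> op_norm H N A" by (rule up) (auto simp: hardy_0)
  finally show nn: "op_norm H N A \<ge> 0" .
  assume f: "f \<in> H"
  show "N (A f) \<le> op_norm H N A * N f"
  proof (cases "N f = 0")
    case True
    then show ?thesis using C f by fastforce
  next
    case False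
    then have p: "N f > 0" using N_nonneg[of f] by linarith
    define c :: complex where "c = of_real (1 / N f)"
    have c: "cmod c = 1 / N f" using p by (simp add: c_def norm_divide)
    define u where "u s = c * f s" for s
    have u: "u \<in> H" unfolding u_def by (rule hardy_scale[OF f])
    have u1: "N u \<le> 1" unfolding u_def X_scale(2)[OF hardy_X[OF f]] c using p by simp
    have Au: "A u \<in> X" using A u unfolding homog_bounded_def by blast
    have Af: "A f \<in> X" using A f unfolding homog_bounded_def by blast
    have "AE t in circle. A u t = c * A f t"
      using A f unfolding homog_bounded_def u_def by blast
    then have "N (\<lambda>t. c * A f t) = N (A u)"
      by (rule X_AE_cong(2)[OF Au X_measurable[OF X_scale(1)[OF Af]]])
    then have "1 / N f * N (A f) = N (A u)" unfolding X_scale(2)[OF Af] c .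
    then have "1 / N f * N (A f) \<le> op_norm H N A" using up[OF u u1] by simp
    then show ?thesis using p by (simp add: field_simps)
  qed
qed

lemma op_norm_le:
  assumes "M \<ge> 0" "\<And>f. f \<in> H \<Longrightarrow> N (A f) \<le> M * N f"
  shows "op_norm H N A \<le> M"
  unfolding op_norm_def
proof (rule cSUP_least)
  show "{f \<in> H. N f \<le> 1} \<noteq> {}" using hardy_0 by force
  fix f assume f: "f \<in> {f \<in> H. N f \<le> 1}"
  then have "N (A f) \<le> M * N f" using assms by blast
  also have "\<dots> \<le> M * 1" using f assms by (intro mult_left_mono) auto
  finally show "N (A f) \<le> M" by simp
qed

lemma homog_diff:
  assumes A: "homog_bounded A" and K: "bop K"
  shows "homog_bounded (\<lambda>f t. A f t - K f t)"
  unfolding homog_bounded_def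
proof (intro conjI ballI allI)
  obtain C where C: "\<forall>f\<in>H. N (A f) \<le> C * N f" using A unfolding homog_bounded_def by blast
  obtain D where D: "\<forall>f\<in>H. N (K f) \<le> D * N f" using bopD(4)[OF K] by blast
  have AX: "A f \<in> X" "K f \<in> X" if "f \<in> H" for f
    using that A bopD(1)[OF K that] unfolding homog_bounded_def by (auto intro: hardy_X)
  fix f assume f: "f \<in> H"
  show "(\<lambda>t. A f t - K f t) \<in> X" by (rule X_diff(1)[OF AX[OF f]])
  fix c
  have "AE t in circle. A (\<lambda>s. c * f s) t = c * A f t" using A f unfolding homog_bounded_def by blast
  then show "AE t in circle. A (\<lambda>s. c * f s) t - K (\<lambda>s. c * f s) t = c * (A f t - K f t)"
    using bopD(3)[OF K f, of c] by eventually_elim (simp add: algebra_simps)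
next
  obtain C where C: "\<forall>f\<in>H. N (A f) \<le> C * N f" using A unfolding homog_bounded_def by blast
  obtain D where D: "\<forall>f\<in>H. N (K f) \<le> D * N f" using bopD(4)[OF K] by blast
  have AX: "A f \<in> X" "K f \<in> X" if "f \<in> H" for f
    using that A bopD(1)[OF K that] unfolding homog_bounded_def by (auto intro: hardy_X)
  show "\<exists>C. \<forall>f\<in>H. N (\<lambda>t. A f t - K f t) \<le> C * N f"
  proof (intro exI[of _ "C + D"] ballI)
    fix f assume f: "f \<in> H"
    have "N (\<lambda>t. A f t - K f t) \<le> N (A f) + N (K f)" by (rule X_diff(2)[OF AX[OF f]])
    also have "\<dots> \<le> C * N f + D * N f" using C D f by (intro add_mono) auto
    finally show "N (\<lambda>t. A f t - K f t) \<le> (C + D) * N f" by (simp add: distrib_right)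
  qed
qed

lemma ess_norm_le:
  assumes A: "homog_bounded A" and K: "cop K" and M: "M \<ge> 0" "\<And>f. f \<in> H \<Longrightarrow> N (\<lambda>t. A f t - K f t) \<le> M * N f"
  shows "ess_norm H N A \<le> M"
proof -
  have "ess_norm H N A \<le> op_norm H N (\<lambda>f t. A f t - K f t)"
    unfolding ess_norm_def
    by (rule cINF_lower) (use K A in \<open>auto intro!: bdd_belowI2[where m=0] op_norm_bound(1) homog_diff cop_bop\<close>)
  also have "\<dots> \<le> M" by (rule op_norm_le[OF M])
  finally show ?thesis .
qed

lemma ess_norm_ge:
  assumes A: "homog_bounded A"
    and low: "\<And>K M. cop K \<Longrightarrow> M \<ge> 0 \<Longrightarrow> (\<And>f. f \<in> H \<Longrightarrow> N (\<lambda>t. A f t - K f t) \<le> M * N f) \<Longrightarrow> m \<le> M"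
  shows "m \<le> ess_norm H N A"
  unfolding ess_norm_def
proof (rule cINF_greatest)
  show "{K. cop K} \<noteq> {}" using cop_zero by blast
  fix K assume "K \<in> {K. cop K}"
  then have K: "cop K" by simp
  have h: "homog_bounded (\<lambda>f t. A f t - K f t)" by (rule homog_diff[OF A cop_bop[OF K]])
  show "m \<le> op_norm H N (\<lambda>f t. A f t - K f t)"
    by (rule low[OF K op_norm_bound(1)[OF h] op_norm_bound(2)[OF h]])
qed

lemma ess_norm_lessE:
  assumes A: "homog_bounded A" and less: "ess_norm H N A < M"
  obtains K where "cop K" "\<And>f. f \<in> H \<Longrightarrow> N (\<lambda>t. A f t - K f t) \<le> M * N f"
proof -
  have "\<exists>K\<in>{K. cop K}. op_norm H N (\<lambda>f t. A f t - K f t) < M"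
    using less cop_zero unfolding ess_norm_def
    by (subst (asm) cINF_less_iff) (use A in \<open>auto intro!: bdd_belowI2[where m=0] op_norm_bound(1) homog_diff cop_bop\<close>)
  then obtain K where K: "cop K" "op_norm H N (\<lambda>f t. A f t - K f t) < M" by auto
  have h: "homog_bounded (\<lambda>f t. A f t - K f t)" by (rule homog_diff[OF A cop_bop[OF K(1)]])
  have "N (\<lambda>t. A f t - K f t) \<le> M * N f" if "f \<in> H" for f
    using op_norm_bound(2)[OF h that] K(2) by (meson N_nonneg less_imp_le mult_right_mono order_trans)
  then show ?thesis using that[OF K(1)] by blast
qed

end

section \<open>Approximation in \<open>C + H\<^sup>\<infinity>\<close>\<close>

definition laurent_on_circle :: "(complex \<Rightarrow> complex) \<Rightarrow> bool" where
  "laurent_on_circle f \<longleftrightarrow> (\<exists>(n::nat) q. \<forall>t\<in>sphere 0 1. f t * t ^ n = poly q t)"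

lemma laurent_const: "laurent_on_circle (\<lambda>_. c)"
  unfolding laurent_on_circle_def by (intro exI[of _ 0] exI[of _ "[:c:]"]) simp

lemma laurent_add:
  assumes "laurent_on_circle f" "laurent_on_circle g" shows "laurent_on_circle (\<lambda>t. f t + g t)"
proof -
  obtain m p n q where pq: "\<forall>t\<in>sphere 0 1. f t * t ^ m = poly p t" "\<forall>t\<in>sphere 0 1. g t * t ^ n = poly q t"
    using assms unfolding laurent_on_circle_def by blast
  have "(f t + g t) * t ^ (m + n) = poly (p * monom 1 n + q * monom 1 m) t" if "t \<in> sphere 0 1" for t
  proof -
    have "(f t + g t) * t ^ (m + n) = (f t * t ^ m) * t ^ n + (g t * t ^ n) * t ^ m"
      by (simp add: power_add algebra_simps)
    also have "\<dots> = poly p t * t ^ n + poly q t * t ^ m" using pq that by simp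
    finally show ?thesis by (simp add: poly_monom)
  qed
  then show ?thesis unfolding laurent_on_circle_def by blast
qed

lemma laurent_mult:
  assumes "laurent_on_circle f" "laurent_on_circle g" shows "laurent_on_circle (\<lambda>t. f t * g t)"
proof -
  obtain m p n q where pq: "\<forall>t\<in>sphere 0 1. f t * t ^ m = poly p t" "\<forall>t\<in>sphere 0 1. g t * t ^ n = poly q t"
    using assms unfolding laurent_on_circle_def by blast
  have "(f t * g t) * t ^ (m + n) = poly (p * q) t" if "t \<in> sphere 0 1" for t
  proof -
    have "(f t * g t) * t ^ (m + n) = (f t * t ^ m) * (g t * t ^ n)"
      by (simp add: power_add algebra_simps)
    also have "\<dots> = poly p t * poly q t" using pq that by simp
    finally show ?thesis by simp
  qed
  then show ?thesis unfolding laurent_on_circle_def by blast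
qed

lemma laurent_Re_Im: "laurent_on_circle (\<lambda>t. of_real (Re t))" "laurent_on_circle (\<lambda>t. of_real (Im t))"
proof -
  have sq: "t * cnj t = 1" if "t \<in> sphere 0 1" for t
    using that complex_norm_square[of t] by simp
  have "of_real (Re t) * t ^ 1 = poly [:1/2, 0, 1/2:] t" if "t \<in> sphere 0 1" for t
  proof -
    have "of_real (Re t) * t = (t + cnj t) / 2 * t" by (simp add: complex_add_cnj)
    also have "\<dots> = (t * t + t * cnj t) / 2" by (simp add: algebra_simps)
    finally show ?thesis using sq[OF that] by (simp add: field_simps)
  qed
  then show "laurent_on_circle (\<lambda>t. of_real (Re t))" unfolding laurent_on_circle_def by blast
  have "of_real (Im t) * t ^ 1 = poly [:\<i>/2, 0, - (\<i>/2):] t" if "t \<in> sphere 0 1" for t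
  proof -
    have "t - cnj t = of_real (2 * Im t) * \<i>" by (rule complex_diff_cnj)
    then have "of_real (Im t) = (t - cnj t) * (- (\<i> / 2))" by simp
    then have "of_real (Im t) * t = (t - cnj t) * (- (\<i> / 2)) * t" by (rule arg_cong)
    also have "\<dots> = (t * t - t * cnj t) * (- (\<i> / 2))"
    proof -
      have "(x - y) * c * x = (x * x - x * y) * c" for x y c :: complex by (simp add: algebra_simps)
      then show ?thesis .
    qed
    also have "\<dots> = (t * t - 1) * (- (\<i> / 2))" unfolding sq[OF that] ..
    also have "\<dots> = poly [:\<i>/2, 0, - (\<i>/2):] t"
    proof -
      have "(t * t - 1) * (- c) = poly [:c, 0, - c:] t" for c by (simp add: algebra_simps)
      then show ?thesis .
    qed
    finally show ?thesis by simp
  qed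
  then show "laurent_on_circle (\<lambda>t. of_real (Im t))" unfolding laurent_on_circle_def by blast
qed

lemma laurent_real_polynomial_function:
  fixes f :: "complex \<Rightarrow> real"
  assumes "real_polynomial_function f" shows "laurent_on_circle (\<lambda>t. of_real (f t))"
  using assms
proof (induction rule: real_polynomial_function.induct)
  case (linear f)
  then interpret bounded_linear f .
  have "f t = Re t * f 1 + Im t * f \<i>" for t
  proof -
    have "t = Re t *\<^sub>R 1 + Im t *\<^sub>R \<i>" by (simp add: complex_eq_iff)
    then have "f t = f (Re t *\<^sub>R 1 + Im t *\<^sub>R \<i>)" by simp
    also have "\<dots> = Re t * f 1 + Im t * f \<i>" by (simp only: add scale real_scaleR_def)
    finally show ?thesis .
  qed
  then have "(\<lambda>t. complex_of_real (f t)) = (\<lambda>t. of_real (Re t) * of_real (f 1) + of_real (Im t) * of_real (f \<i>))"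
    by (metis of_real_add of_real_mult)
  then show ?case
    using laurent_add[OF laurent_mult[OF laurent_Re_Im(1) laurent_const] laurent_mult[OF laurent_Re_Im(2) laurent_const]] by simp
next
  case (const c)
  show ?case by (rule laurent_const)
next
  case (add f g)
  then show ?case using laurent_add by simp
next
  case (mult f g)
  then show ?case using laurent_mult by simp
qed

text \<open>Stone-Weierstrass gives an approximation by a polynomial in the real and imaginary part
  of \<open>t\<close>; on the circle these are \<open>(t + 1/t) / 2\<close> and \<open>(t - 1/t) / 2\<i>\<close>.\<close>
lemma continuous_near_laurent:
  assumes g: "continuous_on (sphere 0 1) g" and e: "e > 0"
  shows "\<exists>(n::nat) q. \<forall>t\<in>sphere 0 1. cmod (g t - mon (- int n) t * poly q t) \<le> e"
proof -
  obtain p where p: "polynomial_function p" "\<forall>t\<in>sphere 0 1. norm (g t - p t) < e"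
    using Stone_Weierstrass_polynomial_function[OF compact_sphere g e] by blast
  have "real_polynomial_function (\<lambda>t. Re (p t))" "real_polynomial_function (\<lambda>t. Im (p t))"
    using p(1) bounded_linear_Re bounded_linear_Im unfolding polynomial_function_def o_def by blast+
  then have "laurent_on_circle (\<lambda>t. of_real (Re (p t)) + of_real (Im (p t)) * \<i>)"
    by (intro laurent_add laurent_mult laurent_const laurent_real_polynomial_function)
  moreover have "(\<lambda>t. of_real (Re (p t)) + of_real (Im (p t)) * \<i>) = p"
    by (simp add: fun_eq_iff complex_eq_iff)
  ultimately have "laurent_on_circle p" by (simp only:)
  then obtain n q where q: "\<forall>t\<in>sphere 0 1. p t * t ^ n = poly q t"
    unfolding laurent_on_circle_def by blast
  have "cmod (g t - mon (- int n) t * poly q t) \<le> e" if t: "t \<in> sphere 0 1" for t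
  proof -
    have "t \<noteq> 0" using t by auto
    have "mon (- int n) t = inverse (t ^ n)" by (simp add: mon_def power_int_minus)
    moreover have "poly q t = p t * t ^ n" using q t by simp
    ultimately have "mon (- int n) t * poly q t = p t" using \<open>t \<noteq> 0\<close> by simp
    then show ?thesis using p(2) t by (auto intro: less_imp_le)
  qed
  then show ?thesis by blast
qed

lemma analytic_poly: "analytic_L1 (poly q)"
proof (induction q)
  case 0
  then show ?case by (simp add: analytic_L1_def)
next
  case (pCons a q)
  have b: "AE w in circle. cmod (mon 1 w) \<le> 1" by (rule AE_I2) (simp add: cmod_mon del: space_circle)
  have "analytic_L1 (\<lambda>t. mon 1 t * poly q t)" by (rule analytic_L1_mult[OF analytic_L1_mon pCons(2) b]) simp
  moreover have "analytic_L1 (\<lambda>t. a)"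
    by (auto simp: analytic_L1_def integral_powi)
  ultimately have "integrable circle (\<lambda>t. a + mon 1 t * poly q t) \<and> (\<forall>n>0. (LINT w|circle. (a + mon 1 w * poly q w) * w powi n) = 0)"
    unfolding analytic_L1_def by (auto simp: distrib_right integrable_mult_powi)
  then show ?case by (simp add: analytic_L1_def mon_def)
qed

lemma Hinf_analytic:
  assumes h: "h \<in> Hinf" shows "h \<in> Linf" "analytic_L1 h"
proof -
  show L: "h \<in> Linf" using h by (simp add: hardy_def)
  have "integrable circle h"
    by (rule integrable_const_bound[OF Linf_bound(2)[OF L] Linf_bound(1)[OF L]])
  then show "analytic_L1 h" using h by (simp add: analytic_L1_iff hardy_def)
qed

text \<open>If \<open>a = g + k\<close> and \<open>g\<close> is close to \<open>e\<^sub>-\<^sub>n q\<close> with a polynomial \<open>q\<close>, then \<open>h = q + e\<^sub>n k\<close>.\<close>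
lemma C_plus_Hinf_approx:
  assumes a: "a \<in> C_plus_Hinf" and e: "e > 0"
  obtains n :: nat and h where "analytic_L1 h" "AE t in circle. cmod (h t) \<le> Linf_norm a + e"
    "AE t in circle. cmod (a t - mon (- int n) t * h t) \<le> e"
proof -
  obtain g k where gk: "continuous_on (sphere 0 1) g" "k \<in> Hinf" "AE t in circle. a t = g t + k t" and aL: "a \<in> Linf"
    using a unfolding C_plus_Hinf_def by blast
  obtain n :: nat and q where q: "\<forall>t\<in>sphere 0 1. cmod (g t - mon (- int n) t * poly q t) \<le> e"
    using continuous_near_laurent[OF gk(1) e] by blast
  define h where "h t = poly q t + mon n t * k t" for t
  have b: "AE w in circle. cmod (mon n w) \<le> 1" by (rule AE_I2) (simp add: cmod_mon del: space_circle)
  have "analytic_L1 (\<lambda>t. mon n t * k t)" by (rule analytic_L1_mult[OF analytic_L1_mon Hinf_analytic(2)[OF gk(2)] b]) simp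
  then have 1: "analytic_L1 h" using analytic_poly[of q]
    by (auto simp: h_def[abs_def] analytic_L1_def distrib_right integrable_mult_powi)
  have 3: "AE t in circle. cmod (a t - mon (- int n) t * h t) \<le> e"
    using gk(3) AE_space
  proof eventually_elim
    case (elim t)
    have "mon (- int n) t * h t = mon (- int n) t * poly q t + (mon (- int n) t * mon n t) * k t"
      by (simp add: h_def algebra_simps)
    also have "mon (- int n) t * mon n t = 1" using elim(2) by (simp add: mon_add del: space_circle)
    finally have eq: "a t - mon (- int n) t * h t = g t - mon (- int n) t * poly q t" using elim(1) by simp
    show ?case unfolding eq using q elim(2) by simp
  qed
  have 2: "AE t in circle. cmod (h t) \<le> Linf_norm a + e"
    using 3 Linf_bound(2)[OF aL] AE_space
  proof eventually_elim
    case (elim t)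
    have "cmod (h t) = cmod (mon (- int n) t * h t)" using elim(3) by (simp add: norm_mult cmod_mon del: space_circle)
    also have "\<dots> = cmod (a t - (a t - mon (- int n) t * h t))" by simp
    also have "\<dots> \<le> cmod (a t) + cmod (a t - mon (- int n) t * h t)" by (rule norm_triangle_ineq4)
    finally show ?case using elim by linarith
  qed
  show ?thesis by (rule that[OF 1 2 3])
qed

lemma integral_mon_mult: "(LINT w|circle. mon i w * mon j w) = (if i + j = 0 then 1 else 0)"
proof -
  have "(LINT w|circle. mon i w * mon j w) = (LINT w|circle. w powi (i + j))"
    by (intro Bochner_Integration.integral_cong refl) (simp add: mon_add mon_def[of "i+j"] del: space_circle)
  then show ?thesis by (simp add: integral_powi)
qed

lemma integrable_mon_mult: "integrable circle (\<lambda>w. mon i w * mon j w)"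
  by (rule bounded_integrable_circle[where B=1]) (auto simp: norm_mult mon_def)

text \<open>The functions \<open>e\<^sub>r\<close> with distinct exponents are orthonormal, so the square of the \<open>L\<^sup>2\<close> norm of
  the mean of \<open>k + 1\<close> of them is \<open>1 / (k + 1)\<close>.\<close>
lemma averages_tend_to_0:
  fixes r :: "nat \<Rightarrow> int"
  assumes r: "inj r"
  defines "\<phi> \<equiv> \<lambda>k t. (\<Sum>n<Suc k. mon (r n) t) / of_nat (Suc k)"
  obtains s :: "nat \<Rightarrow> nat" where "strict_mono s" "AE t in circle. (\<lambda>k. \<phi> (s k) t) \<longlonglongrightarrow> 0"
proof -
  have [measurable]: "\<phi> k \<in> borel_measurable circle" for k unfolding \<phi>_def by measurable
  have bound: "cmod (\<phi> k t) \<le> 1" if "t \<in> sphere 0 1" for k t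
  proof -
    have "cmod (\<Sum>n<Suc k. mon (r n) t) \<le> (\<Sum>n<Suc k. 1)"
      by (rule sum_norm_le) (use that in \<open>simp add: cmod_mon\<close>)
    then show ?thesis unfolding \<phi>_def norm_divide norm_of_nat by (simp add: divide_le_eq)
  qed
  have sq: "complex_of_real ((cmod (\<phi> k t))\<^sup>2) = (\<Sum>n<Suc k. \<Sum>m<Suc k. mon (r n) t * mon (- r m) t) / of_nat (Suc k) / of_nat (Suc k)"
    if "t \<in> space circle" for k t
  proof -
    have t: "cmod t = 1" using that by simp
    have "complex_of_real ((cmod (\<phi> k t))\<^sup>2) = \<phi> k t * cnj (\<phi> k t)" using complex_norm_square[of "\<phi> k t"] by simp
    also have "cnj (\<phi> k t) = (\<Sum>m<Suc k. mon (- r m) t) / of_nat (Suc k)"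
      unfolding \<phi>_def complex_cnj_divide complex_cnj_of_nat cnj_sum by (simp only: cnj_mon[OF t])
    finally show ?thesis unfolding \<phi>_def by (simp only: times_divide_eq_left times_divide_eq_right sum_product)
  qed
  have "complex_of_real (LINT t|circle. (cmod (\<phi> k t))\<^sup>2) = of_real (1 / Suc k)" for k
  proof -
    have "complex_of_real (LINT t|circle. (cmod (\<phi> k t))\<^sup>2) = (LINT t|circle. complex_of_real ((cmod (\<phi> k t))\<^sup>2))"
      by (rule integral_complex_of_real[symmetric])
    also have "\<dots> = (LINT t|circle. (\<Sum>n<Suc k. \<Sum>m<Suc k. mon (r n) t * mon (- r m) t) / of_nat (Suc k) / of_nat (Suc k))"
      by (intro Bochner_Integration.integral_cong refl sq)
    also have "\<dots> = (\<Sum>n<Suc k. \<Sum>m<Suc k. (LINT t|circle. mon (r n) t * mon (- r m) t)) / of_nat (Suc k) / of_nat (Suc k)"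
      by (simp only: integral_divide_zero Bochner_Integration.integral_sum Bochner_Integration.integrable_sum integrable_mon_mult)
    also have "(\<Sum>n<Suc k. \<Sum>m<Suc k. (LINT t|circle. mon (r n) t * mon (- r m) t)) = (\<Sum>n<Suc k. (1::complex))"
    proof (rule sum.cong[OF refl])
      fix n assume n: "n \<in> {..<Suc k}"
      have "(\<Sum>m<Suc k. (LINT t|circle. mon (r n) t * mon (- r m) t)) = (\<Sum>m<Suc k. if m = n then 1 else 0)"
        using r by (intro sum.cong refl) (auto simp: integral_mon_mult inj_def)
      then show "(\<Sum>m<Suc k. (LINT t|circle. mon (r n) t * mon (- r m) t)) = 1" using n by simp
    qed
    finally show ?thesis by simp
  qed
  then have int: "(LINT t|circle. (cmod (\<phi> k t))\<^sup>2) = 1 / Suc k" for k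
    by (simp only: of_real_eq_iff)
  have "(\<lambda>k. LINT t|circle. norm ((cmod (\<phi> k t))\<^sup>2)) \<longlonglongrightarrow> 0"
    using LIMSEQ_Suc[OF lim_1_over_n] by (simp add: int)
  moreover have "integrable circle (\<lambda>t. (cmod (\<phi> k t))\<^sup>2)" for k
    using not_integrable_integral_eq[of circle "\<lambda>t. (cmod (\<phi> k t))\<^sup>2"] int[of k] by fastforce
  ultimately obtain s where s: "strict_mono s" "AE t in circle. (\<lambda>k. (cmod (\<phi> (s k) t))\<^sup>2) \<longlonglongrightarrow> 0"
    using tendsto_L1_AE_subseq[of circle "\<lambda>k t. (cmod (\<phi> k t))\<^sup>2"] by blast
  have "AE t in circle. (\<lambda>k. \<phi> (s k) t) \<longlonglongrightarrow> 0"
    using s(2)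
  proof eventually_elim
    case (elim t)
    then have "(\<lambda>k. sqrt ((cmod (\<phi> (s k) t))\<^sup>2)) \<longlonglongrightarrow> sqrt 0" by (rule tendsto_real_sqrt)
    then show ?case by (simp add: tendsto_norm_zero_iff)
  qed
  then show ?thesis using that s(1) by blast
qed

section \<open>The upper estimate\<close>

locale riesz_bounded = function_space +
  assumes rb: "bounded_op (bfs \<rho>) (bfs_norm \<rho>) riesz"
begin

lemma riesz_X: "f \<in> X \<Longrightarrow> riesz f \<in> X" using rb unfolding bounded_op_def by blast
lemma riesz_add: "f \<in> X \<Longrightarrow> g \<in> X \<Longrightarrow> AE t in circle. riesz (\<lambda>s. f s + g s) t = riesz f t + riesz g t"
  using rb unfolding bounded_op_def by blast
lemma riesz_scale: "f \<in> X \<Longrightarrow> AE t in circle. riesz (\<lambda>s. c * f s) t = c * riesz f t"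
  using rb unfolding bounded_op_def by blast
lemma riesz_bound: "\<exists>C\<ge>0. \<forall>f\<in>X. N (riesz f) \<le> C * N f"
proof -
  obtain C where "\<forall>f\<in>X. N (riesz f) \<le> C * N f" using rb unfolding bounded_op_def by blast
  then have "\<forall>f\<in>X. N (riesz f) \<le> max C 0 * N f"
    by (meson N_nonneg max.cobounded1 mult_right_mono order_trans)
  then show ?thesis by (intro exI[of _ "max C 0"]) auto
qed
lemma riesz_cong: "f \<in> X \<Longrightarrow> g \<in> X \<Longrightarrow> AE t in circle. f t = g t \<Longrightarrow> AE t in circle. riesz f t = riesz g t"
  by (rule AE_cong_of_bounded[OF _ _ rb]) (auto intro: X_diff)
lemma riesz_hardy: "f \<in> H \<Longrightarrow> AE t in circle. riesz f t = f t"
  by (intro riesz_analytic) (simp add: hardy_iff)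

lemma toeplitz_homog:
  assumes a: "a \<in> borel_measurable circle" and B: "AE t in circle. cmod (a t) \<le> B" "B \<ge> 0"
  shows "homog_bounded (toeplitz a)"
  unfolding homog_bounded_def toeplitz_def
proof (intro conjI ballI allI)
  fix f assume f: "f \<in> H"
  show "riesz (\<lambda>t. a t * f t) \<in> X" by (rule riesz_X[OF X_mult(1)[OF hardy_X[OF f] a B]])
  fix c
  show "AE t in circle. riesz (\<lambda>t. a t * (c * f t)) t = c * riesz (\<lambda>t. a t * f t) t"
    using riesz_scale[OF X_mult(1)[OF hardy_X[OF f] a B], of c] by (simp add: mult.left_commute)
next
  obtain C where C: "C \<ge> 0" "\<forall>f\<in>X. N (riesz f) \<le> C * N f" using riesz_bound by blast
  show "\<exists>C. \<forall>f\<in>H. N (riesz (\<lambda>t. a t * f t)) \<le> C * N f"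
  proof (intro exI[of _ "C * B"] ballI)
    fix f assume f: "f \<in> H"
    have "N (riesz (\<lambda>t. a t * f t)) \<le> C * N (\<lambda>t. a t * f t)"
      using C(2) X_mult(1)[OF hardy_X[OF f] a B] by blast
    also have "\<dots> \<le> C * (B * N f)" using C(1) X_mult(2)[OF hardy_X[OF f] a B] by (intro mult_left_mono)
    finally show "N (riesz (\<lambda>t. a t * f t)) \<le> C * B * N f" by (simp add: mult.assoc)
  qed
qed

abbreviation T where "T \<equiv> toeplitz (mon (-1))"

lemma mon_X: "mon n \<in> X"
  by (rule X_bounded[OF mon_measurable, of _ 1]) (rule AE_I2, simp add: cmod_mon del: space_circle)

lemma riesz_mon_neg: "n > 0 \<Longrightarrow> AE t in circle. riesz (\<lambda>s. c * mon (-n) s) t = 0"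
  using riesz_scale[OF mon_X[of "-n"], of c] riesz_mon_negative[of n] by (auto elim: eventually_elim2)

text \<open>Here \<open>c\<close> is the zeroth Fourier coefficient of \<open>f\<close>: removing it makes \<open>e\<^sub>-\<^sub>1 f\<close> analytic, and
  \<open>P\<close> annihilates \<open>e\<^sub>-\<^sub>1\<close>.\<close>
lemma backward_shift:
  assumes f: "f \<in> H"
  obtains c g where "g \<in> H" "\<And>t. mon (-1) t * f t = g t + c * mon (-1) t"
    "AE t in circle. T f t = g t"
proof -
  define c where "c = (LINT w|circle. f w)"
  define g where "g t = mon (-1) t * (f t - c)" for t
  have fX: "f \<in> X" using f by (rule hardy_X)
  have cX: "(\<lambda>t. c) \<in> X" using X_scale(1)[OF one_in_X, of c] by simp
  have gX: "g \<in> X" unfolding g_def by (rule X_mon(1)[OF X_diff(1)[OF fX cX]])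
  have eq: "mon (-1) t * f t = g t + c * mon (-1) t" for t by (simp add: g_def algebra_simps)
  have "(LINT w|circle. g w * w powi n) = 0" if n: "n > 0" for n
  proof -
    have "(LINT w|circle. g w * w powi n) = (LINT w|circle. f w * w powi (n - 1) - c * w powi (n - 1))"
    proof (intro Bochner_Integration.integral_cong refl)
      fix w assume "w \<in> space circle"
      then have "mon (-1) w * w powi n = w powi (n - 1)"
        using mon_add[of w "-1" n] by (simp add: mon_def[of n] mon_def[of "n-1"] del: space_circle)
      then show "g w * w powi n = f w * w powi (n - 1) - c * w powi (n - 1)"
        unfolding g_def by (metis (no_types, opaque_lifting) left_diff_distrib mult.assoc mult.commute)
    qed
    also have "\<dots> = (LINT w|circle. f w * w powi (n - 1)) - c * (LINT w|circle. w powi (n - 1))"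
      using integrable_mult_powi[OF X_integrable[OF fX]] integrable_powi by simp
    also have "\<dots> = 0"
    proof (cases "n = 1")
      case True
      show ?thesis unfolding integral_powi[of "n - 1"] using True by (simp add: c_def)
    next
      case False
      then show ?thesis using n f by (auto simp: integral_powi hardy_iff analytic_L1_def)
    qed
    finally show ?thesis .
  qed
  then have g: "g \<in> H" using gX X_integrable[OF gX] by (simp add: hardy_iff analytic_L1_def)
  have "AE t in circle. riesz (\<lambda>s. g s + c * mon (-1) s) t = riesz g t + riesz (\<lambda>s. c * mon (-1) s) t"
    by (rule riesz_add[OF gX X_scale(1)[OF mon_X]])
  then have "AE t in circle. T f t = g t"
    using riesz_hardy[OF g] riesz_mon_neg[of 1 c, OF zero_less_one] unfolding toeplitz_def eq by eventually_elim simp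
  then show ?thesis using that[OF g eq] by blast
qed

lemma T_bop: "bop T"
proof -
  have b: "AE t in circle. cmod (mon (-1) t) \<le> 1" by (rule AE_I2) (simp add: cmod_mon del: space_circle)
  have hb: "homog_bounded T" by (rule toeplitz_homog[OF mon_measurable b]) simp
  then obtain C where C: "\<forall>f\<in>H. N (T f) \<le> C * N f" unfolding homog_bounded_def by blast
  show ?thesis
  proof (rule bopI[of _ C])
    fix f assume f: "f \<in> H"
    obtain c g where g: "g \<in> H" "AE t in circle. T f t = g t" using backward_shift[OF f] by metis
    have "T f \<in> X" using hb f unfolding homog_bounded_def by blast
    moreover have "AE t in circle. g t = T f t" using g(2) by eventually_elim simp
    ultimately show "T f \<in> H" using hardy_AE_cong[OF g(1)] X_measurable by blast
    show "N (T f) \<le> C * N f" using C f by blast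
    fix c show "AE t in circle. T (\<lambda>s. c * f s) t = c * T f t" using hb f unfolding homog_bounded_def by blast
  next
    fix f g assume f: "f \<in> H" and g: "g \<in> H"
    show "AE t in circle. T (\<lambda>s. f s + g s) t = T f t + T g t"
      using riesz_add[OF X_mon(1)[OF hardy_X[OF f], of "-1"] X_mon(1)[OF hardy_X[OF g], of "-1"]]
      by (simp add: toeplitz_def distrib_left)
  qed
qed

lemma bop_funpow: "bop A \<Longrightarrow> bop (\<lambda>f. (A ^^ n) f)"
proof (induction n)
  case 0
  show ?case by (rule bopI[of _ 1]) auto
next
  case (Suc n)
  then show ?case using bop_comp[of A "\<lambda>f. (A ^^ n) f"] by simp
qed

text \<open>Write \<open>e\<^sub>-\<^sub>1 f = g + c e\<^sub>-\<^sub>1\<close>, where \<open>g = T f\<close> almost everywhere. Then \<open>e\<^sub>-\<^sub>n\<^sub>-\<^sub>1 f = e\<^sub>-\<^sub>n g + c e\<^sub>-\<^sub>n\<^sub>-\<^sub>1\<close>, and \<open>P\<close> annihilates the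
  second term, so the claim for \<open>f\<close> and \<open>n + 1\<close> is that for \<open>g\<close> and \<open>n\<close>.\<close>
lemma T_power:
  "f \<in> H \<Longrightarrow> AE t in circle. (T ^^ n) f t = riesz (\<lambda>s. mon (- int n) s * f s) t"
proof (induction n arbitrary: f)
  case 0
  then show ?case using riesz_hardy[OF 0] by (auto elim: eventually_mono)
next
  case (Suc n)
  obtain c g where g: "g \<in> H" "\<And>t. mon (-1) t * f t = g t + c * mon (-1) t" "AE t in circle. T f t = g t"
    using backward_shift[OF Suc.prems] by metis
  have TT: "(T ^^ Suc n) f = (T ^^ n) (T f)" by (simp only: funpow_Suc_right o_def)
  have "AE t in circle. (T ^^ n) (T f) t = (T ^^ n) g t"
    by (rule bop_cong[OF bop_funpow[OF T_bop] bopD(1)[OF T_bop Suc.prems] g(1,3)])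
  moreover have "AE t in circle. (T ^^ n) g t = riesz (\<lambda>s. mon (- int n) s * g s) t" by (rule Suc.IH[OF g(1)])
  moreover have "AE t in circle. riesz (\<lambda>s. mon (- int n) s * g s + c * mon (- (1 + int n)) s) t
      = riesz (\<lambda>s. mon (- int n) s * g s) t + riesz (\<lambda>s. c * mon (- (1 + int n)) s) t"
    by (rule riesz_add[OF X_mon(1)[OF hardy_X[OF g(1)]] X_scale(1)[OF mon_X]])
  moreover have "AE t in circle. riesz (\<lambda>s. c * mon (- (1 + int n)) s) t = 0" by (rule riesz_mon_neg) simp
  moreover have "AE t in circle. riesz (\<lambda>s. mon (- int (Suc n)) s * f s) t = riesz (\<lambda>s. mon (- int n) s * g s + c * mon (- (1 + int n)) s) t"
  proof (rule riesz_cong)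
    show "(\<lambda>s. mon (- int (Suc n)) s * f s) \<in> X" by (rule X_mon(1)[OF hardy_X[OF Suc.prems]])
    show "(\<lambda>s. mon (- int n) s * g s + c * mon (- (1 + int n)) s) \<in> X"
      by (rule X_add(1)[OF X_mon(1)[OF hardy_X[OF g(1)]] X_scale(1)[OF mon_X]])
    show "AE t in circle. mon (- int (Suc n)) t * f t = mon (- int n) t * g t + c * mon (- (1 + int n)) t"
    proof (rule AE_I2)
      fix t assume t: "t \<in> space circle"
      have "- int (Suc n) = - int n + -1" by simp
      then have m: "mon (- int (Suc n)) t = mon (- int n) t * mon (-1) t" by (simp only: mon_add[OF t])
      have "- (1 + int n) = - int n + -1" by simp
      then have m2: "mon (- (1 + int n)) t = mon (- int n) t * mon (-1) t" by (simp only: mon_add[OF t])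
      have "mon (- int (Suc n)) t * f t = mon (- int n) t * (mon (-1) t * f t)" unfolding m by (rule mult.assoc)
      also have "\<dots> = mon (- int n) t * g t + c * mon (- (1 + int n)) t" unfolding g(2) m2 by (simp add: algebra_simps)
      finally show "mon (- int (Suc n)) t * f t = mon (- int n) t * g t + c * mon (- (1 + int n)) t" .
    qed
  qed
  ultimately show ?case unfolding TT by eventually_elim simp
qed

lemma power_bound:
  assumes A: "bop A" and M: "M \<ge> 0" "\<And>f. f \<in> H \<Longrightarrow> N (A f) \<le> M * N f" and f: "f \<in> H"
  shows "N ((A ^^ n) f) \<le> M ^ n * N f"
proof (induction n)
  case (Suc n)
  have "(A ^^ n) f \<in> H" using bopD(1)[OF bop_funpow[OF A] f] .
  then have "N ((A ^^ Suc n) f) \<le> M * N ((A ^^ n) f)" using M(2) by simp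
  also have "\<dots> \<le> M * (M ^ n * N f)" using Suc M(1) by (rule mult_left_mono)
  finally show ?case by (simp add: mult.assoc)
qed simp

lemma ess_norm_upper:
  assumes T1: "ess_norm H N T \<le> 1" and a: "a \<in> C_plus_Hinf"
  shows "ess_norm H N (toeplitz a) \<le> Linf_norm a"
proof (rule field_le_epsilon)
  fix e :: real assume e: "e > 0"
  obtain C where C: "C \<ge> 0" "\<forall>f\<in>X. N (riesz f) \<le> C * N f" using riesz_bound by blast
  have aL: "a \<in> Linf" using a by (simp add: C_plus_Hinf_def)
  note aB = Linf_bound[OF aL]
  \<comment> \<open>Replacing \<open>a\<close> by \<open>e\<^sub>-\<^sub>n h\<close> costs \<open>C \<delta>\<close>; the bound \<open>B\<close> of \<open>h\<close> and the choice of \<open>\<eta>\<close> cost another \<open>2 \<delta>\<close>.\<close>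
  define \<delta> where "\<delta> = e / (C + 2)"
  have "(C + 2) * \<delta> = e" using C(1) by (simp add: \<delta>_def)
  moreover have "\<delta> > 0" using e C(1) by (simp add: \<delta>_def)
  ultimately have \<delta>: "\<delta> > 0" "C * \<delta> + 2 * \<delta> = e" by (simp_all only: distrib_right)
  obtain n h where h: "analytic_L1 h" "AE t in circle. cmod (h t) \<le> Linf_norm a + \<delta>"
    "AE t in circle. cmod (a t - mon (- int n) t * h t) \<le> \<delta>"
    using C_plus_Hinf_approx[OF a \<delta>(1)] .
  define B where "B = Linf_norm a + \<delta>"
  have B: "B \<ge> 0" using aB(3) \<delta>(1) by (simp add: B_def)
  have hm[measurable]: "h \<in> borel_measurable circle" using h(1) by (auto simp: analytic_L1_def)
  note am[measurable] = aB(1)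
  have "((\<lambda>\<eta>. (1 + \<eta>) ^ n * B) \<longlongrightarrow> (1 + 0) ^ n * B) (at_right 0)" by (intro tendsto_intros)
  then have "\<forall>\<^sub>F \<eta> in at_right 0. (1 + \<eta>) ^ n * B < B + \<delta>" using \<delta>(1) by (intro order_tendstoD(2)) auto
  then have "\<forall>\<^sub>F \<eta> in at_right 0. 0 < \<eta> \<and> (1 + \<eta>) ^ n * B < B + \<delta>"
    using eventually_at_right_less by eventually_elim simp
  then obtain \<eta> where \<eta>: "\<eta> > 0" "(1 + \<eta>) ^ n * B < B + \<delta>"
    using eventually_happens'[OF trivial_limit_at_right_real] by blast
  obtain K where K: "cop K" "\<And>f. f \<in> H \<Longrightarrow> N (\<lambda>t. T f t - K f t) \<le> (1 + \<eta>) * N f"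
    using ess_norm_lessE[OF bop_homog[OF T_bop], of "1 + \<eta>"] T1 \<eta>(1) by auto
  \<comment> \<open>The operator \<open>A\<close> is the nearly contractive one, and \<open>L\<close> the compact operator to be subtracted.\<close>
  define A where "A f t = T f t - K f t" for f t
  have A: "bop A" unfolding A_def[abs_def] by (rule bop_diff[OF T_bop cop_bop[OF K(1)]])
  have AK: "cop (\<lambda>f t. T f t - A f t)" using K(1) by (simp add: A_def)
  have Bh: "bop (\<lambda>f t. h t * f t)" by (rule bop_mult[OF h(1) h(2)[folded B_def] B])
  define L where "L f t = (T ^^ n) (\<lambda>t. h t * f t) t - (A ^^ n) (\<lambda>t. h t * f t) t" for f t
  have L: "cop L" unfolding L_def[abs_def] using compact_power_diff[OF T_bop A AK Bh, of n] by blast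
  have "ess_norm H N (toeplitz a) \<le> C * \<delta> + (B + \<delta>)"
  proof (rule ess_norm_le[OF toeplitz_homog[OF aB] L])
    show "0 \<le> C * \<delta> + (B + \<delta>)" using C(1) \<delta>(1) B by simp
    fix f assume f: "f \<in> H"
    have fX: "f \<in> X" by (rule hardy_X[OF f])
    define d where "d t = a t - mon (- int n) t * h t" for t
    have dm: "d \<in> borel_measurable circle" unfolding d_def[abs_def] by measurable
    have d: "(\<lambda>t. d t * f t) \<in> X" "N (\<lambda>t. d t * f t) \<le> \<delta> * N f"
      using X_mult[OF fX dm, of \<delta>] h(3) \<delta>(1) by (auto simp: d_def)
    have hf: "(\<lambda>t. h t * f t) \<in> H" "N (\<lambda>t. h t * f t) \<le> B * N f"
      using hardy_mult[OF f h(1) h(2)[folded B_def] B] by auto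
    have Ah: "(A ^^ n) (\<lambda>t. h t * f t) \<in> H" by (rule bopD(1)[OF bop_funpow[OF A] hf(1)])
    have split: "(\<lambda>t. a t * f t) = (\<lambda>t. d t * f t + mon (- int n) t * (h t * f t))"
      by (simp add: d_def fun_eq_iff algebra_simps)
    have "AE t in circle. toeplitz a f t = riesz (\<lambda>t. d t * f t) t + riesz (\<lambda>t. mon (- int n) t * (h t * f t)) t"
      unfolding toeplitz_def split by (rule riesz_add[OF d(1) X_mon(1)[OF hardy_X[OF hf(1)]]])
    then have "AE t in circle. riesz (\<lambda>t. d t * f t) t + (A ^^ n) (\<lambda>t. h t * f t) t = toeplitz a f t - L f t"
      using T_power[OF hf(1), of n] unfolding L_def by eventually_elim simp
    moreover have "toeplitz a f \<in> X" "L f \<in> X"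
      using toeplitz_homog[OF aB] f bopD(1)[OF cop_bop[OF L] f] hardy_X unfolding homog_bounded_def by auto
    ultimately have "N (\<lambda>t. toeplitz a f t - L f t) = N (\<lambda>t. riesz (\<lambda>t. d t * f t) t + (A ^^ n) (\<lambda>t. h t * f t) t)"
      by (intro X_AE_cong(2)[OF X_add(1)[OF riesz_X[OF d(1)] hardy_X[OF Ah]]] X_measurable X_diff(1))
    also have "\<dots> \<le> N (riesz (\<lambda>t. d t * f t)) + N ((A ^^ n) (\<lambda>t. h t * f t))"
      by (rule X_add(2)[OF riesz_X[OF d(1)] hardy_X[OF Ah]])
    also have "\<dots> \<le> C * (\<delta> * N f) + (1 + \<eta>) ^ n * (B * N f)"
    proof (rule add_mono)
      have "N (riesz (\<lambda>t. d t * f t)) \<le> C * N (\<lambda>t. d t * f t)" using C(2) d(1) by blast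
      also have "\<dots> \<le> C * (\<delta> * N f)" using C(1) d(2) by (intro mult_left_mono)
      finally show "N (riesz (\<lambda>t. d t * f t)) \<le> C * (\<delta> * N f)" .
      have "N ((A ^^ n) (\<lambda>t. h t * f t)) \<le> (1 + \<eta>) ^ n * N (\<lambda>t. h t * f t)"
        by (rule power_bound[OF A _ _ hf(1)]) (use \<eta>(1) K(2) in \<open>auto simp: A_def[abs_def]\<close>)
      also have "\<dots> \<le> (1 + \<eta>) ^ n * (B * N f)" using \<eta>(1) hf(2) by (intro mult_left_mono) auto
      finally show "N ((A ^^ n) (\<lambda>t. h t * f t)) \<le> (1 + \<eta>) ^ n * (B * N f)" .
    qed
    also have "\<dots> = (C * \<delta> + (1 + \<eta>) ^ n * B) * N f" by (simp add: algebra_simps)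
    also have "\<dots> \<le> (C * \<delta> + (B + \<delta>)) * N f" using \<eta>(2) by (intro mult_right_mono) auto
    finally show "N (\<lambda>t. toeplitz a f t - L f t) \<le> (C * \<delta> + (B + \<delta>)) * N f" .
  qed
  also have "\<dots> = Linf_norm a + e" using \<delta>(2) by (simp add: B_def)
  finally show "ess_norm H N (toeplitz a) \<le> Linf_norm a + e" .
qed

section \<open>The lower estimate\<close>

text \<open>The norm of \<open>h f\<close> is recovered from the images of \<open>e\<^sub>n\<^sub>+\<^sub>m f\<close>: these are \<open>e\<^sub>n h f\<close> up to \<open>K\<close>, and the
  compact part is averaged away.\<close>
lemma limit_of_shifted_images:
  assumes h: "analytic_L1 h" "AE t in circle. cmod (h t) \<le> B" "B \<ge> 0"
    and K: "cop K" and M: "M \<ge> 0"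
    and bound: "\<And>f. f \<in> H \<Longrightarrow> N (\<lambda>t. riesz (\<lambda>s. mon (- int m) s * h s * f s) t - K f t) \<le> M * N f"
    and f: "f \<in> H" and f1: "N f \<le> 1"
  shows "N (\<lambda>t. h t * f t) \<le> M * N f"
proof (rule field_le_epsilon)
  fix \<delta> :: real assume \<delta>: "\<delta> > 0"
  have hf: "(\<lambda>t. h t * f t) \<in> H" using hardy_mult[OF f h] by auto
  have hfX: "(\<lambda>t. h t * f t) \<in> X" by (rule hardy_X[OF hf])
  define F where "F n t = mon (int (n + m)) t * f t" for n t
  have F: "F n \<in> H" for n unfolding F_def by (rule hardy_mon[OF f]) simp
  have FN: "N (F n) = N f" for n unfolding F_def by (rule X_mon(2)[OF hardy_X[OF f]])
  have F1: "N (F n) \<le> 1" for n using FN f1 by simp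
  have KF: "K (F n) \<in> H" for n by (rule bopD(1)[OF cop_bop[OF K] F])
  obtain r0 g where rg: "strict_mono r0" "g \<in> H" "(\<lambda>n. N (\<lambda>t. K (F (r0 n)) t - g t)) \<longlonglongrightarrow> 0"
    using copD[OF K F F1] .
  have gX: "g \<in> X" by (rule hardy_X[OF rg(2)])
  have "\<forall>\<^sub>F n in sequentially. N (\<lambda>t. K (F (r0 n)) t - g t) < \<delta>" by (rule order_tendstoD(2)[OF rg(3) \<delta>])
  then obtain n0 where n0: "\<forall>n\<ge>n0. N (\<lambda>t. K (F (r0 n)) t - g t) < \<delta>" unfolding eventually_sequentially by (rule exE)
  \<comment> \<open>Starting the subsequence late makes the error at most \<open>\<delta>\<close> for all its members, hence for
    the averages too.\<close>
  define r where "r n = r0 (n0 + n)" for n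
  have injr: "inj (\<lambda>n. - int (r n))"
  proof (rule injI)
    fix x y assume "- int (r x) = - int (r y)"
    then have "r0 (n0 + x) = r0 (n0 + y)" by (simp add: r_def)
    then show "x = y" unfolding strict_mono_eq[OF rg(1)] by simp
  qed
  \<comment> \<open>Multiplication by the unimodular function with exponent \<open>- r n\<close> keeps the norm and brings the image back to \<open>h f\<close>.\<close>
  define v where "v n t = h t * f t - mon (- int (r n)) t * g t" for n t
  have vX: "v n \<in> X" for n unfolding v_def by (rule X_diff(1)[OF hfX X_mon(1)[OF gX]])
  have Nv: "N (v n) \<le> M * N f + \<delta>" for n
  proof -
    define u where "u t = mon (int (r n)) t * (h t * f t) - g t" for t
    define p where "p t = riesz (\<lambda>s. mon (- int m) s * h s * F (r n) s) t - K (F (r n)) t" for t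
    have uX: "u \<in> X" unfolding u_def by (rule X_diff(1)[OF X_mon(1)[OF hfX] gX])
    have shift: "(\<lambda>s. mon (int (r n)) s * (h s * f s)) \<in> H" by (rule hardy_mon[OF hf]) simp
    have hFX: "(\<lambda>s. mon (- int m) s * h s * F (r n) s) \<in> X"
      using X_mon(1)[OF hardy_X[OF hardy_mult(1)[OF F h]], of "- int m"] by (simp add: mult.assoc)
    have eqs: "AE t in circle. mon (- int m) t * h t * F (r n) t = mon (int (r n)) t * (h t * f t)"
    proof (rule AE_I2)
      fix t assume t: "t \<in> space circle"
      have "mon (- int m) t * h t * F (r n) t = (mon (- int m) t * mon (int (r n + m)) t) * (h t * f t)"
        by (simp add: F_def)
      also have "mon (- int m) t * mon (int (r n + m)) t = mon (int (r n)) t" by (simp add: mon_add[OF t])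
      finally show "mon (- int m) t * h t * F (r n) t = mon (int (r n)) t * (h t * f t)" .
    qed
    have rz: "AE t in circle. riesz (\<lambda>s. mon (- int m) s * h s * F (r n) s) t = mon (int (r n)) t * (h t * f t)"
      using riesz_cong[OF hFX hardy_X[OF shift] eqs] riesz_hardy[OF shift] by eventually_elim simp
    have pX: "p \<in> X" unfolding p_def by (rule X_diff(1)[OF riesz_X[OF hFX] hardy_X[OF KF]])
    have eX: "(\<lambda>t. K (F (r n)) t - g t) \<in> X" by (rule X_diff(1)[OF hardy_X[OF KF] gX])
    have "AE t in circle. p t + (K (F (r n)) t - g t) = u t"
      using rz unfolding p_def u_def by eventually_elim simp
    then have "N u = N (\<lambda>t. p t + (K (F (r n)) t - g t))"
      by (rule X_AE_cong(2)[OF X_add(1)[OF pX eX] X_measurable[OF uX]])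
    also have "\<dots> \<le> N p + N (\<lambda>t. K (F (r n)) t - g t)" by (rule X_add(2)[OF pX eX])
    also have "\<dots> \<le> M * N f + \<delta>"
      using bound[OF F, of "r n"] n0[rule_format, of "n0 + n"] FN[of "r n"] by (intro add_mono) (auto simp: p_def[abs_def] r_def)
    finally have Nu: "N u \<le> M * N f + \<delta>" .
    have "AE t in circle. mon (- int (r n)) t * u t = v n t"
    proof (rule AE_I2)
      fix t assume t: "t \<in> space circle"
      have "mon (- int (r n)) t * u t = (mon (- int (r n)) t * mon (int (r n)) t) * (h t * f t) - mon (- int (r n)) t * g t"
        by (simp add: u_def algebra_simps)
      also have "mon (- int (r n)) t * mon (int (r n)) t = 1" by (simp add: mon_add[OF t])
      finally show "mon (- int (r n)) t * u t = v n t" by (simp add: v_def)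
    qed
    then have "N (v n) = N (\<lambda>t. mon (- int (r n)) t * u t)"
      by (rule X_AE_cong(2)[OF X_mon(1)[OF uX] X_measurable[OF vX]])
    also have "\<dots> = N u" by (rule X_mon(2)[OF uX])
    finally show ?thesis using Nu by simp
  qed
  obtain s where s: "strict_mono (s :: nat \<Rightarrow> nat)"
    "AE t in circle. (\<lambda>k. (\<Sum>n<Suc (s k). mon (- int (r n)) t) / of_nat (Suc (s k))) \<longlonglongrightarrow> 0"
    using averages_tend_to_0[OF injr] .
  define w where "w k t = of_real (1 / real (Suc k)) * (\<Sum>n<Suc k. v n t)" for k t
  have w: "w k \<in> X \<and> N (w k) \<le> M * N f + \<delta>" for k
  proof -
    have S: "(\<lambda>t. \<Sum>n<Suc k. v n t) \<in> X" "N (\<lambda>t. \<Sum>n<Suc k. v n t) \<le> (\<Sum>n<Suc k. N (v n))"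
      using X_sum[of "{..<Suc k}" v] vX by auto
    have "(\<Sum>n<Suc k. N (v n)) \<le> (\<Sum>n<Suc k. M * N f + \<delta>)" by (rule sum_mono) (rule Nv)
    then have le: "N (\<lambda>t. \<Sum>n<Suc k. v n t) \<le> real (Suc k) * (M * N f + \<delta>)" using S(2) by (simp add: algebra_simps)
    have "N (w k) = 1 / real (Suc k) * N (\<lambda>t. \<Sum>n<Suc k. v n t)"
      unfolding w_def X_scale(2)[OF S(1)] norm_of_real by simp
    also have "\<dots> \<le> 1 / real (Suc k) * (real (Suc k) * (M * N f + \<delta>))" by (rule mult_left_mono[OF le]) simp
    finally have "N (w k) \<le> M * N f + \<delta>" by simp
    then show ?thesis unfolding w_def using X_scale(1)[OF S(1)] by blast
  qed
  have weq: "w k t = h t * f t - ((\<Sum>n<Suc k. mon (- int (r n)) t) / of_nat (Suc k)) * g t" for k t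
  proof -
    have "(\<Sum>n<Suc k. v n t) = of_nat (Suc k) * (h t * f t) - (\<Sum>n<Suc k. mon (- int (r n)) t) * g t"
      unfolding v_def sum_subtractf sum_distrib_right by simp
    then have "w k t = of_real (1 / real (Suc k)) * (of_nat (Suc k) * (h t * f t) - (\<Sum>n<Suc k. mon (- int (r n)) t) * g t)"
      unfolding w_def by (simp only:)
    also have "\<dots> = h t * f t - ((\<Sum>n<Suc k. mon (- int (r n)) t) / of_nat (Suc k)) * g t"
      by (simp only: of_real_divide of_real_1 of_real_of_nat_eq right_diff_distrib) (simp del: sum.lessThan_Suc of_nat_Suc)
    finally show ?thesis .
  qed
  have lim: "AE t in circle. (\<lambda>k. w (s k) t) \<longlonglongrightarrow> h t * f t"
    using s(2)
  proof eventually_elim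
    case (elim t)
    have "(\<lambda>k. h t * f t - ((\<Sum>n<Suc (s k). mon (- int (r n)) t) / of_nat (Suc (s k))) * g t) \<longlonglongrightarrow> h t * f t - 0 * g t"
      by (intro tendsto_diff tendsto_mult tendsto_const elim)
    then show ?case unfolding weq by simp
  qed
  have wX: "w (s k) \<in> X" and wN: "N (w (s k)) \<le> M * N f + \<delta>" for k using w by simp_all
  show "N (\<lambda>t. h t * f t) \<le> M * N f + \<delta>"
    by (rule X_fatou(2)[of "\<lambda>k. w (s k)", OF wX wN lim X_measurable[OF hfX]])
qed

text \<open>A multiplier bound on all of the Hardy space can be iterated: applied to the powers of \<open>h\<close> it
  yields the hypothesis of \<open>power_sequence_bound\<close>.\<close>
lemma multiplier_bound:
  assumes h: "analytic_L1 h" "AE t in circle. cmod (h t) \<le> B" "B \<ge> 0"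
    and K: "cop K" and M: "M \<ge> 0"
    and bound: "\<And>f. f \<in> H \<Longrightarrow> N (\<lambda>t. riesz (\<lambda>s. mon (- int m) s * h s * f s) t - K f t) \<le> M * N f"
  shows "AE t in circle. cmod (h t) \<le> M"
proof -
  have hm: "h \<in> borel_measurable circle" using h(1) by (auto simp: analytic_L1_def)
  have mult: "N (\<lambda>t. h t * f t) \<le> M * N f" if f: "f \<in> H" for f
  proof (cases "N f \<le> 1")
    case True
    show ?thesis by (rule limit_of_shifted_images[OF h K M bound f True])
  next
    case False
    then have p: "N f > 0" by simp
    define c :: complex where "c = of_real (1 / N f)"
    have c: "cmod c = 1 / N f" using p by (simp add: c_def norm_divide)
    have u: "(\<lambda>t. c * f t) \<in> H" by (rule hardy_scale[OF f])
    have Nu: "N (\<lambda>t. c * f t) = 1" unfolding X_scale(2)[OF hardy_X[OF f]] c using p by simp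
    have hfX: "(\<lambda>t. h t * f t) \<in> X" using hardy_mult(1)[OF f h] by (rule hardy_X)
    have "N (\<lambda>t. h t * (c * f t)) \<le> M * 1"
      using limit_of_shifted_images[OF h K M bound u] Nu by simp
    also have "(\<lambda>t. h t * (c * f t)) = (\<lambda>t. c * (h t * f t))" by (simp add: mult.left_commute)
    finally have "1 / N f * N (\<lambda>t. h t * f t) \<le> M" unfolding X_scale(2)[OF hfX] c by simp
    then show ?thesis using p by (simp add: field_simps)
  qed
  have hk: "(\<lambda>t. h t ^ k) \<in> H" for k
  proof (induction k)
    case 0
    show ?case using hardy_1 by simp
  next
    case (Suc k)
    then show ?case using hardy_mult(1)[OF Suc h] by simp
  qed
  show ?thesis by (rule power_sequence_bound[OF hm hardy_X[OF hk] M mult[OF hk]])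
qed

lemma ess_norm_lower:
  assumes a: "a \<in> C_plus_Hinf"
  shows "Linf_norm a \<le> ess_norm H N (toeplitz a)"
proof -
  have aL: "a \<in> Linf" using a by (simp add: C_plus_Hinf_def)
  note aB = Linf_bound[OF aL]
  note am[measurable] = aB(1)
  obtain C where C: "C \<ge> 0" "\<forall>f\<in>X. N (riesz f) \<le> C * N f" using riesz_bound by blast
  show ?thesis
  proof (rule ess_norm_ge[OF toeplitz_homog[OF aB]])
    fix K M assume K: "cop K" and M: "M \<ge> 0" and le: "\<And>f. f \<in> H \<Longrightarrow> N (\<lambda>t. toeplitz a f t - K f t) \<le> M * N f"
    show "Linf_norm a \<le> M"
    proof (rule field_le_epsilon)
      fix e :: real assume e: "e > 0"
      \<comment> \<open>Replacing \<open>a\<close> by \<open>e\<^sub>-\<^sub>n h\<close> costs \<open>C \<delta>\<close> in the operator norm and \<open>\<delta>\<close> in the norm of the symbol.\<close>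
      define \<delta> where "\<delta> = e / (C + 1)"
      have "(C + 1) * \<delta> = e" using C(1) by (simp add: \<delta>_def)
      moreover have "\<delta> > 0" using e C(1) by (simp add: \<delta>_def)
      ultimately have \<delta>: "\<delta> > 0" "C * \<delta> + \<delta> = e" by (simp_all only: distrib_right mult_1)
      obtain n h where h: "analytic_L1 h" "AE t in circle. cmod (h t) \<le> Linf_norm a + \<delta>"
        "AE t in circle. cmod (a t - mon (- int n) t * h t) \<le> \<delta>"
        using C_plus_Hinf_approx[OF a \<delta>(1)] .
      have B: "Linf_norm a + \<delta> \<ge> 0" using aB(3) \<delta>(1) by simp
      have hm[measurable]: "h \<in> borel_measurable circle" using h(1) by (auto simp: analytic_L1_def)
      have "AE t in circle. cmod (h t) \<le> M + C * \<delta>"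
      proof (rule multiplier_bound[OF h(1,2) B K])
        show "0 \<le> M + C * \<delta>" using M C(1) \<delta>(1) by simp
        fix f assume f: "f \<in> H"
        have fX: "f \<in> X" by (rule hardy_X[OF f])
        define d where "d t = mon (- int n) t * h t - a t" for t
        have dm: "d \<in> borel_measurable circle" unfolding d_def[abs_def] by measurable
        have d: "(\<lambda>t. d t * f t) \<in> X" "N (\<lambda>t. d t * f t) \<le> \<delta> * N f"
          using X_mult[OF fX dm, of \<delta>] h(3) \<delta>(1) by (auto simp: d_def norm_minus_commute)
        have af: "(\<lambda>t. a t * f t) \<in> X" by (rule X_mult(1)[OF fX aB])
        have Kf: "K f \<in> X" by (rule hardy_X[OF bopD(1)[OF cop_bop[OF K] f]])
        have Ta: "toeplitz a f \<in> X" unfolding toeplitz_def by (rule riesz_X[OF af])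
        have split: "(\<lambda>s. mon (- int n) s * h s * f s) = (\<lambda>s. d s * f s + a s * f s)"
          by (simp add: d_def fun_eq_iff algebra_simps)
        have sX: "(\<lambda>s. mon (- int n) s * h s * f s) \<in> X" unfolding split by (rule X_add(1)[OF d(1) af])
        have "AE t in circle. riesz (\<lambda>s. mon (- int n) s * h s * f s) t = riesz (\<lambda>s. d s * f s) t + toeplitz a f t"
          unfolding split toeplitz_def by (rule riesz_add[OF d(1) af])
        then have "AE t in circle. riesz (\<lambda>s. d s * f s) t + (toeplitz a f t - K f t) = riesz (\<lambda>s. mon (- int n) s * h s * f s) t - K f t"
          by eventually_elim simp
        then have "N (\<lambda>t. riesz (\<lambda>s. mon (- int n) s * h s * f s) t - K f t) = N (\<lambda>t. riesz (\<lambda>s. d s * f s) t + (toeplitz a f t - K f t))"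
          by (rule X_AE_cong(2)[OF X_add(1)[OF riesz_X[OF d(1)] X_diff(1)[OF Ta Kf]] X_measurable[OF X_diff(1)[OF riesz_X[OF sX] Kf]]])
        also have "\<dots> \<le> N (riesz (\<lambda>s. d s * f s)) + N (\<lambda>t. toeplitz a f t - K f t)"
          by (rule X_add(2)[OF riesz_X[OF d(1)] X_diff(1)[OF Ta Kf]])
        also have "\<dots> \<le> C * (\<delta> * N f) + M * N f"
        proof (rule add_mono[OF _ le[OF f]])
          have "N (riesz (\<lambda>t. d t * f t)) \<le> C * N (\<lambda>t. d t * f t)" using C(2) d(1) by blast
          also have "\<dots> \<le> C * (\<delta> * N f)" using C(1) d(2) by (intro mult_left_mono)
          finally show "N (riesz (\<lambda>t. d t * f t)) \<le> C * (\<delta> * N f)" .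
        qed
        finally show "N (\<lambda>t. riesz (\<lambda>s. mon (- int n) s * h s * f s) t - K f t) \<le> (M + C * \<delta>) * N f"
          by (simp add: algebra_simps)
      qed
      then have "AE t in circle. cmod (a t) \<le> M + e"
        using h(3) AE_space
      proof eventually_elim
        case (elim t)
        have "cmod (a t) = cmod ((a t - mon (- int n) t * h t) + mon (- int n) t * h t)" by simp
        also have "\<dots> \<le> cmod (a t - mon (- int n) t * h t) + cmod (mon (- int n) t * h t)" by (rule norm_triangle_ineq)
        also have "cmod (mon (- int n) t * h t) = cmod (h t)" using elim(3) by (simp add: norm_mult cmod_mon del: space_circle)
        finally show ?case using elim(1,2) \<delta>(2) by linarith
      qed
      then show "Linf_norm a \<le> M + e" using M e by (intro Linf_I(2)) auto
    qed
  qed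
qed

end

section \<open>The equivalence\<close>

lemma mon_in_C_plus_Hinf: "mon n \<in> C_plus_Hinf" and Linf_norm_mon: "Linf_norm (mon n) = 1"
proof -
  have b: "AE t in circle. cmod (mon n t) \<le> 1" by (rule AE_I2) (simp add: cmod_mon del: space_circle)
  have L: "mon n \<in> Linf" and le: "Linf_norm (mon n) \<le> 1" using Linf_I[OF mon_measurable b] by auto
  have z: "(\<lambda>t. 0) \<in> Hinf"
    using Linf_I(1)[of "\<lambda>t. 0" 0] by (simp add: hardy_def fourier_coeff_def)
  have c: "continuous_on (sphere 0 1) (mon n)"
    unfolding mon_def[abs_def] by (intro continuous_intros) auto
  show "mon n \<in> C_plus_Hinf" unfolding C_plus_Hinf_def
  proof (intro CollectI conjI L exI)
    show "AE t in circle. mon n t = mon n t + 0" by simp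
  qed (rule c z)+
  have "AE t in circle. 1 \<le> Linf_norm (mon n)"
    using Linf_bound(2)[OF L] AE_space by eventually_elim (simp add: cmod_mon del: space_circle)
  then have "1 \<le> Linf_norm (mon n)" by simp
  then show "Linf_norm (mon n) = 1" using le by simp
qed

theorem theorem1p2:
  fixes \<rho> :: "(complex \<Rightarrow> ennreal) \<Rightarrow> ennreal"
  assumes "banach_function_norm \<rho>"
    and "bounded_op (bfs \<rho>) (bfs_norm \<rho>) riesz"
  shows "ess_norm (hardy \<rho>) (bfs_norm \<rho>) (toeplitz (mon (-1))) = 1 \<longleftrightarrow>
         (\<forall>a\<in>C_plus_Hinf. ess_norm (hardy \<rho>) (bfs_norm \<rho>) (toeplitz a) = Linf_norm a)"
proof -
  interpret riesz_bounded \<rho> by unfold_locales (rule assms)+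
  show ?thesis
  proof
    assume "ess_norm (hardy \<rho>) (bfs_norm \<rho>) (toeplitz (mon (-1))) = 1"
    then show "\<forall>a\<in>C_plus_Hinf. ess_norm (hardy \<rho>) (bfs_norm \<rho>) (toeplitz a) = Linf_norm a"
      by (intro ballI antisym ess_norm_upper ess_norm_lower) auto
  next
    assume "\<forall>a\<in>C_plus_Hinf. ess_norm (hardy \<rho>) (bfs_norm \<rho>) (toeplitz a) = Linf_norm a"
    then show "ess_norm (hardy \<rho>) (bfs_norm \<rho>) (toeplitz (mon (-1))) = 1"
      using mon_in_C_plus_Hinf[of "-1"] Linf_norm_mon[of "-1"] by simp
  qed
qed

end
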